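(* Let $\sigma>2$. There exist $\varepsilon>0$ and a constant $C$ such that whenever $\|\{u_n(0)\}\|_{l^{5/4}(\mathbb Z)}\le\varepsilon$ and $\|\{\partial_tu_n(0)\}\|_{l^{5/4}(\mathbb Z)}\le\varepsilon$, the solution of the one-dimensional discrete nonlinear Klein-Gordon equation (with either choice of sign) $$\partial_t^2u_n(t)-(\Delta_d u)_n(t)+u_n(t)\pm|u_n(t)|^{2\sigma}u_n(t)=0,\qquad n\in\mathbb Z,$$ with this initial data satisfies, for all $p$ with $2\le p\le5$, $$\|\{u_n(t)\}\|_{l^p}\le C\,t^{-(p-2)/(3p)}\,\|\{u_n(0)\}\|_{l^{p'}}.$$ In particular, there are no small standing wave solutions of this equation: there is no nonzero solution of the form $u_n(t)=e^{i\Lambda t}\phi_n$ ($\Lambda\in\mathbb R$) whose initial data satisfies the two smallness conditions above.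
   Context: The one-dimensional discrete Laplacian (lattice spacing $1$) is $(\Delta_d u)_n=u_{n+1}+u_{n-1}-2u_n$, $n\in\mathbb Z$. The spaces $l^p=l^p(\mathbb Z)$ are the usual sequence spaces, $t>0$ is time, and $p'$ is the Hölder conjugate of $p$, $1/p+1/p'=1$.
   Formalization: The right side of the decay estimate is the l^{p'} norm of u(0) plus that of ∂_t u(0); with only u(0), as printed, it fails for u(0)=0 and ∂_t u(0) a small nonzero multiple of a delta sequence. *)

theory Defs
  imports "HOL-Analysis.Analysis"
begin

definition lp_space :: "real \<Rightarrow> (int \<Rightarrow> complex) set" where
  "lp_space p = {x. (\<lambda>n. norm (x n) powr p) summable_on UNIV}"

(* Meaningful only for members of lp_space p: infsum is 0 for families that are not summable. *)
definition lp_norm :: "real \<Rightarrow> (int \<Rightarrow> complex) \<Rightarrow> real" where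
  "lp_norm p x = (\<Sum>\<^sub>\<infinity>n. norm (x n) powr p) powr (1 / p)"

definition lp_ball :: "real \<Rightarrow> real \<Rightarrow> (int \<Rightarrow> complex) set" where
  "lp_ball p r = {x \<in> lp_space p. lp_norm p x \<le> r}"

definition disc_laplacian :: "(int \<Rightarrow> complex) \<Rightarrow> int \<Rightarrow> complex" where
  "disc_laplacian x n = x (n + 1) + x (n - 1) - 2 * x n"

(* Componentwise time derivative on the half line t \<ge> 0, one-sided at t = 0. *)
definition time_deriv :: "(real \<Rightarrow> int \<Rightarrow> complex) \<Rightarrow> real \<Rightarrow> int \<Rightarrow> complex" where
  "time_deriv u t n = vector_derivative (\<lambda>s. u s n) (at t within {0..})"

definition l2_continuous :: "(real \<Rightarrow> int \<Rightarrow> complex) \<Rightarrow> bool" where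
  "l2_continuous u \<longleftrightarrow>
     (\<forall>t\<ge>0. u t \<in> lp_space 2) \<and>
     (\<forall>t\<ge>0. ((\<lambda>s. lp_norm 2 (\<lambda>n. u s n - u t n)) \<longlongrightarrow> 0) (at t within {0..}))"

(* Global forward solution of the equation with nonlinearity a * |u|^(2 sigma) * u, in the energy
   class: u and its time derivative are continuous from [0,\<infinity>) to l^2. Without such a class
   the Cauchy problem on the infinite lattice has no unique solution. *)
definition dnkg_solution :: "real \<Rightarrow> real \<Rightarrow> (real \<Rightarrow> int \<Rightarrow> complex) \<Rightarrow> bool" where
  "dnkg_solution a \<sigma> u \<longleftrightarrow>
     l2_continuous u \<and> l2_continuous (time_deriv u) \<and>
     (\<forall>t\<ge>0. \<forall>n.
        (\<lambda>s. u s n) differentiable (at t within {0..}) \<and>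
        (\<lambda>s. time_deriv u s n) differentiable (at t within {0..}) \<and>
        time_deriv (time_deriv u) t n - disc_laplacian (u t) n + u t n
          + of_real (a * norm (u t n) powr (2 * \<sigma>)) * u t n = 0)"

end

theory Submission
  imports Defs "HOL-Complex_Analysis.Conformal_Mappings"
begin

text \<open>
  The solution operators of the linear equation are convolutions with the kernels of
  $\sin(t\omega)/\omega$ and $\cos(t\omega)$, where $\omega(\xi) = \sqrt{3 - 2\cos\xi}$.  Since
  $\omega''$ has a simple zero, van der Corput's lemma bounds the kernels by $C t^{-1/3}$ and,
  away from the two wave fronts $|n| = ct$, by $C (t\,||n| - ct|)^{-1/4}$; the latter makes their
  $l^5$ norm $O(t^{-1/4})$.  Parseval and Riesz-Thorin give the $l^{p'} \to l^p$ decay rate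
  $(p-2)/(3p)$, and the $l^5$ bound on the kernel gives $l^{5/4} \to l^\infty$ decay at rate $1/4$.

  The rate $1/4$ in $l^\infty$ is what makes the estimate close for every $p$ down to $p = 2$: together
  with the rate $1/5$ in $l^5$, the potential $|u|^{2\sigma}$ maps $l^p$ to $l^{p'}$ with a norm that
  decays like $t^{-\sigma/2}$ relative to the expected decay, and $\sigma/2 > 1$ makes this integrable.  A
  continuity argument keeps the two norms small, after which Duhamel's formula is a linear
  inequality for the $l^p$ norm of $u$.  A standing wave has constant $l^5$ norm, so it vanishes.

  All norms are handled through finite sums, and Duhamel's formula is proved by testing a given
  solution against the kernels on a finite window, whose boundary terms vanish by the rapid
  decay of the kernels outside the light cone.
\<close>

section \<open>Van der Corput estimates\<close>

text \<open>Why two decay rates are tracked. For p = 5 the l^5 rate alone would do: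
  \<open>|u|^(2\<sigma>) u\<close> is bounded in l^(5/4) by the power 2\<sigma>+1 of the l^5 norm,
  hence by t^(-(2\<sigma>+1)/5), integrable at infinity exactly for \<sigma> > 2. For p = 2 the
  nonlinearity multiplies l^2 by \<open>|u|^(2\<sigma>)\<close>, so the sup norm matters; the
  embedding of l^5 gives it only the rate 1/5, and 2\<sigma>/5 > 1 would demand \<sigma> > 5/2. The
  rate 1/4 brings the condition back to \<sigma>/2 > 1. It is available because 5 > 4: the
  fourth-root profile of the kernel at a wave front is in l^p, uniformly, only for p > 4. Integrals
  of unknown functions are avoided throughout: an increment is compared with the increment of an
  explicit majorant whose derivative dominates, which is the mean value inequality below. Its l^2
  version serves existence, and in Duhamel's formula the majorant is a primitive of the bound on the
  forcing.\<close>

lemma norm_diff_le_majorant: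
  fixes f :: "real \<Rightarrow> 'a::real_normed_vector"
  assumes "a \<le> b"
    and f: "\<And>x. x \<in> {a..b} \<Longrightarrow> (f has_vector_derivative f' x) (at x within {a..b})"
    and g: "\<And>x. x \<in> {a..b} \<Longrightarrow> (g has_real_derivative g' x) (at x within {a..b})"
    and le: "\<And>x. x \<in> {a..b} \<Longrightarrow> norm (f' x) \<le> g' x"
  shows "norm (f b - f a) \<le> g b - g a"
proof (cases "a = b")
  case False
  with assms(1) have "a < b" by simp
  then show ?thesis
  proof (rule differentiable_bound_general)
    show "continuous_on {a..b} f" "continuous_on {a..b} g"
      using continuous_on_vector_derivative[OF f] DERIV_continuous_on[OF g] by blast+
    fix x assume x: "a < x" "x < b"
    then have eq: "at x within {a..b} = at x" by (simp add: at_within_Icc_at)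
    show "(f has_vector_derivative f' x) (at x)" using f[of x] x eq by auto
    show "(g has_vector_derivative g' x) (at x)"
      using g[of x] x eq by (auto simp: has_real_derivative_iff_has_vector_derivative)
    show "norm (f' x) \<le> g' x" using le x by auto
  qed
qed auto

text \<open>The majorants of every iterated estimate (kernels outside the cone, Picard increments,
  uniqueness): passing from k+1 to k by differentiation costs exactly the factor
  \<open>L\<close>.\<close>

lemma power_fact_deriv:
  "((\<lambda>s. B * (L * s) ^ Suc k / fact (Suc k)) has_real_derivative L * (B * (L * s) ^ k / fact k)) (at s within S)"
proof -
  have "((\<lambda>s::real. L * s) has_real_derivative L) (at s within S)"
    by (auto intro!: derivative_eq_intros)
  from DERIV_cmult[OF DERIV_cdivide[OF DERIV_power_Suc[OF this, of k], of "fact (Suc k)"], of B]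
  have "((\<lambda>s. B * (L * s) ^ Suc k / fact (Suc k)) has_real_derivative
      B * ((real (Suc k) * (L * (L * s) ^ k)) / fact (Suc k))) (at s within S)"
    by (simp del: fact_Suc power_Suc add: add.commute)
  moreover have "B * ((c * (L * x)) / (c * y)) = L * (B * x / y)" if "c \<noteq> 0" for c x y :: real
    using that by simp
  ultimately show ?thesis by (simp only: fact_Suc of_nat_mult of_nat_neq_0 simp_thms)
qed

text \<open>Integration by parts, with the integral represented by an antiderivative
  \<open>H\<close>: the derivative of \<open>H + cos \<phi> / \<phi>'\<close> is
  \<open>- cos \<phi> * \<phi>'' / \<phi>'^2\<close>, dominated by the derivative of
  \<open>1 / \<phi>'\<close> up to sign. As that has a constant sign, the variation is at most 1/l;
  the two boundary terms add 1/l each.\<close>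

lemma van_der_Corput_first:
  fixes \<phi> :: "real \<Rightarrow> real"
  assumes ab: "a \<le> b" and l: "l > 0"
    and H: "\<And>x. x \<in> {a..b} \<Longrightarrow> (H has_real_derivative sin (\<phi> x)) (at x)"
    and p: "\<And>x. x \<in> {a..b} \<Longrightarrow> (\<phi> has_real_derivative \<phi>' x) (at x)"
    and p1: "\<And>x. x \<in> {a..b} \<Longrightarrow> (\<phi>' has_real_derivative \<phi>'' x) (at x)"
    and ge: "\<And>x. x \<in> {a..b} \<Longrightarrow> \<phi>' x \<ge> l"
    and sgn: "(\<forall>x\<in>{a..b}. \<phi>'' x \<ge> 0) \<or> (\<forall>x\<in>{a..b}. \<phi>'' x \<le> 0)"
  shows "\<bar>H b - H a\<bar> \<le> 3 / l"
proof -
  define f where "f x = H x + cos (\<phi> x) / \<phi>' x" for x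
  define f' where "f' x = - cos (\<phi> x) * \<phi>'' x / (\<phi>' x)^2" for x
  have df: "(f has_real_derivative f' x) (at x within {a..b})" if "x \<in> {a..b}" for x
  proof -
    have "\<phi>' x > 0" using ge[OF that] l by linarith
    then have "(f has_real_derivative f' x) (at x)"
      unfolding f_def f'_def
      by (auto intro!: derivative_eq_intros H[OF that] p[OF that] p1[OF that] simp: field_simps power2_eq_square)
    then show ?thesis using has_field_derivative_at_within by blast
  qed
  have dg: "((\<lambda>x. s / \<phi>' x) has_real_derivative - s * \<phi>'' x / (\<phi>' x)^2) (at x within {a..b})" if "x \<in> {a..b}" for x s
  proof -
    have "\<phi>' x > 0" using ge[OF that] l by linarith
    then have "((\<lambda>x. s / \<phi>' x) has_real_derivative - s * \<phi>'' x / (\<phi>' x)^2) (at x)"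
      by (auto intro!: derivative_eq_intros p1[OF that] simp: field_simps power2_eq_square)
    then show ?thesis using has_field_derivative_at_within by blast
  qed
  \<comment> \<open>\<open>s\<close> is minus the sign of \<open>\<phi>''\<close>, which makes
    \<open>s / \<phi>'\<close> a nondecreasing majorant for \<open>f\<close>.\<close>
  have main: "\<bar>f b - f a\<bar> \<le> s / \<phi>' b - s / \<phi>' a" if s: "\<And>x. x \<in> {a..b} \<Longrightarrow> \<bar>\<phi>'' x\<bar> = - s * \<phi>'' x" for s
  proof -
    have "norm (f b - f a) \<le> s / \<phi>' b - s / \<phi>' a"
    proof (rule norm_diff_le_majorant[OF ab, where f'=f' and g'="\<lambda>x. - s * \<phi>'' x / (\<phi>' x)^2"])
      fix x assume x: "x \<in> {a..b}"
      show "(f has_vector_derivative f' x) (at x within {a..b})"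
        using df[OF x] by (simp add: has_real_derivative_iff_has_vector_derivative)
      show "((\<lambda>x. s / \<phi>' x) has_real_derivative - s * \<phi>'' x / (\<phi>' x)^2) (at x within {a..b})"
        using dg[OF x] .
      have "norm (f' x) = \<bar>cos (\<phi> x)\<bar> * \<bar>\<phi>'' x\<bar> / (\<phi>' x)^2"
        by (simp add: f'_def abs_mult)
      also have "\<dots> \<le> 1 * \<bar>\<phi>'' x\<bar> / (\<phi>' x)^2"
        by (intro divide_right_mono mult_right_mono) auto
      finally show "norm (f' x) \<le> - s * \<phi>'' x / (\<phi>' x)^2" using s[OF x] by simp
    qed
    then show ?thesis by simp
  qed
  have pa: "\<phi>' a \<ge> l" "\<phi>' b \<ge> l" using ge ab by auto
  have inv: "0 \<le> 1 / \<phi>' a" "1 / \<phi>' a \<le> 1 / l" "0 \<le> 1 / \<phi>' b" "1 / \<phi>' b \<le> 1 / l"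
    using pa l by (auto intro!: divide_left_mono)
  have fab: "\<bar>f b - f a\<bar> \<le> 1 / l"
    using sgn
  proof
    assume "\<forall>x\<in>{a..b}. \<phi>'' x \<ge> 0"
    then have "\<bar>f b - f a\<bar> \<le> -1 / \<phi>' b - -1 / \<phi>' a" by (intro main) auto
    then have "\<bar>f b - f a\<bar> \<le> 1 / \<phi>' a - 1 / \<phi>' b" by simp
    then show ?thesis using inv by linarith
  next
    assume "\<forall>x\<in>{a..b}. \<phi>'' x \<le> 0"
    then have "\<bar>f b - f a\<bar> \<le> 1 / \<phi>' b - 1 / \<phi>' a" by (intro main) auto
    then show ?thesis using inv by linarith
  qed
  have c: "\<bar>cos (\<phi> x) / \<phi>' x\<bar> \<le> 1 / l" if "\<phi>' x \<ge> l" for x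
    using that l by (auto simp: abs_div intro!: frac_le)
  have "H b - H a = (f b - f a) - cos (\<phi> b) / \<phi>' b + cos (\<phi> a) / \<phi>' a" by (simp add: f_def)
  then have "\<bar>H b - H a\<bar> \<le> 1 / l + 1 / l + 1 / l" using fab c[of a] c[of b] pa by linarith
  then show ?thesis by simp
qed

lemma van_der_Corput_first_neg:
  fixes \<phi> :: "real \<Rightarrow> real"
  assumes ab: "a \<le> b" and l: "l > 0"
    and H: "\<And>x. x \<in> {a..b} \<Longrightarrow> (H has_real_derivative sin (\<phi> x)) (at x)"
    and p: "\<And>x. x \<in> {a..b} \<Longrightarrow> (\<phi> has_real_derivative \<phi>' x) (at x)"
    and p1: "\<And>x. x \<in> {a..b} \<Longrightarrow> (\<phi>' has_real_derivative \<phi>'' x) (at x)"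
    and le: "\<And>x. x \<in> {a..b} \<Longrightarrow> \<phi>' x \<le> - l"
    and sgn: "(\<forall>x\<in>{a..b}. \<phi>'' x \<ge> 0) \<or> (\<forall>x\<in>{a..b}. \<phi>'' x \<le> 0)"
  shows "\<bar>H b - H a\<bar> \<le> 3 / l"
proof -
  have "\<bar>(\<lambda>x. - H x) b - (\<lambda>x. - H x) a\<bar> \<le> 3 / l"
    by (rule van_der_Corput_first[OF ab l, where \<phi>="\<lambda>x. - \<phi> x" and \<phi>'="\<lambda>x. - \<phi>' x" and \<phi>''="\<lambda>x. - \<phi>'' x"]) (use le sgn in \<open>fastforce intro!: derivative_eq_intros H p p1\<close>)+
  then show ?thesis by simp
qed

lemma antiderivative_sin_le:
  assumes "a \<le> b" and H: "\<And>x. x \<in> {a..b} \<Longrightarrow> (H has_real_derivative sin (\<phi> x)) (at x)"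
  shows "\<bar>H b - H a\<bar> \<le> b - a"
proof -
  have "norm (H b - H a) \<le> (\<lambda>x. x) b - (\<lambda>x. x) a"
    using assms(1)
  proof (rule norm_diff_le_majorant[where f'="\<lambda>x. sin (\<phi> x)" and g'="\<lambda>x. 1"])
    fix x assume "x \<in> {a..b}"
    from H[OF this] show "(H has_vector_derivative sin (\<phi> x)) (at x within {a..b})"
      using has_field_derivative_at_within has_real_derivative_iff_has_vector_derivative by blast
  qed (auto intro!: derivative_eq_intros)
  then show ?thesis by simp
qed

text \<open>\<open>\<phi>'\<close> grows at rate at least \<open>l\<close>, so it is small only near
  a single point. Within distance \<open>r\<close> of that point the integral is bounded by the
  length; further away \<open>|\<phi>'|\<close> is at least \<open>l r = sqrt l\<close> and the
  first-derivative test applies. Each side costs r + 3r.\<close>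

lemma van_der_Corput_second:
  fixes \<phi> :: "real \<Rightarrow> real"
  assumes ab: "a \<le> b" and l: "l > 0"
    and H: "\<And>x. x \<in> {a..b} \<Longrightarrow> (H has_real_derivative sin (\<phi> x)) (at x)"
    and p: "\<And>x. x \<in> {a..b} \<Longrightarrow> (\<phi> has_real_derivative \<phi>' x) (at x)"
    and p1: "\<And>x. x \<in> {a..b} \<Longrightarrow> (\<phi>' has_real_derivative \<phi>'' x) (at x)"
    and ge: "\<And>x. x \<in> {a..b} \<Longrightarrow> \<phi>'' x \<ge> l"
  shows "\<bar>H b - H a\<bar> \<le> 8 / sqrt l"
proof -
  define r where "r = 1 / sqrt l"
  have r: "r > 0" "l * r = sqrt l" using l by (auto simp: r_def field_simps)
  have mono: "\<phi>' y - \<phi>' x \<ge> l * (y - x)" if "x \<in> {a..b}" "y \<in> {a..b}" "x \<le> y" for x y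
  proof (cases "x = y")
    case False
    then have "x < y" using that by simp
    then have "\<exists>z>x. z < y \<and> \<phi>' y - \<phi>' x = (y - x) * \<phi>'' z"
      by (rule MVT2) (use p1 that in auto)
    then obtain z where "z > x" "z < y" "\<phi>' y - \<phi>' x = (y - x) * \<phi>'' z" by blast
    moreover have "\<phi>'' z \<ge> l" using ge[of z] calculation that by auto
    ultimately show ?thesis using that by (metis diff_ge_0_iff_ge mult.commute mult_left_mono)
  qed auto
  have right: "\<bar>H b - H z\<bar> \<le> 4 * r" if z: "z \<in> {a..b}" "\<phi>' z \<ge> 0" for z
  proof (cases "b \<le> z + r")
    case True
    have "\<bar>H b - H z\<bar> \<le> b - z" using z by (intro antiderivative_sin_le[where H=H and \<phi>=\<phi>] H) auto
    then show ?thesis using True r by linarith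
  next
    case False
    have 1: "\<bar>H (z + r) - H z\<bar> \<le> (z + r) - z"
      using z r False by (intro antiderivative_sin_le[where H=H and \<phi>=\<phi>] H) auto
    have 2: "\<bar>H b - H (z + r)\<bar> \<le> 3 / sqrt l"
    proof (rule van_der_Corput_first[where H=H and \<phi>=\<phi> and \<phi>'=\<phi>' and \<phi>''=\<phi>''])
      fix x assume x: "x \<in> {z + r..b}"
      then have x': "x \<in> {a..b}" using z r by auto
      have "sqrt l \<le> l * (x - z)" using x l unfolding r(2)[symmetric] by (intro mult_left_mono) auto
      then show "sqrt l \<le> \<phi>' x" using mono[of z x] z x' x r by auto
    next
      show "(\<forall>x\<in>{z + r..b}. 0 \<le> \<phi>'' x) \<or> (\<forall>x\<in>{z + r..b}. \<phi>'' x \<le> 0)"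
        using order_trans[OF less_imp_le[OF l] ge] z r by auto
    qed (use False l z r in \<open>auto intro!: H p p1\<close>)
    show ?thesis using 1 2 by (simp add: r_def)
  qed
  have left: "\<bar>H z - H a\<bar> \<le> 4 * r" if z: "z \<in> {a..b}" "\<phi>' z \<le> 0" for z
  proof (cases "z - r \<le> a")
    case True
    have "\<bar>H z - H a\<bar> \<le> z - a" using z by (intro antiderivative_sin_le[where H=H and \<phi>=\<phi>] H) auto
    then show ?thesis using True r by linarith
  next
    case False
    have 1: "\<bar>H z - H (z - r)\<bar> \<le> z - (z - r)"
      using z r False by (intro antiderivative_sin_le[where H=H and \<phi>=\<phi>] H) auto
    have 2: "\<bar>H (z - r) - H a\<bar> \<le> 3 / sqrt l"
    proof (rule van_der_Corput_first_neg[where H=H and \<phi>=\<phi> and \<phi>'=\<phi>' and \<phi>''=\<phi>''])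
      fix x assume x: "x \<in> {a..z - r}"
      then have x': "x \<in> {a..b}" using z r by auto
      have "sqrt l \<le> l * (z - x)" using x l unfolding r(2)[symmetric] by (intro mult_left_mono) auto
      then show "\<phi>' x \<le> - sqrt l" using mono[of x z] z x' x r by auto
    next
      show "(\<forall>x\<in>{a..z - r}. 0 \<le> \<phi>'' x) \<or> (\<forall>x\<in>{a..z - r}. \<phi>'' x \<le> 0)"
        using order_trans[OF less_imp_le[OF l] ge] z r by auto
    qed (use False l z r in \<open>auto intro!: H p p1\<close>)
    show ?thesis using 1 2 by (simp add: r_def)
  qed
  \<comment> \<open>If \<open>\<phi>'\<close> does not change sign from negative to positive, one of
    the two one-sided estimates, started at an endpoint, already covers the whole interval.\<close>
  have "\<bar>H b - H a\<bar> \<le> 8 * r"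
  proof (cases "\<phi>' a \<ge> 0 \<or> \<phi>' b \<le> 0")
    case True
    then show ?thesis using right[of a] left[of b] ab r by auto
  next
    case False
    have "continuous_on {a..b} \<phi>'" by (meson DERIV_continuous_on has_field_derivative_at_within p1)
    then obtain z where "z \<in> {a..b}" "\<phi>' z = 0"
      using IVT'[of \<phi>' a 0 b] False ab by auto
    then show ?thesis using right[of z] left[of z] by auto
  qed
  then show ?thesis by (simp add: r_def)
qed

lemma van_der_Corput_second_neg:
  fixes \<phi> :: "real \<Rightarrow> real"
  assumes ab: "a \<le> b" and l: "l > 0"
    and H: "\<And>x. x \<in> {a..b} \<Longrightarrow> (H has_real_derivative sin (\<phi> x)) (at x)"
    and p: "\<And>x. x \<in> {a..b} \<Longrightarrow> (\<phi> has_real_derivative \<phi>' x) (at x)"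
    and p1: "\<And>x. x \<in> {a..b} \<Longrightarrow> (\<phi>' has_real_derivative \<phi>'' x) (at x)"
    and le: "\<And>x. x \<in> {a..b} \<Longrightarrow> \<phi>'' x \<le> - l"
  shows "\<bar>H b - H a\<bar> \<le> 8 / sqrt l"
proof -
  have "\<bar>(\<lambda>x. - H x) b - (\<lambda>x. - H x) a\<bar> \<le> 8 / sqrt l"
    by (rule van_der_Corput_second[OF ab l, where \<phi>="\<lambda>x. - \<phi> x" and \<phi>'="\<lambda>x. - \<phi>' x" and \<phi>''="\<lambda>x. - \<phi>'' x"]) (use le in \<open>fastforce intro!: derivative_eq_intros H p p1\<close>)+
  then show ?thesis by simp
qed

section \<open>The dispersion relation\<close>

text \<open>On e^(i n \<xi>) the discrete Laplacian minus the identity acts as multiplication by 2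
  cos \<xi> - 3, that is, by minus the square of this frequency.\<close>

definition disp :: "real \<Rightarrow> real" where
  "disp \<xi> = sqrt (3 - 2 * cos \<xi>)"

definition disp'' :: "real \<Rightarrow> real" where
  "disp'' \<xi> = (cos \<xi> * (3 - 2 * cos \<xi>) - (sin \<xi>)\<^sup>2) / (disp \<xi>)^3"

text \<open>The root in $[-1,1]$ of $x^2 - 3x + 1$, to which the numerator of $\omega''$ reduces for $x = \cos\xi$.\<close>

definition infl_cos :: real where
  "infl_cos = (3 - sqrt 5) / 2"

definition infl :: real where
  "infl = arccos infl_cos"

text \<open>The group velocity \<open>sin \<xi> / disp \<xi>\<close> increases on [0, pi] up to
  \<open>infl\<close> and decreases after it, so this is its maximum: the speed of the wave
  fronts.\<close>

definition max_speed :: real where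
  "max_speed = sin infl / disp infl"

lemma disp_ge_1: "disp \<xi> \<ge> 1"
  using cos_le_one[of \<xi>] by (simp add: disp_def)

lemma disp_pos [simp]: "disp \<xi> > 0" "disp \<xi> \<noteq> 0"
  using disp_ge_1[of \<xi>] by auto

lemma disp_sq: "(disp \<xi>)\<^sup>2 = 3 - 2 * cos \<xi>"
  using cos_le_one[of \<xi>] by (simp add: disp_def del: cos_le_one)

lemma disp_le_3: "disp \<xi> \<le> 3"
  using cos_ge_minus_one[of \<xi>] by (simp add: disp_def real_sqrt_le_iff real_le_lsqrt del: cos_ge_minus_one)

lemma disp_deriv: "(disp has_real_derivative sin \<xi> / disp \<xi>) (at \<xi>)"
proof -
  have "3 - 2 * cos \<xi> > 0" using cos_le_one[of \<xi>] by (simp del: cos_le_one)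
  then show ?thesis
    unfolding disp_def by (auto intro!: derivative_eq_intros simp: field_simps)
qed

lemma disp_deriv2: "((\<lambda>\<xi>. sin \<xi> / disp \<xi>) has_real_derivative disp'' \<xi>) (at \<xi>)"
proof -
  have "(cos \<xi> * disp \<xi> - sin \<xi> * (sin \<xi> / disp \<xi>)) / (disp \<xi> * disp \<xi>) = disp'' \<xi>"
    unfolding disp''_def disp_sq[symmetric] by (simp add: field_simps power2_eq_square power3_eq_cube)
  then show ?thesis
    by (auto intro!: derivative_eq_intros disp_deriv)
qed

lemma sqrt5: "2 < sqrt (5::real)" "sqrt (5::real) < 3"
  by (rule real_less_rsqrt, simp add: power2_eq_square, rule real_less_lsqrt, auto simp: power2_eq_square)

lemma infl_props: "0 < infl" "infl < pi" "cos infl = infl_cos"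
proof -
  have c: "0 < infl_cos" "infl_cos < 1" using sqrt5 by (auto simp: infl_cos_def)
  show "cos infl = infl_cos" unfolding infl_def using c by (simp add: cos_arccos)
  show "0 < infl" "infl < pi" unfolding infl_def using c arccos_lt_bounded[of infl_cos] by auto
qed

text \<open>With x = cos \<xi> the numerator is -(x^2 - 3x + 1). The larger root (3 + sqrt 5)/2
  exceeds 1, so the second factor stays positive and the sign is that of the first.\<close>

lemma disp''_factor: "disp'' \<xi> = (cos \<xi> - infl_cos) * ((3 + sqrt 5) / 2 - cos \<xi>) / (disp \<xi>)^3"
proof -
  have "cos \<xi> * (3 - 2 * cos \<xi>) - (sin \<xi>)\<^sup>2 = (cos \<xi> - infl_cos) * ((3 + sqrt 5) / 2 - cos \<xi>)"
    unfolding sin_squared_eq infl_cos_def by (simp add: field_simps power2_eq_square)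
  then show ?thesis by (simp add: disp''_def)
qed

lemma sin_ge_half:
  assumes "0 \<le> y" "y \<le> pi / 2"
  shows "sin y \<ge> y / 2"
proof (cases "y \<le> pi / 3")
  case True
  show ?thesis
  proof (cases "y = 0")
    case False
    then have "\<exists>z>0. z < y \<and> sin y - sin 0 = (y - 0) * cos z"
      by (intro MVT2) (use assms in \<open>auto intro!: derivative_eq_intros\<close>)
    then obtain z where z: "0 < z" "z < y" "sin y = y * cos z" by auto
    have "cos z \<ge> cos (pi / 3)" using z True by (intro cos_monotone_0_pi_le) auto
    then have "y * (1/2) \<le> y * cos z" using assms by (intro mult_left_mono) (auto simp: cos_60)
    then show ?thesis using z by simp
  qed auto
next
  case False
  have "sin y \<ge> sin (pi / 3)" using False assms by (intro sin_monotone_2pi_le) auto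
  moreover have "sin (pi / 3) \<ge> (0.85::real)"
    unfolding sin_60 using real_le_rsqrt[of "1.7" 3] by (auto simp: power2_eq_square)
  ultimately show ?thesis using assms pi_less_4 pi_approx by simp
qed

text \<open>Interior values \<open>y\<close> are taken by cosine with nonzero slope. In the product
  formula the factor sin((x+y)/2) is bounded below by \<open>m\<close>, because (x+y)/2 stays
  between y/2 and (pi+y)/2, and the factor sin((y-x)/2) is comparable to its argument.\<close>

lemma cos_diff_lower:
  assumes "0 < y" "y < pi"
  obtains k where "k > 0" "\<And>x. 0 \<le> x \<Longrightarrow> x \<le> pi \<Longrightarrow> \<bar>cos x - cos y\<bar> \<ge> k * \<bar>x - y\<bar>"
proof -
  define m where "m = min (sin (y / 2)) (sin ((pi - y) / 2))"
  have m: "m > 0" unfolding m_def using assms by (auto intro!: sin_gt_zero)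
  have "\<bar>cos x - cos y\<bar> \<ge> (m / 2) * \<bar>x - y\<bar>" if x: "0 \<le> x" "x \<le> pi" for x
  proof -
    have 1: "sin ((x + y) / 2) \<ge> m"
    proof (cases "(x + y) / 2 \<le> pi / 2")
      case True
      have "sin ((x + y) / 2) \<ge> sin (y / 2)" using True assms x by (intro sin_monotone_2pi_le) auto
      then show ?thesis by (simp add: m_def)
    next
      case False
      have "sin (pi - (x + y) / 2) \<ge> sin ((pi - y) / 2)"
        using False assms x by (intro sin_monotone_2pi_le) (auto simp: field_simps)
      then show ?thesis by (simp add: m_def)
    qed
    have "sin (\<bar>y - x\<bar> / 2) \<ge> \<bar>y - x\<bar> / 2 / 2"
      by (intro sin_ge_half) (use assms x in auto)
    moreover have "\<bar>sin ((y - x) / 2)\<bar> \<ge> sin (\<bar>y - x\<bar> / 2)"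
    proof (cases "y \<ge> x")
      case False
      then have "\<bar>y - x\<bar> / 2 = - ((y - x) / 2)" by (auto simp: abs_if field_simps)
      then have "sin (\<bar>y - x\<bar> / 2) = - sin ((y - x) / 2)" by (simp only: sin_minus)
      then show ?thesis by linarith
    qed auto
    ultimately have 2: "\<bar>sin ((y - x) / 2)\<bar> \<ge> \<bar>x - y\<bar> / 4" by (simp add: abs_minus_commute)
    have "m * (\<bar>x - y\<bar> / 4) \<le> sin ((x + y) / 2) * \<bar>sin ((y - x) / 2)\<bar>"
      using 1 2 m by (intro mult_mono) auto
    moreover have "\<bar>cos x - cos y\<bar> = 2 * sin ((x + y) / 2) * \<bar>sin ((y - x) / 2)\<bar>"
      unfolding cos_diff_cos using 1 m by (simp add: abs_mult)
    ultimately show ?thesis by simp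
  qed
  then show ?thesis using that[of "m / 2"] m by auto
qed

text \<open>The quantitative form of the simple zero of \<omega>'' at \<open>infl\<close>; the loss
  of 27 is the cube of the crude bound 3 on \<open>disp\<close>.\<close>

lemma disp''_bounds:
  "\<exists>k>0. (\<forall>x. 0 \<le> x \<longrightarrow> x \<le> infl \<longrightarrow> disp'' x \<ge> k * (infl - x)) \<and>
    (\<forall>x. infl \<le> x \<longrightarrow> x \<le> pi \<longrightarrow> disp'' x \<le> - (k * (x - infl)))"
proof -
  obtain k where k: "k > 0" "\<And>x. 0 \<le> x \<Longrightarrow> x \<le> pi \<Longrightarrow> \<bar>cos x - cos infl\<bar> \<ge> k * \<bar>x - infl\<bar>"
    using cos_diff_lower infl_props by metis
  have lo: "1 / 27 \<le> ((3 + sqrt 5) / 2 - cos x) / (disp x)^3" for x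
  proof (rule frac_le)
    show "(disp x)^3 \<le> 27" using power_mono[OF disp_le_3[of x], of 3] disp_pos(1)[of x] by simp
    show "1 \<le> (3 + sqrt 5) / 2 - cos x" "0 \<le> (3 + sqrt 5) / 2 - cos x"
      using cos_le_one[of x] sqrt5 by (simp_all add: field_simps del: cos_le_one)
  qed auto
  have 1: "disp'' x \<ge> k / 27 * (infl - x)" if x: "0 \<le> x" "x \<le> infl" for x
  proof -
    have "cos x \<ge> cos infl" using x infl_props by (intro cos_monotone_0_pi_le) auto
    then have "cos x - infl_cos \<ge> k * (infl - x)" "cos x - infl_cos \<ge> 0"
      using k(2)[of x] x infl_props by simp_all
    then have "(cos x - infl_cos) * (((3 + sqrt 5) / 2 - cos x) / (disp x)^3) \<ge> (k * (infl - x)) * (1 / 27)"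
      using lo[of x] k x by (intro mult_mono) auto
    then show ?thesis by (simp add: disp''_factor)
  qed
  have 2: "disp'' x \<le> - (k / 27 * (x - infl))" if x: "infl \<le> x" "x \<le> pi" for x
  proof -
    have "cos x \<le> cos infl" using x infl_props by (intro cos_monotone_0_pi_le) auto
    then have "infl_cos - cos x \<ge> k * (x - infl)" "infl_cos - cos x \<ge> 0"
      using k(2)[of x] x infl_props by simp_all
    then have "(infl_cos - cos x) * (((3 + sqrt 5) / 2 - cos x) / (disp x)^3) \<ge> (k * (x - infl)) * (1 / 27)"
      using lo[of x] k x by (intro mult_mono) auto
    moreover have "disp'' x = - ((infl_cos - cos x) * (((3 + sqrt 5) / 2 - cos x) / (disp x)^3))"
      by (simp add: disp''_factor field_simps)
    ultimately show ?thesis by simp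
  qed
  show ?thesis using k(1) 1 2 by (intro exI[of _ "k / 27"]) auto
qed

lemma disp''_upper: "\<bar>disp'' x\<bar> \<le> 4 * \<bar>x - infl\<bar>"
proof -
  have "\<bar>cos x - cos infl\<bar> \<le> \<bar>x - infl\<bar>"
  proof -
    have "norm (cos x - cos infl) \<le> 1 * norm (x - infl)"
      by (rule field_differentiable_bound[of UNIV cos "\<lambda>x. - sin x"])
        (auto intro!: derivative_eq_intros)
    then show ?thesis by simp
  qed
  then have 1: "\<bar>cos x - infl_cos\<bar> \<le> \<bar>x - infl\<bar>" by (simp add: infl_props)
  have 2: "\<bar>(3 + sqrt 5) / 2 - cos x\<bar> \<le> 4"
    using cos_le_one[of x] cos_ge_minus_one[of x] sqrt5 unfolding abs_le_iff by (simp add: field_simps del: cos_le_one cos_ge_minus_one)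
  have 3: "1 \<le> (disp x)^3" using disp_ge_1[of x] by simp
  have "\<bar>disp'' x\<bar> = \<bar>cos x - infl_cos\<bar> * \<bar>(3 + sqrt 5) / 2 - cos x\<bar> / (disp x)^3"
    by (simp add: disp''_factor abs_mult power_abs abs_of_pos)
  also have "\<dots> \<le> (\<bar>x - infl\<bar> * 4) / 1"
    using 1 2 3 by (intro frac_le mult_mono) auto
  finally show ?thesis by simp
qed

text \<open>Mean value theorem from \<open>infl\<close> to x: the derivative of the group velocity
  is itself at most linear in the distance to \<open>infl\<close>, so the velocity leaves its
  maximum only quadratically.\<close>

lemma group_velocity_quadratic: "\<bar>sin x / disp x - max_speed\<bar> \<le> 4 * (x - infl)\<^sup>2"
proof -
  have "norm (sin x / disp x - sin infl / disp infl) \<le> (4 * \<bar>x - infl\<bar>) * norm (x - infl)"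
  proof (rule field_differentiable_bound[of "closed_segment infl x" "\<lambda>\<xi>. sin \<xi> / disp \<xi>" disp''])
    fix z assume z: "z \<in> closed_segment infl x"
    show "((\<lambda>\<xi>. sin \<xi> / disp \<xi>) has_field_derivative disp'' z) (at z within closed_segment infl x)"
      using disp_deriv2 has_field_derivative_at_within by blast
    have "\<bar>z - infl\<bar> \<le> \<bar>x - infl\<bar>" using z by (auto simp: closed_segment_eq_real_ivl split: if_splits)
    then show "norm (disp'' z) \<le> 4 * \<bar>x - infl\<bar>" using disp''_upper[of z] by simp
  qed auto
  then show ?thesis by (simp add: max_speed_def power2_eq_square abs_mult_self_eq mult.assoc)
qed

text \<open>The interval [0, y] is cut at z - \<delta> and z + \<delta>. The cut points
  \<open>p\<close> and \<open>q\<close> are clamped to the interval, so that a piece may degenerate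
  to a point and then contributes nothing.\<close>

lemma split_bound:
  fixes H :: "real \<Rightarrow> real"
  assumes "0 \<le> y" "y \<le> pi" "\<delta> \<ge> 0" "0 < z" "z < pi"
    and left: "\<And>a b. 0 \<le> a \<Longrightarrow> a \<le> b \<Longrightarrow> b \<le> z - \<delta> \<Longrightarrow> \<bar>H b - H a\<bar> \<le> E"
    and right: "\<And>a b. z + \<delta> \<le> a \<Longrightarrow> a \<le> b \<Longrightarrow> b \<le> pi \<Longrightarrow> \<bar>H b - H a\<bar> \<le> E"
    and mid: "\<And>a b. 0 \<le> a \<Longrightarrow> z - \<delta> \<le> a \<Longrightarrow> a \<le> b \<Longrightarrow> b \<le> z + \<delta> \<Longrightarrow> b \<le> pi \<Longrightarrow> \<bar>H b - H a\<bar> \<le> D"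
    and nn: "E \<ge> 0" "D \<ge> 0"
  shows "\<bar>H y - H 0\<bar> \<le> 2 * E + D"
proof -
  define p where "p = min y (max 0 (z - \<delta>))"
  define q where "q = min y (z + \<delta>)"
  have 1: "\<bar>H p - H 0\<bar> \<le> E"
  proof (cases "z - \<delta> \<ge> 0")
    case True then show ?thesis by (intro left) (use assms in \<open>auto simp: p_def\<close>)
  next
    case False then have "p = 0" using assms by (auto simp: p_def)
    then show ?thesis using nn by simp
  qed
  have 2: "\<bar>H q - H p\<bar> \<le> D"
  proof (cases "p < y")
    case True
    then show ?thesis by (intro mid) (use assms in \<open>auto simp: p_def q_def\<close>)
  next
    case False
    then have "p = y" "q = y" using assms by (auto simp: p_def q_def)
    then show ?thesis using nn by simp
  qed
  have 3: "\<bar>H y - H q\<bar> \<le> E"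
  proof (cases "q < y")
    case True
    then show ?thesis by (intro right) (use assms in \<open>auto simp: q_def\<close>)
  next
    case False
    then have "q = y" using assms by (auto simp: q_def)
    then show ?thesis using nn by simp
  qed
  show ?thesis using 1 2 3 by linarith
qed

section \<open>Oscillatory integrals with the phase
  \<open>t * disp \<xi> - x * \<xi> + \<beta>\<close>\<close>

context
  fixes t x \<beta> :: real and H :: "real \<Rightarrow> real"
  assumes t: "t > 0"
    and H: "\<And>\<xi>. \<xi> \<in> {0..pi} \<Longrightarrow> (H has_real_derivative sin (t * disp \<xi> - x * \<xi> + \<beta>)) (at \<xi>)"
begin

lemma phase_deriv:
  "((\<lambda>\<xi>. t * disp \<xi> - x * \<xi> + \<beta>) has_real_derivative (t * (sin \<xi> / disp \<xi>) - x)) (at \<xi>)"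
  "((\<lambda>\<xi>. t * (sin \<xi> / disp \<xi>) - x) has_real_derivative (t * disp'' \<xi>)) (at \<xi>)"
proof -
  show "((\<lambda>\<xi>. t * disp \<xi> - x * \<xi> + \<beta>) has_real_derivative (t * (sin \<xi> / disp \<xi>) - x)) (at \<xi>)"
    by (auto intro!: derivative_eq_intros disp_deriv)
  show "((\<lambda>\<xi>. t * (sin \<xi> / disp \<xi>) - x) has_real_derivative (t * disp'' \<xi>)) (at \<xi>)"
    using DERIV_diff[OF DERIV_cmult[OF disp_deriv2[of \<xi>], of t] DERIV_const[of x]] by simp
qed

text \<open>At distance at least \<open>\<delta>\<close> from the inflection point the second
  derivative of the phase has a fixed sign and size at least t k \<delta>, so the second-derivative
  test applies on either side.\<close>

lemma osc_outer:
  assumes k: "k > 0"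
    "\<And>x. 0 \<le> x \<Longrightarrow> x \<le> infl \<Longrightarrow> disp'' x \<ge> k * (infl - x)"
    "\<And>x. infl \<le> x \<Longrightarrow> x \<le> pi \<Longrightarrow> disp'' x \<le> - (k * (x - infl))"
    and d: "\<delta> > 0"
  shows "0 \<le> a \<Longrightarrow> a \<le> b \<Longrightarrow> b \<le> infl - \<delta> \<Longrightarrow> \<bar>H b - H a\<bar> \<le> 8 / sqrt (t * (k * \<delta>))"
    and "infl + \<delta> \<le> a \<Longrightarrow> a \<le> b \<Longrightarrow> b \<le> pi \<Longrightarrow> \<bar>H b - H a\<bar> \<le> 8 / sqrt (t * (k * \<delta>))"
proof -
  assume ab: "0 \<le> a" "a \<le> b" "b \<le> infl - \<delta>"
  show "\<bar>H b - H a\<bar> \<le> 8 / sqrt (t * (k * \<delta>))"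
  proof (rule van_der_Corput_second[where H=H, OF _ _ H phase_deriv])
    fix y assume y: "y \<in> {a..b}"
    then have "k * \<delta> \<le> k * (infl - y)" using k ab by (intro mult_left_mono) auto
    also have "\<dots> \<le> disp'' y" using y ab d by (intro k) auto
    finally show "t * (k * \<delta>) \<le> t * disp'' y" using t by (intro mult_left_mono) auto
  qed (use ab t k d infl_props in auto)
next
  assume ab: "infl + \<delta> \<le> a" "a \<le> b" "b \<le> pi"
  show "\<bar>H b - H a\<bar> \<le> 8 / sqrt (t * (k * \<delta>))"
  proof (rule van_der_Corput_second_neg[where H=H, OF _ _ H phase_deriv])
    fix y assume y: "y \<in> {a..b}"
    have "disp'' y \<le> - (k * (y - infl))" using y ab d by (intro k) auto
    also have "\<dots> \<le> - (k * \<delta>)" using k ab y by auto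
    finally have "t * disp'' y \<le> t * (- (k * \<delta>))" using t by (intro mult_left_mono) auto
    then show "t * disp'' y \<le> - (t * (k * \<delta>))" by simp
  qed (use ab t k d infl_props in auto)
qed

text \<open>Within \<open>\<delta>\<close> of the inflection point the phase derivative differs from
  \<open>max_speed * t - x\<close> by at most 4 t \<delta>^2 \<le> d/2, so it keeps its sign and has
  size at least d/2. It is monotone on each side of \<open>infl\<close>; two first-derivative tests
  give 2 * 3/(d/2) = 12/d.\<close>

lemma osc_inner:
  assumes dist: "8 * t * \<delta>\<^sup>2 \<le> d" "d = \<bar>x - max_speed * t\<bar>" "d > 0"
    and k: "k > 0"
    "\<And>x. 0 \<le> x \<Longrightarrow> x \<le> infl \<Longrightarrow> disp'' x \<ge> k * (infl - x)"
    "\<And>x. infl \<le> x \<Longrightarrow> x \<le> pi \<Longrightarrow> disp'' x \<le> - (k * (x - infl))"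
    and ab: "0 \<le> a" "infl - \<delta> \<le> a" "a \<le> b" "b \<le> infl + \<delta>" "b \<le> pi"
  shows "\<bar>H b - H a\<bar> \<le> 12 / d"
proof -
  let ?v = "\<lambda>y. t * (sin y / disp y) - x"
  have v: "\<bar>?v y - (max_speed * t - x)\<bar> \<le> d / 2" if "y \<in> {a..b}" for y
  proof -
    have "\<bar>y - infl\<bar> \<le> \<delta>" using that ab by auto
    then have "(y - infl)\<^sup>2 \<le> \<delta>\<^sup>2" by (metis abs_ge_zero abs_le_square_iff abs_of_nonneg order_trans)
    then have "\<bar>sin y / disp y - max_speed\<bar> \<le> 4 * \<delta>\<^sup>2" using group_velocity_quadratic[of y] by linarith
    then have "t * \<bar>sin y / disp y - max_speed\<bar> \<le> t * (4 * \<delta>\<^sup>2)" using t by (intro mult_left_mono) auto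
    moreover have "\<bar>?v y - (max_speed * t - x)\<bar> = t * \<bar>sin y / disp y - max_speed\<bar>"
    proof -
      have "?v y - (max_speed * t - x) = t * (sin y / disp y - max_speed)" by (simp add: algebra_simps)
      then show ?thesis using t by (simp only: abs_mult abs_of_pos)
    qed
    ultimately show ?thesis using dist by simp
  qed
  have piece: "\<bar>H b' - H a'\<bar> \<le> 3 / (d / 2)"
    if ab': "a \<le> a'" "a' \<le> b'" "b' \<le> b" and s: "b' \<le> infl \<or> infl \<le> a'" for a' b'
  proof -
    have sgn: "(\<forall>x\<in>{a'..b'}. 0 \<le> t * disp'' x) \<or> (\<forall>x\<in>{a'..b'}. t * disp'' x \<le> 0)"
      using s
    proof
      assume s: "b' \<le> infl"
      have "0 \<le> disp'' y" if "y \<in> {a'..b'}" for y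
      proof -
        have "0 \<le> k * (infl - y)" using k(1) that s by (intro mult_nonneg_nonneg) auto
        also have "\<dots> \<le> disp'' y" using that s ab ab' by (intro k(2)) auto
        finally show ?thesis .
      qed
      then show ?thesis using t by auto
    next
      assume s: "infl \<le> a'"
      have "disp'' y \<le> 0" if "y \<in> {a'..b'}" for y
      proof -
        have "disp'' y \<le> - (k * (y - infl))" using that s ab ab' by (intro k(3)) auto
        also have "0 \<le> k * (y - infl)" using k(1) that s by (intro mult_nonneg_nonneg) auto
        then have "- (k * (y - infl)) \<le> 0" by simp
        finally show ?thesis .
      qed
      then show ?thesis using t by (auto simp: mult_le_0_iff)
    qed
    show ?thesis
    proof (cases "max_speed * t - x \<ge> 0")
      case True
      show ?thesis
      proof (rule van_der_Corput_first[where H=H, OF _ _ H phase_deriv])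
        fix y assume "y \<in> {a'..b'}"
        then have "\<bar>?v y - (max_speed * t - x)\<bar> \<le> d / 2" using ab' by (intro v) auto
        moreover have "d = max_speed * t - x" using True dist by simp
        ultimately show "d / 2 \<le> ?v y" unfolding abs_le_iff by linarith
      qed (use ab ab' dist sgn in auto)
    next
      case False
      show ?thesis
      proof (rule van_der_Corput_first_neg[where H=H, OF _ _ H phase_deriv])
        fix y assume "y \<in> {a'..b'}"
        then have "\<bar>?v y - (max_speed * t - x)\<bar> \<le> d / 2" using ab' by (intro v) auto
        moreover have "d = - (max_speed * t - x)" using False dist by simp
        ultimately show "?v y \<le> - (d / 2)" unfolding abs_le_iff by linarith
      qed (use ab ab' dist sgn in auto)
    qed
  qed
  have six: "3 / (d / 2) = 6 / d" by simp
  show ?thesis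
  proof (cases "b \<le> infl \<or> infl \<le> a")
    case True
    then have "\<bar>H b - H a\<bar> \<le> 6 / d" using piece[of a b] ab six by auto
    also have "\<dots> \<le> 12 / d" using dist by (intro divide_right_mono) auto
    finally show ?thesis .
  next
    case False
    then have "\<bar>H b - H infl\<bar> \<le> 6 / d" "\<bar>H infl - H a\<bar> \<le> 6 / d"
      using piece[of infl b] piece[of a infl] ab six by auto
    then have "\<bar>H b - H a\<bar> \<le> 6 / d + 6 / d" by linarith
    then show ?thesis by simp
  qed
qed

end

text \<open>Both bounds cut a neighbourhood of radius \<delta> out around the inflection point and
  differ in the choice of \<delta>: without information on x the inner part is bounded by its
  length, away from the wave front by the absence of a stationary point.\<close>

lemma oscillatory_bounds:
  "\<exists>C>0. \<forall>t x \<beta> H y. t \<ge> 1 \<longrightarrow> 0 \<le> y \<longrightarrow> y \<le> pi \<longrightarrow>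
       (\<forall>\<xi>\<in>{0..pi}. (H has_real_derivative sin (t * disp \<xi> - x * \<xi> + \<beta>)) (at \<xi>)) \<longrightarrow>
       \<bar>H y - H 0\<bar> \<le> C * t powr (-1/3) \<and>
       \<bar>H y - H 0\<bar> \<le> C * t powr (-1/4) * max 1 \<bar>x - max_speed * t\<bar> powr (-1/4)"
proof -
  from disp''_bounds obtain k where k0: "k > 0"
    and k1: "\<forall>x. 0 \<le> x \<longrightarrow> x \<le> infl \<longrightarrow> disp'' x \<ge> k * (infl - x)"
    and k2: "\<forall>x. infl \<le> x \<longrightarrow> x \<le> pi \<longrightarrow> disp'' x \<le> - (k * (x - infl))"
    by (elim exE conjE)
  note k = k0 k1[rule_format] k2[rule_format]
  define C where "C = 64 / sqrt k + 12"
  have C: "C > 0" using k0 by (simp add: C_def add_pos_pos)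
  have *: "\<bar>H y - H 0\<bar> \<le> C * t powr (-1/3) \<and>
       \<bar>H y - H 0\<bar> \<le> C * t powr (-1/4) * max 1 \<bar>x - max_speed * t\<bar> powr (-1/4)"
    if t: "t \<ge> 1" and y: "0 \<le> y" "y \<le> pi"
      and H: "\<And>\<xi>. \<xi> \<in> {0..pi} \<Longrightarrow> (H has_real_derivative sin (t * disp \<xi> - x * \<xi> + \<beta>)) (at \<xi>)"
    for t x \<beta> H y
  proof -
    have t0: "t > 0" using t by simp
    have A: "\<bar>H y - H 0\<bar> \<le> C * t powr (-1/3)"
    proof -
      \<comment> \<open>This radius balances the inner length \<delta> against the outer bound (t
        \<delta>)^(-1/2).\<close>
      define \<delta> where "\<delta> = t powr (-1/3)"
      have d: "\<delta> > 0" using t0 by (simp add: \<delta>_def)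
      have "\<bar>H y - H 0\<bar> \<le> 2 * (8 / sqrt (t * (k * \<delta>))) + 2 * \<delta>"
      proof (rule split_bound[OF y _ infl_props(1,2) osc_outer[OF t0 H k d]])
        fix a b assume ab: "0 \<le> a" "infl - \<delta> \<le> a" "a \<le> b" "b \<le> infl + \<delta>" "b \<le> pi"
        have "\<bar>H b - H a\<bar> \<le> b - a"
          using ab by (intro antiderivative_sin_le[where H=H, OF _ H]) auto
        then show "\<bar>H b - H a\<bar> \<le> 2 * \<delta>" using ab by linarith
      qed (use d k0 t0 in auto)
      moreover have "sqrt (t * (k * \<delta>)) = sqrt k * t powr (1/3)"
      proof -
        have "t * \<delta> = t powr (1 + -1/3)" unfolding powr_add \<delta>_def using t0 by simp
        also have "1 + -1/3 = (1/3 + 1/3 :: real)" by simp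
        also have "t powr (1/3 + 1/3) = (t powr (1/3))\<^sup>2" unfolding powr_add power2_eq_square ..
        finally have "sqrt (t * \<delta>) = t powr (1/3)" by simp
        moreover have "t * (k * \<delta>) = k * (t * \<delta>)" by simp
        ultimately show ?thesis by (simp only: real_sqrt_mult[of k "t * \<delta>"])
      qed
      moreover have "8 / (sqrt k * t powr (1/3)) = 8 / sqrt k * \<delta>"
        using powr_minus_divide[of t "1/3"] by (simp add: \<delta>_def)
      ultimately have "\<bar>H y - H 0\<bar> \<le> 2 * (8 / sqrt k * \<delta>) + 2 * \<delta>" by simp
      also have "\<dots> = (16 / sqrt k + 2) * \<delta>" by (simp add: distrib_right)
      also have "\<dots> \<le> C * \<delta>"
      proof (rule mult_right_mono)
        have "16 / sqrt k \<le> 64 / sqrt k" using k0 by (intro divide_right_mono) auto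
        then show "16 / sqrt k + 2 \<le> C" unfolding C_def by linarith
      qed (use d in auto)
      finally show ?thesis by (simp add: \<delta>_def)
    qed
    define d where "d = \<bar>x - max_speed * t\<bar>"
    have B: "\<bar>H y - H 0\<bar> \<le> C * t powr (-1/4) * max 1 d powr (-1/4)"
    \<comment> \<open>Up to distance t^(1/3) from the front, d^(-1/4) is at least t^(-1/12), and the
      bound already shown is the stronger one. Beyond it, t times the new radius is comparable to
      sqrt (d t), which gives (d t)^(-1/4) outside; inside, 1/d = d^(-3/4) d^(-1/4) with d^(-3/4) at
      most t^(-1/4).\<close>
    proof (cases "max 1 d \<le> t powr (1/3)")
      case True
      have "t powr (-1/12) = (t powr (1/3)) powr (-1/4)" by (simp add: powr_powr)
      also have "\<dots> \<le> max 1 d powr (-1/4)" using True by (intro powr_mono2') auto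
      finally have "t powr (-1/4) * t powr (-1/12) \<le> t powr (-1/4) * max 1 d powr (-1/4)"
        by (intro mult_left_mono) auto
      then have "t powr (-1/3) \<le> t powr (-1/4) * max 1 d powr (-1/4)" by (simp flip: powr_add)
      then have "C * t powr (-1/3) \<le> C * (t powr (-1/4) * max 1 d powr (-1/4))"
        using C by (intro mult_left_mono) auto
      then show ?thesis using A by (simp add: mult.assoc)
    next
      case False
      have t13: "t powr (1/3) \<ge> 1" using t by (simp add: ge_one_powr_ge_zero)
      have d: "d > t powr (1/3)" "d > 1" "max 1 d = d" using False t13 by auto
      define r where "r = d powr (-1/4) * t powr (-1/4)"
      \<comment> \<open>the largest neighbourhood of the inflection point on which the phase is not stationary\<close>
      define \<delta> where "\<delta> = sqrt (d / (8 * t))"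
      have dl: "\<delta> > 0" using d t0 by (simp add: \<delta>_def)
      have "\<bar>H y - H 0\<bar> \<le> 2 * (8 / sqrt (t * (k * \<delta>))) + 12 / d"
      proof (rule split_bound[OF y _ infl_props(1,2) osc_outer[OF t0 H k dl]])
        fix a b assume ab: "0 \<le> a" "infl - \<delta> \<le> a" "a \<le> b" "b \<le> infl + \<delta>" "b \<le> pi"
        show "\<bar>H b - H a\<bar> \<le> 12 / d"
        proof (rule osc_inner[OF t0 H _ d_def _ k ab])
          show "8 * t * \<delta>\<^sup>2 \<le> d" unfolding \<delta>_def using t0 d by simp
        qed (use d in auto)
      qed (use d dl k0 t0 in auto)
      moreover have "12 / d \<le> 12 * r"
      proof -
        have "1 / d = d powr (-3/4) * d powr (-1/4)" using d by (simp add: powr_minus_divide flip: powr_add)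
        also have "\<dots> \<le> (t powr (1/3)) powr (-3/4) * d powr (-1/4)"
          using d t0 by (intro mult_right_mono powr_mono2') auto
        also have "\<dots> = r" by (simp add: powr_powr r_def)
        finally show ?thesis by simp
      qed
      moreover have "8 / sqrt (t * (k * \<delta>)) \<le> 32 / sqrt k * r"
      proof -
        have "(d * t) powr (1/2) = sqrt (d * t)" using d t0 by (simp add: powr_half_sqrt)
        also have "sqrt (d * t) \<le> 16 * (t * \<delta>)"
        proof -
          have "t * \<delta> = sqrt (t\<^sup>2 * (d / (8 * t)))" using t0 unfolding real_sqrt_mult by (simp add: \<delta>_def)
          also have "t\<^sup>2 * (d / (8 * t)) = d * t / 8" using t0 by (simp add: power2_eq_square)
          finally have "16 * (t * \<delta>) = sqrt (16\<^sup>2) * sqrt (d * t / 8)" by simp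
          also have "\<dots> = sqrt (16\<^sup>2 * (d * t / 8))" by (rule real_sqrt_mult[symmetric])
          also have "\<dots> \<ge> sqrt (d * t)" using d t0 by (intro real_sqrt_le_mono) simp
          finally show ?thesis .
        qed
        finally have "sqrt ((d * t) powr (1/2)) \<le> sqrt (16 * (t * \<delta>))" by (rule real_sqrt_le_mono)
        moreover have "sqrt ((d * t) powr (1/2)) = (d * t) powr (1/4)"
          using powr_half_sqrt[of "(d * t) powr (1/2)"] by (simp add: powr_powr)
        moreover have "sqrt (16 * (t * \<delta>)) = 4 * sqrt (t * \<delta>)"
          unfolding real_sqrt_mult[of 16] by simp
        ultimately have "(d * t) powr (1/4) \<le> 4 * sqrt (t * \<delta>)" by simp
        then have le: "sqrt k * (d * t) powr (1/4) \<le> sqrt k * (4 * sqrt (t * \<delta>))"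
          using k0 by (intro mult_left_mono) auto
        have "t * (k * \<delta>) = k * (t * \<delta>)" by simp
        then have "sqrt (t * (k * \<delta>)) = sqrt k * sqrt (t * \<delta>)" by (simp only: real_sqrt_mult)
        with le have "sqrt k * (d * t) powr (1/4) \<le> 4 * sqrt (t * (k * \<delta>))" by simp
        then have "32 / (4 * sqrt (t * (k * \<delta>))) \<le> 32 / (sqrt k * (d * t) powr (1/4))"
          using k0 d dl t0 by (intro divide_left_mono mult_pos_pos) auto
        also have "\<dots> = 32 / sqrt k * r" using d t0 powr_minus_divide[of t "1/4"] powr_minus_divide[of d "1/4"]
          by (simp add: r_def powr_mult)
        finally show ?thesis by simp
      qed
      ultimately have "\<bar>H y - H 0\<bar> \<le> 2 * (32 / sqrt k * r) + 12 * r" by linarith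
      also have "\<dots> = C * r" by (simp add: C_def distrib_right)
      finally have "\<bar>H y - H 0\<bar> \<le> C * r" .
      then show ?thesis using d by (simp add: r_def mult_ac)
    qed
    from A B show ?thesis unfolding d_def by blast
  qed
  show ?thesis using C * by (intro exI[of _ C]) blast
qed

section \<open>The kernels of the free propagator\<close>

text \<open>The n-th Fourier coefficient of the even extension of \<open>\<mu>\<close>, that is, the
  convolution kernel of the Fourier multiplier \<open>\<mu>\<close>. The half-range cosine form
  keeps it real and the integral on [0, pi], where \<omega>'' has its single zero.\<close>

definition fker :: "(real \<Rightarrow> real) \<Rightarrow> int \<Rightarrow> real" where
  "fker \<mu> n = integral {0..pi} (\<lambda>\<xi>. \<mu> \<xi> * cos (of_int n * \<xi>)) / pi"

definition sine_ker :: "real \<Rightarrow> int \<Rightarrow> real" where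
  "sine_ker t = fker (\<lambda>\<xi>. sin (t * disp \<xi>) / disp \<xi>)"

definition cosine_ker :: "real \<Rightarrow> int \<Rightarrow> real" where
  "cosine_ker t = fker (\<lambda>\<xi>. cos (t * disp \<xi>))"

lemma continuous_disp [continuous_intros]:
  fixes f :: "'a::t2_space \<Rightarrow> real"
  shows "continuous_on A f \<Longrightarrow> continuous_on A (\<lambda>x. disp (f x))"
  unfolding disp_def by (intro continuous_intros)

lemma fker_has_integral:
  assumes "continuous_on {0..pi} \<mu>"
  shows "((\<lambda>\<xi>. \<mu> \<xi> * cos (of_int n * \<xi>)) has_integral (pi * fker \<mu> n)) {0..pi}"
proof -
  have "(\<lambda>\<xi>. \<mu> \<xi> * cos (of_int n * \<xi>)) integrable_on {0..pi}"
    by (intro integrable_continuous_real continuous_intros assms)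
  then show ?thesis by (simp add: fker_def integrable_integral)
qed

lemma sine_multiplier: "continuous_on A (\<lambda>\<xi>. sin (t * disp \<xi>) / disp \<xi>)" "\<bar>sin (t * disp \<xi>) / disp \<xi>\<bar> \<le> 1"
proof -
  show "continuous_on A (\<lambda>\<xi>. sin (t * disp \<xi>) / disp \<xi>)" by (intro continuous_intros) auto
  show "\<bar>sin (t * disp \<xi>) / disp \<xi>\<bar> \<le> 1"
    using frac_le[of 1 "\<bar>sin (t * disp \<xi>)\<bar>" 1 "disp \<xi>"] disp_ge_1[of \<xi>] by (simp add: abs_of_pos)
qed

lemma cosine_multiplier: "continuous_on A (\<lambda>\<xi>. cos (t * disp \<xi>))" "\<bar>cos (t * disp \<xi>)\<bar> \<le> 1"
  by (intro continuous_intros) auto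

lemma fker_le_1:
  assumes "continuous_on {0..pi} \<mu>" "\<And>\<xi>. \<bar>\<mu> \<xi>\<bar> \<le> 1"
  shows "\<bar>fker \<mu> n\<bar> \<le> 1"
proof -
  have "norm (pi * fker \<mu> n) \<le> 1 * measure lborel (cbox 0 pi)"
  proof (rule has_integral_bound)
    show "((\<lambda>\<xi>. \<mu> \<xi> * cos (of_int n * \<xi>)) has_integral (pi * fker \<mu> n)) (cbox 0 pi)"
      using fker_has_integral[OF assms(1)] by simp
    show "norm (\<mu> \<xi> * cos (of_int n * \<xi>)) \<le> 1" for \<xi>
      using mult_mono[OF assms(2)[of \<xi>] abs_cos_le_one[of "of_int n * \<xi>"]] by (simp add: abs_mult)
  qed auto
  then show ?thesis by (simp add: abs_mult)
qed

lemma sine_ker_le_1: "\<bar>sine_ker t n\<bar> \<le> 1"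
  unfolding sine_ker_def by (intro fker_le_1 sine_multiplier)

lemma cosine_ker_le_1: "\<bar>cosine_ker t n\<bar> \<le> 1"
  unfolding cosine_ker_def by (intro fker_le_1 cosine_multiplier)

lemma sine_ker_0: "sine_ker 0 n = 0"
  by (simp add: sine_ker_def fker_def)

lemma integral_cos_int: "((\<lambda>\<xi>. cos (of_int n * \<xi>)) has_integral (if n = 0 then pi else 0)) {0..pi}"
proof (cases "n = 0")
  case True then show ?thesis using has_integral_const_real[of "1::real" 0 pi] by simp
next
  case False
  have "((\<lambda>\<xi>. cos (of_int n * \<xi>)) has_integral (sin (of_int n * pi) / of_int n - sin (of_int n * 0) / of_int n)) {0..pi}"
  proof (rule fundamental_theorem_of_calculus)
    fix \<xi>
    have "((\<lambda>\<xi>. sin (of_int n * \<xi>) / of_int n) has_real_derivative cos (of_int n * \<xi>)) (at \<xi> within {0..pi})"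
      using False by (auto intro!: derivative_eq_intros)
    then show "((\<lambda>\<xi>. sin (of_int n * \<xi>) / of_int n) has_vector_derivative cos (of_int n * \<xi>)) (at \<xi> within {0..pi})"
      by (simp add: has_real_derivative_iff_has_vector_derivative)
  qed auto
  then show ?thesis using False by (simp add: sin_integer_2pi sin_int_times_real mult.commute)
qed

lemma cosine_ker_0: "cosine_ker 0 n = of_bool (n = 0)"
  using integral_unique[OF integral_cos_int[of n]] by (simp add: cosine_ker_def fker_def)

lemma sine_ker_deriv: "((\<lambda>t. sine_ker t n) has_real_derivative cosine_ker t n) (at t)"
proof -
  have "((\<lambda>t. integral (cbox 0 pi) (\<lambda>\<xi>. sin (t * disp \<xi>) / disp \<xi> * cos (of_int n * \<xi>)))
     has_field_derivative integral (cbox 0 pi) (\<lambda>\<xi>. cos (t * disp \<xi>) * cos (of_int n * \<xi>))) (at t within UNIV)"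
    by (rule leibniz_rule_field_derivative)
      (auto intro!: derivative_eq_intros integrable_continuous_real continuous_intros simp: split_beta)
  from DERIV_cdivide[OF this, of pi] show ?thesis
    by (simp add: sine_ker_def cosine_ker_def fker_def)
qed

text \<open>Differentiation in time brings down -\<omega>^2 = 2 cos \<xi> - 3, and 2 cos \<xi> cos(n
  \<xi>) is the sum of the two neighbouring cosines: the kernels solve the free lattice
  equation.\<close>

lemma cosine_ker_deriv:
  "((\<lambda>t. cosine_ker t n) has_real_derivative
     (sine_ker t (n + 1) + sine_ker t (n - 1) - 3 * sine_ker t n)) (at t)"
proof -
  have "((\<lambda>t. integral (cbox 0 pi) (\<lambda>\<xi>. cos (t * disp \<xi>) * cos (of_int n * \<xi>)))
     has_field_derivative integral (cbox 0 pi) (\<lambda>\<xi>. - (disp \<xi> * sin (t * disp \<xi>) * cos (of_int n * \<xi>)))) (at t within UNIV)"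
    by (rule leibniz_rule_field_derivative)
      (auto intro!: derivative_eq_intros integrable_continuous_real continuous_intros simp: split_beta)
  moreover have "integral (cbox 0 pi) (\<lambda>\<xi>. - (disp \<xi> * sin (t * disp \<xi>) * cos (of_int n * \<xi>)))
    = pi * (sine_ker t (n + 1) + sine_ker t (n - 1) - 3 * sine_ker t n)"
  proof (rule integral_unique)
    have eq: "- (disp \<xi> * sin (t * disp \<xi>) * cos (of_int n * \<xi>)) =
      sin (t * disp \<xi>) / disp \<xi> * cos (of_int (n + 1) * \<xi>) + sin (t * disp \<xi>) / disp \<xi> * cos (of_int (n - 1) * \<xi>)
       - 3 * (sin (t * disp \<xi>) / disp \<xi> * cos (of_int n * \<xi>))" for \<xi>
    proof -
      have "cos (of_int (n + 1) * \<xi>) + cos (of_int (n - 1) * \<xi>) = 2 * cos \<xi> * cos (of_int n * \<xi>)"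
        by (simp add: distrib_right left_diff_distrib cos_add cos_diff)
      then have "sin (t * disp \<xi>) / disp \<xi> * cos (of_int (n + 1) * \<xi>) + sin (t * disp \<xi>) / disp \<xi> * cos (of_int (n - 1) * \<xi>)
       - 3 * (sin (t * disp \<xi>) / disp \<xi> * cos (of_int n * \<xi>))
       = - (sin (t * disp \<xi>) / disp \<xi> * (disp \<xi>)\<^sup>2 * cos (of_int n * \<xi>))"
        unfolding disp_sq distrib_left[symmetric] mult.left_commute[of 3] right_diff_distrib[symmetric]
        by (simp add: algebra_simps)
      also have "sin (t * disp \<xi>) / disp \<xi> * (disp \<xi>)\<^sup>2 = disp \<xi> * sin (t * disp \<xi>)"
        by (simp add: power2_eq_square)
      finally show ?thesis by simp
    qed
    have I: "((\<lambda>\<xi>. sin (t * disp \<xi>) / disp \<xi> * cos (of_int m * \<xi>)) has_integral (pi * sine_ker t m)) {0..pi}" for m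
      unfolding sine_ker_def by (intro fker_has_integral sine_multiplier)
    show "((\<lambda>\<xi>. - (disp \<xi> * sin (t * disp \<xi>) * cos (of_int n * \<xi>))) has_integral
      pi * (sine_ker t (n + 1) + sine_ker t (n - 1) - 3 * sine_ker t n)) (cbox 0 pi)"
      unfolding eq using has_integral_diff[OF has_integral_add[OF I[of "n+1"] I[of "n-1"]] has_integral_mult_right[OF I[of n], of 3]]
      by (simp add: algebra_simps)
  qed
  ultimately have "((\<lambda>t. integral (cbox 0 pi) (\<lambda>\<xi>. cos (t * disp \<xi>) * cos (of_int n * \<xi>)))
     has_field_derivative pi * (sine_ker t (n + 1) + sine_ker t (n - 1) - 3 * sine_ker t n)) (at t)" by simp
  from DERIV_cdivide[OF this, of pi] show ?thesis
    by (simp add: cosine_ker_def fker_def)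
qed

text \<open>Both kernels vanish at time 0 off the origin, and their time derivatives at n involve
  only n and its neighbours with coefficients of total size at most 1 + 1 + 3 = 5. Each further site
  therefore gains one integration in time.\<close>

lemma ker_finite_speed:
  assumes "t \<ge> 0" "\<bar>n\<bar> \<ge> int j"
  shows "\<bar>sine_ker t n\<bar> \<le> (5 * t) ^ j / fact j \<and> \<bar>cosine_ker t n\<bar> \<le> (5 * t) ^ j / fact j"
  using assms
proof (induction j arbitrary: t n)
  case 0
  then show ?case by (simp add: sine_ker_le_1 cosine_ker_le_1)
next
  case (Suc j)
  have g: "((\<lambda>s. (5 * s) ^ Suc j / fact (Suc j)) has_real_derivative 5 * ((5 * s) ^ j / fact j)) (at s within {0..t})" for s :: real
    using power_fact_deriv[of 1 5 j s "{0..t}"] by (simp only: mult_1)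
  have IH: "\<bar>sine_ker s m\<bar> \<le> (5 * s) ^ j / fact j" "\<bar>cosine_ker s m\<bar> \<le> (5 * s) ^ j / fact j"
    if "s \<in> {0..t}" "\<bar>m\<bar> \<ge> int j" for s m
    using Suc.IH[of s m] that by auto
  have "norm (sine_ker t n - sine_ker 0 n) \<le> (5 * t) ^ Suc j / fact (Suc j) - (5 * 0) ^ Suc j / fact (Suc j)"
  proof (rule norm_diff_le_majorant[OF Suc.prems(1) _ g])
    fix s assume s: "s \<in> {0..t}"
    show "((\<lambda>s. sine_ker s n) has_vector_derivative cosine_ker s n) (at s within {0..t})"
      using sine_ker_deriv has_field_derivative_at_within has_real_derivative_iff_has_vector_derivative by blast
    have "\<bar>cosine_ker s n\<bar> \<le> (5 * s) ^ j / fact j" using IH(2)[of s n] Suc.prems s by auto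
    also have "0 \<le> (5 * s) ^ j / fact j" using s by auto
    then have "(5 * s) ^ j / fact j \<le> 5 * ((5 * s) ^ j / fact j)" by linarith
    finally show "norm (cosine_ker s n) \<le> 5 * ((5 * s) ^ j / fact j)" by simp
  qed
  moreover have "norm (cosine_ker t n - cosine_ker 0 n) \<le> (5 * t) ^ Suc j / fact (Suc j) - (5 * 0) ^ Suc j / fact (Suc j)"
  proof (rule norm_diff_le_majorant[OF Suc.prems(1) _ g])
    fix s assume s: "s \<in> {0..t}"
    show "((\<lambda>s. cosine_ker s n) has_vector_derivative (sine_ker s (n + 1) + sine_ker s (n - 1) - 3 * sine_ker s n)) (at s within {0..t})"
      using cosine_ker_deriv has_field_derivative_at_within has_real_derivative_iff_has_vector_derivative by blast
    show "norm (sine_ker s (n + 1) + sine_ker s (n - 1) - 3 * sine_ker s n) \<le> 5 * ((5 * s) ^ j / fact j)"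
    proof -
      have "\<bar>sine_ker s (n + 1)\<bar> \<le> (5 * s) ^ j / fact j" "\<bar>sine_ker s (n - 1)\<bar> \<le> (5 * s) ^ j / fact j"
        "\<bar>sine_ker s n\<bar> \<le> (5 * s) ^ j / fact j"
        by (rule IH(1)[OF s]; use Suc.prems in linarith)+
      then show ?thesis unfolding real_norm_def by linarith
    qed
  qed
  moreover have "n \<noteq> 0" using Suc.prems by auto
  ultimately show ?case by (simp add: sine_ker_0 cosine_ker_0)
qed

text \<open>Integration by parts against the amplitude: the boundary term is at most B and the
  remaining integral at most B pi \<le> 4 B.\<close>

lemma oscillatory_amplitude_bound:
  assumes B: "\<And>H y. 0 \<le> y \<Longrightarrow> y \<le> pi \<Longrightarrow>
       (\<And>\<xi>. \<xi> \<in> {0..pi} \<Longrightarrow> (H has_real_derivative sin (\<phi> \<xi>)) (at \<xi>)) \<Longrightarrow> \<bar>H y - H 0\<bar> \<le> B"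
    and c: "continuous_on UNIV \<phi>"
    and psi: "\<And>\<xi>. (\<psi> has_real_derivative \<psi>' \<xi>) (at \<xi>)" "\<And>\<xi>. \<bar>\<psi> \<xi>\<bar> \<le> 1" "\<And>\<xi>. \<bar>\<psi>' \<xi>\<bar> \<le> 1"
      "continuous_on {0..pi} \<psi>'"
  shows "\<bar>integral {0..pi} (\<lambda>\<xi>. sin (\<phi> \<xi>) * \<psi> \<xi>)\<bar> \<le> 5 * B"
proof -
  \<comment> \<open>The integral starts to the left of 0, so that \<open>J\<close> has a two-sided
    derivative at 0 as well, as the hypothesis on \<open>H\<close> demands.\<close>
  define J where "J y = integral {-1..y} (\<lambda>\<xi>. sin (\<phi> \<xi>))" for y
  have cs: "continuous_on A (\<lambda>\<xi>. sin (\<phi> \<xi>))" for A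
    by (intro continuous_intros continuous_on_subset[OF c]) auto
  have J: "(J has_real_derivative sin (\<phi> \<xi>)) (at \<xi>)" if "\<xi> \<in> {0..pi}" for \<xi>
  proof -
    have "(J has_real_derivative sin (\<phi> \<xi>)) (at \<xi> within {-1..pi+1})"
      unfolding J_def using that by (intro integral_has_real_derivative cs) auto
    moreover have "at \<xi> within {-1..pi+1} = at \<xi>" using that by (intro at_within_Icc_at) auto
    ultimately show ?thesis by simp
  qed
  have JB: "\<bar>J y - J 0\<bar> \<le> B" if "y \<in> {0..pi}" for y
    by (rule B[OF _ _ J]) (use that in simp_all)
  have B0: "B \<ge> 0" using JB[of 0] by auto
  define F where "F y = (J y - J 0) * \<psi> y" for y
  have I1: "((\<lambda>\<xi>. sin (\<phi> \<xi>) * \<psi> \<xi> + (J \<xi> - J 0) * \<psi>' \<xi>) has_integral (F pi - F 0)) {0..pi}"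
  proof (rule fundamental_theorem_of_calculus)
    fix \<xi> assume x: "\<xi> \<in> {0..pi}"
    have "(F has_real_derivative sin (\<phi> \<xi>) * \<psi> \<xi> + (J \<xi> - J 0) * \<psi>' \<xi>) (at \<xi>)"
      unfolding F_def by (auto intro!: derivative_eq_intros J[OF x] psi(1))
    then show "(F has_vector_derivative sin (\<phi> \<xi>) * \<psi> \<xi> + (J \<xi> - J 0) * \<psi>' \<xi>) (at \<xi> within {0..pi})"
      using has_field_derivative_at_within has_real_derivative_iff_has_vector_derivative by blast
  qed auto
  have cJ: "continuous_on {0..pi} J"
    by (rule DERIV_continuous_on) (use J has_field_derivative_at_within in blast)
  have "(\<lambda>\<xi>. (J \<xi> - J 0) * \<psi>' \<xi>) integrable_on {0..pi}"
    by (intro integrable_continuous_real continuous_intros cJ psi)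
  then have I2: "((\<lambda>\<xi>. (J \<xi> - J 0) * \<psi>' \<xi>) has_integral integral {0..pi} (\<lambda>\<xi>. (J \<xi> - J 0) * \<psi>' \<xi>)) {0..pi}"
    by (rule integrable_integral)
  have "((\<lambda>\<xi>. sin (\<phi> \<xi>) * \<psi> \<xi>) has_integral (F pi - F 0) - integral {0..pi} (\<lambda>\<xi>. (J \<xi> - J 0) * \<psi>' \<xi>)) {0..pi}"
    using has_integral_diff[OF I1 I2] by simp
  then have eq: "integral {0..pi} (\<lambda>\<xi>. sin (\<phi> \<xi>) * \<psi> \<xi>) = F pi - integral {0..pi} (\<lambda>\<xi>. (J \<xi> - J 0) * \<psi>' \<xi>)"
    by (simp add: integral_unique F_def)
  have "\<bar>F pi\<bar> \<le> B * 1" unfolding F_def abs_mult using JB[of pi] psi(2)[of pi] B0 by (intro mult_mono) auto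
  moreover have "norm (integral {0..pi} (\<lambda>\<xi>. (J \<xi> - J 0) * \<psi>' \<xi>)) \<le> B * measure lborel (cbox 0 pi)"
  proof (rule has_integral_bound)
    show "((\<lambda>\<xi>. (J \<xi> - J 0) * \<psi>' \<xi>) has_integral integral {0..pi} (\<lambda>\<xi>. (J \<xi> - J 0) * \<psi>' \<xi>)) (cbox 0 pi)"
      using I2 by simp
    fix \<xi> assume "\<xi> \<in> cbox 0 pi"
    then have "\<bar>J \<xi> - J 0\<bar> * \<bar>\<psi>' \<xi>\<bar> \<le> B * 1"
      using B0 by (intro mult_mono JB psi(3)) simp_all
    then show "norm ((J \<xi> - J 0) * \<psi>' \<xi>) \<le> B" by (simp add: abs_mult)
  qed (use B0 in auto)
  moreover have "B * pi \<le> B * 4" using B0 pi_less_4 by (intro mult_left_mono) auto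
  ultimately show ?thesis unfolding eq by auto
qed

lemma inverse_disp_deriv:
  "((\<lambda>\<xi>. 1 / disp \<xi>) has_real_derivative - (sin \<xi> / disp \<xi> ^ 3)) (at \<xi>)"
  "\<bar>1 / disp \<xi>\<bar> \<le> 1" "\<bar>- (sin \<xi> / disp \<xi> ^ 3)\<bar> \<le> 1"
proof -
  show "((\<lambda>\<xi>. 1 / disp \<xi>) has_real_derivative - (sin \<xi> / disp \<xi> ^ 3)) (at \<xi>)"
    by (auto intro!: derivative_eq_intros disp_deriv simp: power3_eq_cube)
  show "\<bar>1 / disp \<xi>\<bar> \<le> 1" using disp_ge_1[of \<xi>] by auto
  show "\<bar>- (sin \<xi> / disp \<xi> ^ 3)\<bar> \<le> 1"
    using frac_le[of 1 "\<bar>sin \<xi>\<bar>" 1 "disp \<xi> ^ 3"] disp_ge_1[of \<xi>] by (auto simp: power_abs abs_of_pos)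
qed

text \<open>Writing sin A cos(n \<xi>) as half the sum of sin(A - n \<xi>) and sin(A + n \<xi>)
  produces the phases with x = n and x = -n, hence two fronts. The amplitude is 1/\<omega> for the
  sine kernel and 1 for the cosine kernel, whose cosine is a sine with \<beta> = pi/2.\<close>

lemma kernel_pointwise:
  "\<exists>C>0. \<forall>t\<ge>1. \<forall>n. \<forall>k\<in>{sine_ker, cosine_ker}. \<bar>k t n\<bar> \<le> C * t powr (-1/3) \<and>
     \<bar>k t n\<bar> \<le> C * t powr (-1/4) * (max 1 \<bar>of_int n - max_speed * t\<bar> powr (-1/4)
       + max 1 \<bar>of_int (-n) - max_speed * t\<bar> powr (-1/4))"
proof -
  from oscillatory_bounds obtain C where C: "C > 0"
    and osc: "\<forall>t x \<beta> H y. t \<ge> 1 \<longrightarrow> 0 \<le> y \<longrightarrow> y \<le> pi \<longrightarrow>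
       (\<forall>\<xi>\<in>{0..pi}. (H has_real_derivative sin (t * disp \<xi> - x * \<xi> + \<beta>)) (at \<xi>)) \<longrightarrow>
       \<bar>H y - H 0\<bar> \<le> C * t powr (-1/3) \<and>
       \<bar>H y - H 0\<bar> \<le> C * t powr (-1/4) * max 1 \<bar>x - max_speed * t\<bar> powr (-1/4)"
    by (elim exE conjE)
  define I where "I t x \<beta> \<psi> = integral {0..pi} (\<lambda>\<xi>. sin (t * disp \<xi> - x * \<xi> + \<beta>) * \<psi> \<xi>)" for t x \<beta> \<psi>
  have I: "\<bar>I t x \<beta> \<psi>\<bar> \<le> 5 * (C * t powr (-1/3))"
    "\<bar>I t x \<beta> \<psi>\<bar> \<le> 5 * (C * t powr (-1/4) * max 1 \<bar>x - max_speed * t\<bar> powr (-1/4))"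
    if t: "t \<ge> 1" and psi: "\<psi> = (\<lambda>_. 1) \<or> \<psi> = (\<lambda>\<xi>. 1 / disp \<xi>)" for t x \<beta> \<psi>
  proof -
    have ex: "\<exists>\<psi>'. (\<forall>\<xi>. (\<psi> has_real_derivative \<psi>' \<xi>) (at \<xi>)) \<and> (\<forall>\<xi>. \<bar>\<psi> \<xi>\<bar> \<le> 1) \<and> (\<forall>\<xi>. \<bar>\<psi>' \<xi>\<bar> \<le> 1)
      \<and> continuous_on {0..pi} \<psi>'"
      using psi
    proof
      assume "\<psi> = (\<lambda>_. 1)" then show ?thesis by (intro exI[of _ "\<lambda>_. 0"]) auto
    next
      assume p: "\<psi> = (\<lambda>\<xi>. 1 / disp \<xi>)"
      have "continuous_on {0..pi} (\<lambda>\<xi>. - (sin \<xi> / disp \<xi> ^ 3))" by (intro continuous_intros) auto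
      then show ?thesis unfolding p using inverse_disp_deriv by (intro exI[of _ "\<lambda>\<xi>. - (sin \<xi> / disp \<xi> ^ 3)"]) blast
    qed
    then obtain \<psi>' where psi': "\<And>\<xi>. (\<psi> has_real_derivative \<psi>' \<xi>) (at \<xi>)" "\<And>\<xi>. \<bar>\<psi> \<xi>\<bar> \<le> 1" "\<And>\<xi>. \<bar>\<psi>' \<xi>\<bar> \<le> 1"
      "continuous_on {0..pi} \<psi>'" by auto
    have c: "continuous_on UNIV (\<lambda>\<xi>. t * disp \<xi> - x * \<xi> + \<beta>)" by (intro continuous_intros)
    show "\<bar>I t x \<beta> \<psi>\<bar> \<le> 5 * (C * t powr (-1/3))" unfolding I_def
      by (rule oscillatory_amplitude_bound[OF _ c psi'])
        (rule osc[rule_format, OF t, THEN conjunct1]; assumption)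
    show "\<bar>I t x \<beta> \<psi>\<bar> \<le> 5 * (C * t powr (-1/4) * max 1 \<bar>x - max_speed * t\<bar> powr (-1/4))" unfolding I_def
      by (rule oscillatory_amplitude_bound[OF _ c psi'])
        (rule osc[rule_format, OF t, THEN conjunct2]; assumption)
  qed
  have rep: "\<exists>\<psi> \<beta>. (\<psi> = (\<lambda>_. 1) \<or> \<psi> = (\<lambda>\<xi>. 1 / disp \<xi>)) \<and> k t n * pi = (I t (of_int n) \<beta> \<psi> + I t (of_int (-n)) \<beta> \<psi>) / 2"
    if k: "k \<in> {sine_ker, cosine_ker}" for k t and n :: int
  proof -
    have int: "(\<lambda>\<xi>. sin (t * disp \<xi> - x * \<xi> + \<beta>) * \<psi> \<xi>) integrable_on {0..pi}"
      if "\<psi> = (\<lambda>_. 1) \<or> \<psi> = (\<lambda>\<xi>. 1 / disp \<xi>)" for x \<beta> \<psi>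
      using that by (auto intro!: integrable_continuous_real continuous_intros)
    have *: "integral {0..pi} (\<lambda>\<xi>. sin (t * disp \<xi> + \<beta>) * \<psi> \<xi> * cos (of_int n * \<xi>)) = (I t (of_int n) \<beta> \<psi> + I t (of_int (-n)) \<beta> \<psi>) / 2"
      if psi: "\<psi> = (\<lambda>_. 1) \<or> \<psi> = (\<lambda>\<xi>. 1 / disp \<xi>)" for \<beta> \<psi>
    proof -
      have "sin (t * disp \<xi> + \<beta>) * \<psi> \<xi> * cos (of_int n * \<xi>) =
        (sin (t * disp \<xi> - of_int n * \<xi> + \<beta>) * \<psi> \<xi> + sin (t * disp \<xi> - of_int (-n) * \<xi> + \<beta>) * \<psi> \<xi>) / 2" for \<xi>
      proof -
        have "t * disp \<xi> - of_int n * \<xi> + \<beta> = (t * disp \<xi> + \<beta>) - of_int n * \<xi>"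
          "t * disp \<xi> - of_int (-n) * \<xi> + \<beta> = (t * disp \<xi> + \<beta>) + of_int n * \<xi>" by auto
        then show ?thesis by (simp only: sin_add sin_diff) (simp add: field_simps)
      qed
      then have "integral {0..pi} (\<lambda>\<xi>. sin (t * disp \<xi> + \<beta>) * \<psi> \<xi> * cos (of_int n * \<xi>)) =
        integral {0..pi} (\<lambda>\<xi>. (sin (t * disp \<xi> - of_int n * \<xi> + \<beta>) * \<psi> \<xi> + sin (t * disp \<xi> - of_int (-n) * \<xi> + \<beta>) * \<psi> \<xi>) / 2)"
        by presburger
      also have "\<dots> = (I t (of_int n) \<beta> \<psi> + I t (of_int (-n)) \<beta> \<psi>) / 2"
        unfolding I_def integral_divide using int[OF psi, of "of_int n" \<beta>] int[OF psi, of "of_int (-n)" \<beta>] by (subst Henstock_Kurzweil_Integration.integral_add) auto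
      finally show ?thesis .
    qed
    show ?thesis
    proof (cases "k = sine_ker")
      case True
      show ?thesis using *[of "\<lambda>\<xi>. 1 / disp \<xi>" 0] unfolding True sine_ker_def fker_def
        by (intro exI[of _ "\<lambda>\<xi>. 1 / disp \<xi>"] exI[of _ 0]) auto
    next
      case False
      have "sin (t * disp \<xi> + pi / 2) = cos (t * disp \<xi>)" for \<xi> by (simp add: sin_add)
      then show ?thesis using False k *[of "\<lambda>_. 1" "pi / 2"] unfolding cosine_ker_def fker_def
        by (intro exI[of _ "\<lambda>_. 1"] exI[of _ "pi / 2"]) (auto simp: cosine_ker_def fker_def)
    qed
  qed
  have half: "\<bar>z\<bar> \<le> a + b" if "z * pi = (p + q) / 2" "\<bar>p\<bar> \<le> a" "\<bar>q\<bar> \<le> b" for z p q a b :: real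
  proof -
    have "\<bar>z\<bar> * 1 \<le> \<bar>z\<bar> * pi" using pi_ge_two by (intro mult_left_mono) auto
    also have "\<dots> = \<bar>(p + q) / 2\<bar>" unfolding that(1)[symmetric] by (simp add: abs_mult)
    finally show ?thesis using that by auto
  qed
  show ?thesis
  proof (intro exI[of _ "10 * C"] conjI allI impI ballI)
    fix t :: real and n :: int and k assume t: "t \<ge> 1" and k: "k \<in> {sine_ker, cosine_ker}"
    from rep[OF k, of t n] obtain \<psi> \<beta> where psi: "\<psi> = (\<lambda>_. 1) \<or> \<psi> = (\<lambda>\<xi>. 1 / disp \<xi>)"
      and eq: "k t n * pi = (I t (of_int n) \<beta> \<psi> + I t (of_int (-n)) \<beta> \<psi>) / 2" by blast
    show "\<bar>k t n\<bar> \<le> 10 * C * t powr (- 1 / 3)"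
      using half[OF eq I(1)[OF t psi] I(1)[OF t psi]] by simp
    have "\<bar>k t n\<bar> \<le> 5 * (C * t powr (-1/4) * max 1 \<bar>of_int n - max_speed * t\<bar> powr (-1/4)) + 5 * (C * t powr (-1/4) * max 1 \<bar>of_int (-n) - max_speed * t\<bar> powr (-1/4))"
      by (rule half[OF eq I(2)[OF t psi] I(2)[OF t psi]])
    also have "\<dots> \<le> 2 * \<dots>" using C by simp
    finally show "\<bar>k t n\<bar> \<le> 10 * C * t powr (- 1 / 4) *
          (max 1 \<bar>of_int n - max_speed * t\<bar> powr (- 1 / 4) + max 1 \<bar>of_int (-n) - max_speed * t\<bar> powr (- 1 / 4))"
      by (simp add: algebra_simps)
  qed (use C in auto)
qed

section \<open>Parseval's identity and the l^2 bound for the bilinear forms of the kernels\<close>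

lemma trig_square_integral:
  fixes x :: "int \<Rightarrow> complex"
  assumes "finite A"
  defines "X c \<equiv> \<lambda>\<xi>. \<Sum>n\<in>A. x n * of_real (c (of_int n * \<xi>))"
  shows "((\<lambda>\<xi>. (cmod (X cos \<xi>))\<^sup>2 + (cmod (X sin \<xi>))\<^sup>2) has_integral (pi * (\<Sum>n\<in>A. (cmod (x n))\<^sup>2))) {0..pi}"
proof -
  \<comment> \<open>Only the sum of the cosine and the sine square works on the half period: paired
    terms combine to cos((n-m) \<xi>), which integrates to 0 for n \<noteq> m, whereas cosines alone
    would not separate n from -n.\<close>
  have eq: "(cmod (X cos \<xi>))\<^sup>2 + (cmod (X sin \<xi>))\<^sup>2 = (\<Sum>n\<in>A. \<Sum>m\<in>A. Re (x n * cnj (x m)) * cos (of_int (n - m) * \<xi>))" for \<xi>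
  proof -
    have "complex_of_real ((cmod (X cos \<xi>))\<^sup>2 + (cmod (X sin \<xi>))\<^sup>2) = X cos \<xi> * cnj (X cos \<xi>) + X sin \<xi> * cnj (X sin \<xi>)"
      by (simp only: of_real_add complex_norm_square)
    also have "\<dots> = (\<Sum>n\<in>A. \<Sum>m\<in>A. x n * cnj (x m) * of_real (cos (of_int (n - m) * \<xi>)))"
      unfolding X_def cnj_sum sum_product sum.distrib[symmetric]
      by (intro sum.cong refl) (simp add: left_diff_distrib cos_diff algebra_simps)
    finally have "Re (complex_of_real ((cmod (X cos \<xi>))\<^sup>2 + (cmod (X sin \<xi>))\<^sup>2)) =
      Re (\<Sum>n\<in>A. \<Sum>m\<in>A. x n * cnj (x m) * of_real (cos (of_int (n - m) * \<xi>)))" by (rule arg_cong)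
    then show ?thesis by (simp only: Re_complex_of_real Re_sum) simp
  qed
  have "((\<lambda>\<xi>. \<Sum>n\<in>A. \<Sum>m\<in>A. Re (x n * cnj (x m)) * cos (of_int (n - m) * \<xi>)) has_integral
    (\<Sum>n\<in>A. \<Sum>m\<in>A. Re (x n * cnj (x m)) * (if n - m = 0 then pi else 0))) {0..pi}"
    by (intro has_integral_sum assms has_integral_mult_right integral_cos_int)
  moreover have "(\<Sum>n\<in>A. \<Sum>m\<in>A. Re (x n * cnj (x m)) * (if n - m = 0 then pi else 0)) = pi * (\<Sum>n\<in>A. (cmod (x n))\<^sup>2)"
  proof -
    have "(\<Sum>m\<in>A. Re (x n * cnj (x m)) * (if n - m = 0 then pi else 0)) = pi * (cmod (x n))\<^sup>2" if "n \<in> A" for n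
    proof -
      have "(\<Sum>m\<in>A. Re (x n * cnj (x m)) * (if n - m = 0 then pi else 0)) = (\<Sum>m\<in>A. if n = m then Re (x n * cnj (x m)) * pi else 0)"
        by (intro sum.cong) auto
      also have "\<dots> = Re (x n * cnj (x n)) * pi" using that assms by (simp add: sum.delta')
      also have "Re (x n * cnj (x n)) = (cmod (x n))\<^sup>2"
        by (metis Re_complex_of_real complex_norm_square of_real_power)
      finally show ?thesis by simp
    qed
    then show ?thesis by (simp add: sum_distrib_left)
  qed
  ultimately show ?thesis unfolding eq by simp
qed

text \<open>Expanding cos((n-m) \<xi>) turns the double sum into an integral of \<open>\<mu>\<close>
  times products of the trigonometric sums of x and y; the inequality of arithmetic and geometric
  means and Parseval then give the bound. The mean of the squares, instead of a product of norms,
  equals 1 on unit vectors and is in the form that interpolation uses.\<close>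

lemma fker_form_l2:
  fixes x y :: "int \<Rightarrow> complex"
  assumes fin: "finite A" "finite B" and mu: "continuous_on {0..pi} \<mu>" "\<And>\<xi>. \<bar>\<mu> \<xi>\<bar> \<le> 1"
  shows "cmod (\<Sum>n\<in>A. \<Sum>m\<in>B. x n * y m * of_real (fker \<mu> (n - m))) \<le> ((\<Sum>n\<in>A. (cmod (x n))\<^sup>2) + (\<Sum>m\<in>B. (cmod (y m))\<^sup>2)) / 2"
proof -
  define X where "X c \<xi> = (\<Sum>n\<in>A. x n * of_real (c (of_int n * \<xi>)))" for c :: "real \<Rightarrow> real" and \<xi>
  define Y where "Y c \<xi> = (\<Sum>n\<in>B. y n * of_real (c (of_int n * \<xi>)))" for c :: "real \<Rightarrow> real" and \<xi>
  define S where "S = (\<Sum>n\<in>A. \<Sum>m\<in>B. x n * y m * of_real (fker \<mu> (n - m)))"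
  have "((\<lambda>\<xi>. \<Sum>n\<in>A. \<Sum>m\<in>B. x n * y m * complex_of_real (\<mu> \<xi> * cos (of_int (n - m) * \<xi>))) has_integral
    (\<Sum>n\<in>A. \<Sum>m\<in>B. x n * y m * of_real (pi * fker \<mu> (n - m)))) {0..pi}"
    by (intro has_integral_sum fin has_integral_mult_right has_integral_of_real fker_has_integral mu)
  also have "(\<lambda>\<xi>. \<Sum>n\<in>A. \<Sum>m\<in>B. x n * y m * complex_of_real (\<mu> \<xi> * cos (of_int (n - m) * \<xi>))) =
    (\<lambda>\<xi>. of_real (\<mu> \<xi>) * (X cos \<xi> * Y cos \<xi> + X sin \<xi> * Y sin \<xi>))"
    unfolding X_def Y_def sum_product unfolding sum.distrib[symmetric] unfolding sum_distrib_left
    by (intro ext sum.cong refl) (simp add: left_diff_distrib cos_diff algebra_simps)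
  also have "(\<Sum>n\<in>A. \<Sum>m\<in>B. x n * y m * of_real (pi * fker \<mu> (n - m))) = of_real pi * S"
    unfolding S_def sum_distrib_left by (intro sum.cong refl) simp
  finally have I: "((\<lambda>\<xi>. of_real (\<mu> \<xi>) * (X cos \<xi> * Y cos \<xi> + X sin \<xi> * Y sin \<xi>)) has_integral of_real pi * S) {0..pi}" .
  define M where "M = (\<Sum>n\<in>A. (cmod (x n))\<^sup>2) + (\<Sum>m\<in>B. (cmod (y m))\<^sup>2)"
  have J: "((\<lambda>\<xi>. (((cmod (X cos \<xi>))\<^sup>2 + (cmod (X sin \<xi>))\<^sup>2) + ((cmod (Y cos \<xi>))\<^sup>2 + (cmod (Y sin \<xi>))\<^sup>2)) * (1 / 2)) has_integral
     (pi * (\<Sum>n\<in>A. (cmod (x n))\<^sup>2) + pi * (\<Sum>m\<in>B. (cmod (y m))\<^sup>2)) * (1 / 2)) {0..pi}"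
    unfolding X_def Y_def by (intro has_integral_mult_left has_integral_add trig_square_integral fin)
  have "norm (integral {0..pi} (\<lambda>\<xi>. of_real (\<mu> \<xi>) * (X cos \<xi> * Y cos \<xi> + X sin \<xi> * Y sin \<xi>)))
    \<le> integral {0..pi} (\<lambda>\<xi>. (((cmod (X cos \<xi>))\<^sup>2 + (cmod (X sin \<xi>))\<^sup>2) + ((cmod (Y cos \<xi>))\<^sup>2 + (cmod (Y sin \<xi>))\<^sup>2)) * (1 / 2))"
  proof (rule integral_norm_bound_integral)
    fix \<xi>
    have amgm: "a * b \<le> (a\<^sup>2 + b\<^sup>2) / 2" for a b :: real
      using sum_squares_bound[of a b] by simp
    have "cmod (of_real (\<mu> \<xi>) * (X cos \<xi> * Y cos \<xi> + X sin \<xi> * Y sin \<xi>)) \<le> 1 * (cmod (X cos \<xi>) * cmod (Y cos \<xi>) + cmod (X sin \<xi>) * cmod (Y sin \<xi>))"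
      unfolding norm_mult using mu(2)[of \<xi>]
      by (intro mult_mono order_trans[OF norm_triangle_ineq]) (simp_all add: norm_mult)
    also have "\<dots> \<le> (((cmod (X cos \<xi>))\<^sup>2 + (cmod (X sin \<xi>))\<^sup>2) + ((cmod (Y cos \<xi>))\<^sup>2 + (cmod (Y sin \<xi>))\<^sup>2)) * (1 / 2)"
      using amgm[of "cmod (X cos \<xi>)" "cmod (Y cos \<xi>)"] amgm[of "cmod (X sin \<xi>)" "cmod (Y sin \<xi>)"] by simp
    finally show "cmod (of_real (\<mu> \<xi>) * (X cos \<xi> * Y cos \<xi> + X sin \<xi> * Y sin \<xi>)) \<le> (((cmod (X cos \<xi>))\<^sup>2 + (cmod (X sin \<xi>))\<^sup>2) + ((cmod (Y cos \<xi>))\<^sup>2 + (cmod (Y sin \<xi>))\<^sup>2)) * (1 / 2)" .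
  qed (use I J in blast)+
  then have "pi * cmod S \<le> pi * (M / 2)"
    unfolding integral_unique[OF I] integral_unique[OF J] M_def by (simp add: norm_mult distrib_left)
  then show ?thesis unfolding S_def M_def by (simp add: mult_le_cancel_left)
qed

lemma ker_multiplier:
  assumes "k \<in> {sine_ker, cosine_ker}"
  shows "\<exists>\<mu>. k t = fker \<mu> \<and> continuous_on {0..pi} \<mu> \<and> (\<forall>\<xi>. \<bar>\<mu> \<xi>\<bar> \<le> 1)"
  using assms sine_multiplier cosine_multiplier unfolding sine_ker_def cosine_ker_def by blast

lemma ker_form_l2:
  fixes x y :: "int \<Rightarrow> complex"
  assumes "k \<in> {sine_ker, cosine_ker}" "finite A" "finite B"
  shows "cmod (\<Sum>n\<in>A. \<Sum>m\<in>B. x n * y m * of_real (k t (n - m))) \<le> ((\<Sum>n\<in>A. (cmod (x n))\<^sup>2) + (\<Sum>m\<in>B. (cmod (y m))\<^sup>2)) / 2"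
proof -
  obtain \<mu> where mu: "k t = fker \<mu>" "continuous_on {0..pi} \<mu>" "\<And>\<xi>. \<bar>\<mu> \<xi>\<bar> \<le> 1"
    using ker_multiplier[OF assms(1), of t] by auto
  show ?thesis unfolding mu(1) by (rule fker_form_l2[OF assms(2,3) mu(2,3)])
qed

lemma ker_le_1: "k \<in> {sine_ker, cosine_ker} \<Longrightarrow> \<bar>k t n\<bar> \<le> 1"
  using sine_ker_le_1 cosine_ker_le_1 by auto

text \<open>Testing the l^2 form with the kernel itself and the unit mass at 0 gives S \<le> (S +
  1)/2 for the sum S of squares.\<close>

lemma ker_l2_le_1:
  assumes "k \<in> {sine_ker, cosine_ker}" "finite A"
  shows "(\<Sum>n\<in>A. (k t n)\<^sup>2) \<le> 1"
proof -
  have "cmod (\<Sum>n\<in>A. \<Sum>m\<in>{0}. of_real (k t n) * 1 * of_real (k t (n - m))) \<le>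
    ((\<Sum>n\<in>A. (cmod (of_real (k t n)))\<^sup>2) + (\<Sum>m\<in>{0::int}. (cmod 1)\<^sup>2)) / 2"
    by (rule ker_form_l2[OF assms]) auto
  also have "(\<Sum>n\<in>A. \<Sum>m\<in>{0}. of_real (k t n) * 1 * of_real (k t (n - m))) = complex_of_real (\<Sum>n\<in>A. (k t n)\<^sup>2)"
    by (simp add: power2_eq_square)
  finally have "\<bar>\<Sum>n\<in>A. (k t n)\<^sup>2\<bar> \<le> ((\<Sum>n\<in>A. (k t n)\<^sup>2) + 1) / 2"
    unfolding norm_of_real by simp
  then have "(\<Sum>n\<in>A. (k t n)\<^sup>2) \<le> ((\<Sum>n\<in>A. (k t n)\<^sup>2) + 1) / 2" by (rule abs_le_D1)
  then show ?thesis by (simp add: field_simps)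
qed

section \<open>Decay of the kernels in the sup norm and in l^5\<close>

lemma sum_inverse_dist_bound:
  "\<exists>C>0. \<forall>x::real. \<forall>A. finite A \<longrightarrow> (\<Sum>n\<in>A. max 1 \<bar>of_int n - x\<bar> powr (-5/4)) \<le> C"
proof -
  \<comment> \<open>5/4 is five times the exponent 1/4 of the pointwise bound; since it exceeds 1,
    fifth powers sum across a wave front, uniformly in the position \<open>x\<close> of the
    front.\<close>
  have sm: "summable (\<lambda>k. real (Suc k) powr (-5/4))"
    by (subst summable_Suc_iff) (simp add: summable_real_powr_iff)
  define S where "S = (\<Sum>k. real (Suc k) powr (-5/4))"
  have S: "(\<Sum>k\<in>K. real (Suc k) powr (-5/4)) \<le> S" if "finite K" for K
    unfolding S_def by (intro sum_le_suminf sm that) auto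
  have S0: "S \<ge> 0" using S[of "{}"] by simp
  have "(\<Sum>n\<in>A. max 1 \<bar>of_int n - x\<bar> powr (-5/4)) \<le> 2 * (3 powr (5/4) * S)" if A: "finite A" for A and x :: real
  proof -
    define m where "m = \<lfloor>x\<rfloor>"
    define f where "f n = nat \<bar>n - m\<bar>" for n
    have tm: "max 1 \<bar>of_int n - x\<bar> powr (-5/4) \<le> 3 powr (5/4) * real (Suc (f n)) powr (-5/4)" for n
    proof -
      have mx: "of_int m \<le> x" "x < of_int m + 1" by (auto simp: m_def)
      have f: "real (f n) = \<bar>of_int n - of_int m\<bar>" by (simp add: f_def)
      have "real (Suc (f n)) \<le> 3 * max 1 \<bar>of_int n - x\<bar>"
      proof -
        have "1 \<le> max 1 \<bar>of_int n - x\<bar>" "\<bar>of_int n - x\<bar> \<le> max 1 \<bar>of_int n - x\<bar>" by auto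
        moreover have "\<bar>of_int n - of_int m\<bar> \<le> \<bar>of_int n - x\<bar> + 1" using mx by linarith
        ultimately show ?thesis unfolding of_nat_Suc f by linarith
      qed
      then have "real (Suc (f n)) / 3 \<le> max 1 \<bar>of_int n - x\<bar>" by simp
      then have "max 1 \<bar>of_int n - x\<bar> powr (-5/4) \<le> (real (Suc (f n)) / 3) powr (-5/4)"
        by (intro powr_mono2') auto
      also have "\<dots> = real (Suc (f n)) powr (-5/4) / 3 powr (-5/4)"
        by (simp add: powr_divide)
      also have "\<dots> = 3 powr (5/4) * real (Suc (f n)) powr (-5/4)"
        using powr_minus_divide[of "3::real" "5/4"] by simp
      finally show ?thesis .
    qed
    \<comment> \<open>The integer distance to \<open>m\<close> is injective on n \<ge> m and on n <
      m separately, so each half is dominated by one copy of the series.\<close>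
    have part: "(\<Sum>n\<in>B. max 1 \<bar>of_int n - x\<bar> powr (-5/4)) \<le> 3 powr (5/4) * S" if B: "finite B" "inj_on f B" for B
    proof -
      have "(\<Sum>n\<in>B. max 1 \<bar>of_int n - x\<bar> powr (-5/4)) \<le> (\<Sum>n\<in>B. 3 powr (5/4) * real (Suc (f n)) powr (-5/4))"
        by (intro sum_mono tm)
      also have "\<dots> = 3 powr (5/4) * (\<Sum>k\<in>f ` B. real (Suc k) powr (-5/4))"
        by (simp add: sum_distrib_left sum.reindex[OF B(2)])
      also have "\<dots> \<le> 3 powr (5/4) * S" using B by (intro mult_left_mono S) auto
      finally show ?thesis .
    qed
    have "A = (A \<inter> {m..}) \<union> (A \<inter> {..<m})" by auto
    then have "(\<Sum>n\<in>A. max 1 \<bar>of_int n - x\<bar> powr (-5/4)) = (\<Sum>n\<in>A \<inter> {m..}. max 1 \<bar>of_int n - x\<bar> powr (-5/4)) + (\<Sum>n\<in>A \<inter> {..<m}. max 1 \<bar>of_int n - x\<bar> powr (-5/4))"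
      using A by (subst sum.union_disjoint[symmetric]) auto
    also have "\<dots> \<le> 3 powr (5/4) * S + 3 powr (5/4) * S"
      using A by (intro add_mono part) (auto simp: f_def inj_on_def)
    finally show ?thesis by (simp add: mult.commute)
  qed
  then have "\<forall>x::real. \<forall>A. finite A \<longrightarrow> (\<Sum>n\<in>A. max 1 \<bar>of_int n - x\<bar> powr (-5/4)) \<le> 2 * (3 powr (5/4) * S) + 1"
    by (meson add_increasing2 zero_le_one order_trans)
  moreover have "2 * (3 powr (5/4) * S) + 1 > 0" using S0 by (simp add: add_nonneg_pos)
  ultimately show ?thesis by blast
qed

lemma powr_shift_one:
  fixes t a :: real
  assumes "t \<ge> 1" "a \<ge> 0"
  shows "t powr (-a) \<le> 2 powr a * (1 + t) powr (-a)"
proof -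
  have "t powr (-a) \<le> ((1 + t) / 2) powr (-a)" using assms by (intro powr_mono2') auto
  also have "\<dots> = 2 powr a * (1 + t) powr (-a)"
    using assms by (simp add: powr_divide powr_minus field_simps)
  finally show ?thesis .
qed

text \<open>For t \<ge> 1 this sums the pointwise bounds over both fronts. For t < 1 only
  boundedness is at stake: the kernels are at most 1 in absolute value, so fifth powers are below
  squares, which sum to at most 1.\<close>

lemma ker_decay:
  "\<exists>C\<ge>1. \<forall>t\<ge>0. \<forall>k\<in>{sine_ker, cosine_ker}. (\<forall>n. \<bar>k t n\<bar> \<le> C * (1 + t) powr (-1/3)) \<and>
     (\<forall>A. finite A \<longrightarrow> (\<Sum>n\<in>A. \<bar>k t n\<bar> ^ 5) \<le> C * (1 + t) powr (-5/4))"
proof -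
  obtain C where C: "C > 0" and P: "\<forall>t\<ge>1. \<forall>n. \<forall>k\<in>{sine_ker, cosine_ker}. \<bar>k t n\<bar> \<le> C * t powr (-1/3) \<and>
     \<bar>k t n\<bar> \<le> C * t powr (-1/4) * (max 1 \<bar>of_int n - max_speed * t\<bar> powr (-1/4)
       + max 1 \<bar>of_int (-n) - max_speed * t\<bar> powr (-1/4))"
    using kernel_pointwise by (elim exE conjE)
  obtain S where S0: "S > 0" and S: "\<forall>x::real. \<forall>A. finite A \<longrightarrow> (\<Sum>n\<in>A. max 1 \<bar>of_int n - x\<bar> powr (-5/4)) \<le> S"
    using sum_inverse_dist_bound by (elim exE conjE)
  define D where "D = 4 + 2 * C + C^5 * 32 * (S + S) * 2 powr (5/4)"
  have D: "D \<ge> 4" "D \<ge> 2 * C" "D \<ge> C^5 * 32 * (S + S) * 2 powr (5/4)" unfolding D_def using C S0 by auto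
  have two: "2 powr (1/3) \<le> (2::real)" "2 powr (5/4) \<le> (4::real)"
    using powr_mono[of "1/3" 1 2] powr_mono[of "5/4" 2 2] by auto
  have small: "1 \<le> 4 * (1 + t) powr (-a)" if "0 \<le> t" "t \<le> 1" "0 \<le> a" "2 powr a \<le> (4::real)" for t a :: real
  proof -
    have "2 powr (-a) \<le> (1 + t) powr (-a)" using that by (intro powr_mono2') auto
    moreover have "1 \<le> 4 * 2 powr (-a)" using that by (simp add: powr_minus field_simps)
    ultimately show ?thesis by linarith
  qed
  have main: "\<bar>k t n\<bar> \<le> D * (1 + t) powr (-1/3)"
    "finite A \<Longrightarrow> (\<Sum>n\<in>A. \<bar>k t n\<bar> ^ 5) \<le> D * (1 + t) powr (-5/4)"
    if t: "t \<ge> 0" and k: "k \<in> {sine_ker, cosine_ker}" for t k n A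
  proof -
    show "\<bar>k t n\<bar> \<le> D * (1 + t) powr (-1/3)"
    proof (cases "t \<ge> 1")
      case True
      then have "\<bar>k t n\<bar> \<le> C * t powr (-1/3)" using P k by blast
      also have "\<dots> \<le> C * (2 powr (1/3) * (1 + t) powr (-1/3))"
        using powr_shift_one[OF True, of "1/3"] C by (intro mult_left_mono) auto
      also have "\<dots> \<le> C * (2 * (1 + t) powr (-1/3))"
        using C two by (intro mult_left_mono mult_right_mono) auto
      also have "\<dots> \<le> D * (1 + t) powr (-1/3)" using mult_right_mono[OF D(2), of "(1 + t) powr (-1/3)"] by simp
      finally show ?thesis .
    next
      case False
      have "\<bar>k t n\<bar> \<le> 1" using k by (rule ker_le_1)
      also have "\<dots> \<le> 4 * (1 + t) powr (-(1/3))" using False t two by (intro small) auto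
      also have "\<dots> \<le> D * (1 + t) powr (-(1/3))" using D by (intro mult_right_mono) auto
      finally show ?thesis by simp
    qed
    assume A: "finite A"
    show "(\<Sum>n\<in>A. \<bar>k t n\<bar> ^ 5) \<le> D * (1 + t) powr (-5/4)"
    proof (cases "t \<ge> 1")
      case True
      define a where "a n = max 1 \<bar>of_int n - max_speed * t\<bar>" for n
      have a: "a n \<ge> 1" for n by (simp add: a_def)
      have pw: "\<bar>k t n\<bar> ^ 5 \<le> C^5 * 32 * t powr (-5/4) * (a n powr (-5/4) + a (-n) powr (-5/4))" for n
      proof -
        let ?p = "a n powr (-1/4)" and ?q = "a (-n) powr (-1/4)"
        have "\<bar>k t n\<bar> \<le> C * t powr (-1/4) * (?p + ?q)"
          using P[rule_format, OF True k] unfolding a_def by blast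
        also have "\<dots> \<le> C * t powr (-1/4) * (2 * max ?p ?q)" using C by (intro mult_left_mono) auto
        finally have "\<bar>k t n\<bar> ^ 5 \<le> (C * t powr (-1/4) * (2 * max ?p ?q)) ^ 5" by (intro power_mono) auto
        also have "\<dots> = C^5 * 32 * (t powr (-1/4)) ^ 5 * (max ?p ?q) ^ 5" by (simp add: power_mult_distrib)
        also have "(t powr (-1/4)) ^ 5 = t powr (-5/4)" using True by (simp add: powr_power)
        also have "(max ?p ?q) ^ 5 \<le> ?p ^ 5 + ?q ^ 5" by (simp add: max_def)
        also have "?p ^ 5 = a n powr (-5/4)" using a[of n] by (subst powr_power) auto
        also have "?q ^ 5 = a (-n) powr (-5/4)" using a[of "-n"] by (subst powr_power) auto
        finally show ?thesis using C by (simp add: mult_left_mono)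
      qed
      have "(\<Sum>n\<in>A. \<bar>k t n\<bar> ^ 5) \<le> (\<Sum>n\<in>A. C^5 * 32 * t powr (-5/4) * (a n powr (-5/4) + a (-n) powr (-5/4)))"
        by (intro sum_mono pw)
      also have "\<dots> = C^5 * 32 * t powr (-5/4) * ((\<Sum>n\<in>A. a n powr (-5/4)) + (\<Sum>n\<in>uminus ` A. a n powr (-5/4)))"
      proof -
        have "(\<Sum>n\<in>uminus ` A. a n powr (-5/4)) = (\<Sum>n\<in>A. a (-n) powr (-5/4))"
          by (subst sum.reindex) auto
        then show ?thesis by (simp only: sum_distrib_left[symmetric] sum.distrib)
      qed
      also have "\<dots> \<le> C^5 * 32 * t powr (-5/4) * (S + S)"
        using C S A unfolding a_def by (intro mult_left_mono add_mono) auto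
      also have "\<dots> = C^5 * 32 * (S + S) * t powr (-5/4)" by simp
      also have "\<dots> \<le> C^5 * 32 * (S + S) * (2 powr (5/4) * (1 + t) powr (-5/4))"
        using powr_shift_one[OF True, of "5/4"] C S0 by (intro mult_left_mono) auto
      also have "\<dots> \<le> D * (1 + t) powr (-5/4)" using mult_right_mono[OF D(3), of "(1 + t) powr (-5/4)"] by simp
      finally show ?thesis .
    next
      case False
      have "(\<Sum>n\<in>A. \<bar>k t n\<bar> ^ 5) \<le> (\<Sum>n\<in>A. (k t n)\<^sup>2)"
      proof (rule sum_mono)
        fix n
        have "\<bar>k t n\<bar> ^ 5 \<le> \<bar>k t n\<bar> ^ 2" using ker_le_1[OF k, of t n] by (intro power_decreasing) auto
        then show "\<bar>k t n\<bar> ^ 5 \<le> (k t n)\<^sup>2" by simp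
      qed
      also have "\<dots> \<le> 1" by (rule ker_l2_le_1[OF k A])
      also have "\<dots> \<le> 4 * (1 + t) powr (-(5/4))" using False t two by (intro small) auto
      also have "\<dots> \<le> D * (1 + t) powr (-(5/4))" using D by (intro mult_right_mono) auto
      finally show ?thesis by simp
    qed
  qed
  show ?thesis
    by (intro exI[of _ D] conjI allI impI ballI main) (use D in auto)
qed

section \<open>Interpolation\<close>

text \<open>Hadamard's theorem. The factor \<open>W\<close>, of modulus M0^(-(1 - Re z)) M1^(-Re z),
  normalises both edges to 1; the Gaussian exp(e (z^2 - 1)) makes the function small far up the
  strip, so that the maximum principle on a rectangle suffices, and e tends to 0 at the end.\<close>

lemma three_lines:
  assumes hol: "G holomorphic_on UNIV"
    and bdd: "\<And>z. 0 \<le> Re z \<Longrightarrow> Re z \<le> 1 \<Longrightarrow> cmod (G z) \<le> B"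
    and left: "\<And>z. Re z = 0 \<Longrightarrow> cmod (G z) \<le> M0"
    and right: "\<And>z. Re z = 1 \<Longrightarrow> cmod (G z) \<le> M1"
    and M: "M0 > 0" "M1 > 0" and th: "0 \<le> \<theta>" "\<theta> \<le> 1"
  shows "cmod (G (of_real \<theta>)) \<le> M0 powr (1 - \<theta>) * M1 powr \<theta>"
proof -
  have "cmod (G 0) \<le> B" by (rule bdd) auto
  then have B0: "B \<ge> 0" using norm_ge_zero[of "G 0"] by linarith
  define W where "W z = exp (of_real (- ln M0) * (1 - z) + of_real (- ln M1) * z)" for z :: complex
  have W: "cmod (W z) = exp (- (ln M0 * (1 - Re z) + ln M1 * Re z))" for z
    by (simp add: W_def norm_exp_eq_Re)
  define B' where "B' = B * exp (\<bar>ln M0\<bar> + \<bar>ln M1\<bar>) + 1"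
  have B': "B' \<ge> 1" using B0 by (simp add: B'_def)
  have GW: "cmod (G z * W z) \<le> B'" if "0 \<le> Re z" "Re z \<le> 1" for z
  proof -
    have "- (ln M0 * (1 - Re z)) \<le> \<bar>ln M0\<bar> * 1"
      using that by (intro order_trans[OF abs_ge_self[of "- (ln M0 * (1 - Re z))", unfolded abs_minus_cancel abs_mult]] mult_left_mono) auto
    moreover have "- (ln M1 * Re z) \<le> \<bar>ln M1\<bar> * 1"
      using that by (intro order_trans[OF abs_ge_self[of "- (ln M1 * Re z)", unfolded abs_minus_cancel abs_mult]] mult_left_mono) auto
    ultimately have "cmod (W z) \<le> exp (\<bar>ln M0\<bar> + \<bar>ln M1\<bar>)" unfolding W by simp
    then have "cmod (G z) * cmod (W z) \<le> B * exp (\<bar>ln M0\<bar> + \<bar>ln M1\<bar>)"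
      using bdd[OF that] B0 by (intro mult_mono) auto
    then show ?thesis by (simp add: norm_mult B'_def)
  qed
  have GW0: "cmod (G z * W z) \<le> 1" if "Re z = 0 \<or> Re z = 1" for z
    using that
  proof
    assume z: "Re z = 0"
    then have "cmod (W z) = inverse M0" using M by (simp add: W exp_minus)
    then have "cmod (G z * W z) = cmod (G z) / M0" by (simp only: norm_mult divide_inverse)
    then show ?thesis using left[OF z] M by simp
  next
    assume z: "Re z = 1"
    then have "cmod (W z) = inverse M1" using M by (simp add: W exp_minus)
    then have "cmod (G z * W z) = cmod (G z) / M1" by (simp only: norm_mult divide_inverse)
    then show ?thesis using right[OF z] M by simp
  qed
  have eps: "cmod (G (of_real \<theta>) * W (of_real \<theta>)) \<le> exp e" if e: "e > 0" for e :: real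
  proof -
    \<comment> \<open>At this height the Gaussian has size at most exp(-e R^2) = 1/B', which cancels
      the crude bound \<open>B'\<close> on the horizontal sides.\<close>
    define R where "R = sqrt (ln B' / e)"
    have R: "R \<ge> 0" "e * R\<^sup>2 = ln B'" using e B' by (auto simp: R_def)
    define F where "F z = G z * W z * exp (of_real e * (z\<^sup>2 - 1))" for z
    define S where "S = cbox (Complex 0 (-R)) (Complex 1 R)"
    have hF: "F holomorphic_on A" for A unfolding F_def W_def
      by (intro holomorphic_intros holomorphic_on_subset[OF hol]) auto
    have nE: "cmod (exp (of_real e * (z\<^sup>2 - 1))) = exp (e * ((Re z)\<^sup>2 - (Im z)\<^sup>2 - 1))" for z
      by (simp add: norm_exp_eq_Re power2_eq_square)
    have "cmod (F (of_real \<theta>)) \<le> 1"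
    proof (rule maximum_modulus_frontier[of F S])
      show "F holomorphic_on interior S" by (rule hF)
      show "continuous_on (closure S) F" by (rule holomorphic_on_imp_continuous_on[OF hF])
      show "bounded S" by (simp add: S_def)
      show "of_real \<theta> \<in> S" using th R by (simp add: S_def in_cbox_complex_iff)
      fix z assume "z \<in> frontier S"
      then have z: "z \<in> S" "z \<notin> box (Complex 0 (-R)) (Complex 1 R)"
        unfolding frontier_def S_def by (auto simp: interior_cbox)
      then have zS: "0 \<le> Re z" "Re z \<le> 1" "- R \<le> Im z" "Im z \<le> R" by (auto simp: S_def in_cbox_complex_iff)
      have sq: "(Re z)\<^sup>2 \<le> 1" using zS by (simp add: power_le_one)
      have cases: "(Re z = 0 \<or> Re z = 1) \<or> \<bar>Im z\<bar> = R"
        using z zS by (auto simp: in_box_complex_iff)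
      show "cmod (F z) \<le> 1"
      proof (cases "Re z = 0 \<or> Re z = 1")
        case True
        have "e * ((Re z)\<^sup>2 - (Im z)\<^sup>2 - 1) \<le> 0"
          using sq e zero_le_power2[of "Im z"] by (intro mult_nonneg_nonpos) linarith+
        then have "cmod (G z * W z) * cmod (exp (of_real e * (z\<^sup>2 - 1))) \<le> 1 * 1"
          unfolding nE by (intro mult_mono GW0 True) auto
        then show ?thesis by (simp add: F_def norm_mult)
      next
        case False
        then have "\<bar>Im z\<bar>\<^sup>2 = R\<^sup>2" using cases by simp
        then have Im: "(Im z)\<^sup>2 = R\<^sup>2" by simp
        have "e * ((Re z)\<^sup>2 - (Im z)\<^sup>2 - 1) \<le> e * (- R\<^sup>2)" unfolding Im using sq e by (intro mult_left_mono) linarith+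
        also have "\<dots> = - ln B'" using R by simp
        finally have "exp (e * ((Re z)\<^sup>2 - (Im z)\<^sup>2 - 1)) \<le> exp (- ln B')" by simp
        also have "exp (- ln B') = inverse B'" using B' by (simp only: exp_minus) simp
        finally have "exp (e * ((Re z)\<^sup>2 - (Im z)\<^sup>2 - 1)) \<le> inverse B'" .
        then have "cmod (G z * W z) * cmod (exp (of_real e * (z\<^sup>2 - 1))) \<le> B' * inverse B'"
          unfolding nE using B' by (intro mult_mono GW zS) auto
        then show ?thesis using B' by (simp add: F_def norm_mult)
      qed
    qed
    moreover have "cmod (F (of_real \<theta>)) = cmod (G (of_real \<theta>) * W (of_real \<theta>)) * exp (e * (\<theta>\<^sup>2 - 1))"
      unfolding F_def norm_mult nE by simp
    moreover have "exp (e * (\<theta>\<^sup>2 - 1)) \<ge> exp (- e)" using e by (simp add: algebra_simps)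
    ultimately have "cmod (G (of_real \<theta>) * W (of_real \<theta>)) * exp (- e) \<le> 1"
      using mult_left_mono[of "exp (- e)" "exp (e * (\<theta>\<^sup>2 - 1))" "cmod (G (of_real \<theta>) * W (of_real \<theta>))"] by simp
    then show ?thesis by (simp add: exp_minus field_simps)
  qed
  have "cmod (G (of_real \<theta>) * W (of_real \<theta>)) \<le> 1"
  proof (rule field_le_epsilon)
    fix d :: real assume d: "d > 0"
    have "exp (ln (1 + d)) = 1 + d" using d by simp
    then show "cmod (G (of_real \<theta>) * W (of_real \<theta>)) \<le> 1 + d" using eps[of "ln (1 + d)"] d by simp
  qed
  moreover have "cmod (W (of_real \<theta>)) = inverse (M0 powr (1 - \<theta>) * M1 powr \<theta>)"
    unfolding W Re_complex_of_real exp_minus exp_add using M by (simp add: powr_def mult.commute)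
  ultimately show ?thesis using M by (simp add: norm_mult field_simps)
qed

text \<open>Hoelder's inequality with exponents 1/l and 1/(1-l): after division by \<open>P\<close>
  and \<open>Q\<close> it is the weighted arithmetic-geometric mean inequality summed over
  \<open>A\<close>.\<close>

lemma holder_sum:
  fixes a b :: "'i \<Rightarrow> real"
  assumes "0 \<le> l" "l \<le> 1" "finite A" and a: "\<And>i. i \<in> A \<Longrightarrow> a i \<ge> 0" "sum a A \<le> P"
    and b: "\<And>i. i \<in> A \<Longrightarrow> b i \<ge> 0" "sum b A \<le> Q"
  shows "(\<Sum>i\<in>A. a i powr l * b i powr (1 - l)) \<le> P powr l * Q powr (1 - l)"
proof -
  have PQ: "P \<ge> 0" "Q \<ge> 0" using sum_nonneg[of A a] sum_nonneg[of A b] a b by auto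
  show ?thesis
  proof (cases "P = 0 \<or> Q = 0")
    case True
    then have "(\<forall>i\<in>A. a i = 0) \<or> (\<forall>i\<in>A. b i = 0)"
    proof
      assume "P = 0"
      then have "sum a A = 0" using a sum_nonneg[of A a] by force
      then show ?thesis using a assms(3) by (simp add: sum_nonneg_eq_0_iff)
    next
      assume "Q = 0"
      then have "sum b A = 0" using b sum_nonneg[of A b] by force
      then show ?thesis using b assms(3) by (simp add: sum_nonneg_eq_0_iff)
    qed
    \<comment> \<open>As \<open>0 powr 0 = 0\<close>, a vanishing factor kills the summand even for
      l = 0 or l = 1.\<close>
    then have "(\<Sum>i\<in>A. a i powr l * b i powr (1 - l)) = 0" by (intro sum.neutral) auto
    then show ?thesis by simp
  next
    case False
    then have pos: "P > 0" "Q > 0" using PQ by auto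
    have "(\<Sum>i\<in>A. a i powr l * b i powr (1 - l)) \<le> (\<Sum>i\<in>A. P powr l * Q powr (1 - l) * (l * (a i / P) + (1 - l) * (b i / Q)))"
    proof (rule sum_mono)
      fix i assume i: "i \<in> A"
      have "(a i / P) powr l * (b i / Q) powr (1 - l) \<le> l * (a i / P) + (1 - l) * (b i / Q)"
      proof (cases "a i = 0 \<or> b i = 0")
        case True
        then have "(a i / P) powr l * (b i / Q) powr (1 - l) = 0" by auto
        moreover have "0 \<le> l * (a i / P)" "0 \<le> (1 - l) * (b i / Q)"
          using a(1)[OF i] b(1)[OF i] pos assms(1,2) by (auto intro!: mult_nonneg_nonneg divide_nonneg_pos)
        ultimately show ?thesis by linarith
      next
        case False
        then show ?thesis using a(1)[OF i] b(1)[OF i] pos assms by (intro Youngs_inequality_0) auto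
      qed
      then have "P powr l * Q powr (1 - l) * ((a i / P) powr l * (b i / Q) powr (1 - l)) \<le> P powr l * Q powr (1 - l) * (l * (a i / P) + (1 - l) * (b i / Q))"
        by (intro mult_left_mono) auto
      moreover have "P powr l * Q powr (1 - l) * ((a i / P) powr l * (b i / Q) powr (1 - l)) = a i powr l * b i powr (1 - l)"
        using a(1)[OF i] b(1)[OF i] pos by (simp add: powr_divide)
      ultimately show "a i powr l * b i powr (1 - l) \<le> P powr l * Q powr (1 - l) * (l * (a i / P) + (1 - l) * (b i / Q))" by simp
    qed
    also have "\<dots> = P powr l * Q powr (1 - l) * (l * (sum a A / P) + (1 - l) * (sum b A / Q))"
    proof -
      have "(\<Sum>i\<in>A. l * (a i / P) + (1 - l) * (b i / Q)) = l * (sum a A / P) + (1 - l) * (sum b A / Q)"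
        by (subst sum.distrib) (simp add: sum_distrib_left sum_divide_distrib)
      then show ?thesis by (simp only: sum_distrib_left[symmetric])
    qed
    also have "\<dots> \<le> P powr l * Q powr (1 - l) * (l * 1 + (1 - l) * 1)"
      using a b pos assms by (intro mult_left_mono add_mono) auto
    finally show ?thesis by simp
  qed
qed

text \<open>Interpolation between the l^2 bound 1 and the l^1 to l^\<infinity> bound
  \<open>M\<close>, by the three lines theorem for the form evaluated on an analytic deformation of
  both vectors.\<close>

lemma riesz_thorin_normalized:
  fixes x :: "'i \<Rightarrow> complex" and y :: "'j \<Rightarrow> complex" and k :: "'i \<Rightarrow> 'j \<Rightarrow> complex"
  assumes fin: "finite A" "finite B"
    and l2: "\<And>x y. cmod (\<Sum>n\<in>A. \<Sum>m\<in>B. x n * y m * k n m) \<le> ((\<Sum>n\<in>A. (cmod (x n))\<^sup>2) + (\<Sum>m\<in>B. (cmod (y m))\<^sup>2)) / 2"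
    and l1: "\<And>n m. n \<in> A \<Longrightarrow> m \<in> B \<Longrightarrow> cmod (k n m) \<le> M" and M: "M > 0"
    and q: "1 \<le> q" "q \<le> 2"
    and x: "(\<Sum>n\<in>A. cmod (x n) powr q) \<le> 1" and y: "(\<Sum>m\<in>B. cmod (y m) powr q) \<le> 1"
  shows "cmod (\<Sum>n\<in>A. \<Sum>m\<in>B. x n * y m * k n m) \<le> M powr (2 / q - 1)"
proof -
  \<comment> \<open>Phase of w times |w|^(q (1+z)/2): on Re z = 0 its square has modulus |w|^q (unit
    vector of l^2), on Re z = 1 it has modulus |w|^q itself (unit vector of l^1), and at z = 2/q - 1
    it returns w.\<close>
  define P where "P z w = sgn w * exp (of_real (q * ln (cmod w)) * ((1 + z) / 2))" for z w :: complex
  have nP: "cmod (P z w) = (if w = 0 then 0 else cmod w powr (q * (1 + Re z) / 2))" for z w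
    by (simp add: P_def norm_mult norm_sgn norm_exp_eq_Re powr_def)
  have P0: "(cmod (P z w))\<^sup>2 = cmod w powr q" if "Re z = 0" for z w
    using that by (simp add: nP powr_power)
  have P1: "cmod (P z w) = cmod w powr q" if "Re z = 1" for z w
    using that by (simp add: nP)
  have Pth: "P (of_real (2 / q - 1)) w = w" for w
  proof (cases "w = 0")
    case False
    have "of_real (q * ln (cmod w)) * ((1 + of_real (2 / q - 1)) / 2) = complex_of_real (ln (cmod w))"
      using q by (simp add: field_simps)
    then have "P (of_real (2 / q - 1)) w = sgn w * of_real (exp (ln (cmod w)))"
      by (simp only: P_def exp_of_real)
    then show ?thesis using False by (simp add: sgn_eq)
  qed (simp add: P_def)
  have small: "cmod (w i) \<le> 1" if "i \<in> I" "finite I" "(\<Sum>n\<in>I. cmod (w n) powr q) \<le> 1" for w and i :: 'l and I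
  proof -
    have "cmod (w i) powr q \<le> (\<Sum>n\<in>I. cmod (w n) powr q)" using that by (intro member_le_sum) auto
    then have "cmod (w i) powr q \<le> 1" using that by simp
    moreover have "1 powr q < cmod (w i) powr q" if "cmod (w i) > 1"
      using that q by (intro powr_less_mono2) auto
    ultimately show ?thesis by (cases "cmod (w i) > 1") auto
  qed
  define F where "F z = (\<Sum>n\<in>A. \<Sum>m\<in>B. P z (x n) * P z (y m) * k n m)" for z
  have tri: "cmod (F z) \<le> (\<Sum>n\<in>A. \<Sum>m\<in>B. cmod (P z (x n)) * cmod (P z (y m)) * cmod (k n m))" for z
    unfolding F_def by (intro order_trans[OF norm_sum] sum_mono) (simp add: norm_mult)
  have "cmod (F (of_real (2 / q - 1))) \<le> 1 powr (1 - (2 / q - 1)) * M powr (2 / q - 1)"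
  proof (rule three_lines)
    show "F holomorphic_on UNIV" unfolding F_def P_def by (intro holomorphic_intros) auto
    show "cmod (F z) \<le> (\<Sum>n\<in>A. \<Sum>m\<in>B. 1 * 1 * cmod (k n m))" if z: "0 \<le> Re z" "Re z \<le> 1" for z
    proof -
      have P: "cmod (P z w) \<le> 1" if "cmod w \<le> 1" for w
        using that z q powr_mono2[of "q * (1 + Re z) / 2" "cmod w" 1] by (simp add: nP)
      show ?thesis
        by (rule order_trans[OF tri]) (intro sum_mono mult_mono P small[OF _ fin(1) x] small[OF _ fin(2) y]; simp)
    qed
    show "cmod (F z) \<le> 1" if z: "Re z = 0" for z
      using l2[of "\<lambda>n. P z (x n)" "\<lambda>m. P z (y m)"] x y unfolding F_def P0[OF z] by (simp add: field_simps)
    show "cmod (F z) \<le> M" if z: "Re z = 1" for z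
    proof -
      have "cmod (F z) \<le> (\<Sum>n\<in>A. \<Sum>m\<in>B. cmod (x n) powr q * cmod (y m) powr q * M)"
        by (rule order_trans[OF tri]) (unfold P1[OF z], intro sum_mono mult_left_mono l1; simp)
      also have "\<dots> = (\<Sum>n\<in>A. cmod (x n) powr q) * (\<Sum>m\<in>B. cmod (y m) powr q) * M"
        unfolding sum_product unfolding sum_distrib_right ..
      also have "\<dots> \<le> 1 * 1 * M" using x y M by (intro mult_right_mono mult_mono) (auto simp: sum_nonneg)
      finally show ?thesis by simp
    qed
  qed (use M q in \<open>auto simp: field_simps\<close>)
  then show ?thesis unfolding F_def Pth by simp
qed

text \<open>Homogeneity in \<open>x\<close> only: \<open>y\<close> ranges over the unit ball of l^q,
  as the duality argument will require.\<close>

lemma riesz_thorin_form: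
  fixes x :: "'i \<Rightarrow> complex" and y :: "'j \<Rightarrow> complex" and k :: "'i \<Rightarrow> 'j \<Rightarrow> complex"
  assumes fin: "finite A" "finite B"
    and l2: "\<And>x y. cmod (\<Sum>n\<in>A. \<Sum>m\<in>B. x n * y m * k n m) \<le> ((\<Sum>n\<in>A. (cmod (x n))\<^sup>2) + (\<Sum>m\<in>B. (cmod (y m))\<^sup>2)) / 2"
    and l1: "\<And>n m. n \<in> A \<Longrightarrow> m \<in> B \<Longrightarrow> cmod (k n m) \<le> M" and M: "M > 0"
    and q: "1 \<le> q" "q \<le> 2"
    and x: "(\<Sum>n\<in>A. cmod (x n) powr q) \<le> X powr q" "X \<ge> 0" and y: "(\<Sum>m\<in>B. cmod (y m) powr q) \<le> 1"
  shows "cmod (\<Sum>n\<in>A. \<Sum>m\<in>B. x n * y m * k n m) \<le> M powr (2 / q - 1) * X"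
proof (cases "X = 0")
  case True
  then have "(\<Sum>n\<in>A. cmod (x n) powr q) = 0" using x sum_nonneg[of A "\<lambda>n. cmod (x n) powr q"] by force
  then have "\<forall>n\<in>A. x n = 0" using fin by (simp add: sum_nonneg_eq_0_iff)
  then show ?thesis using True by simp
next
  case False
  then have X: "X > 0" using x by simp
  have "cmod (\<Sum>n\<in>A. \<Sum>m\<in>B. (x n / of_real X) * y m * k n m) \<le> M powr (2 / q - 1)"
  proof (rule riesz_thorin_normalized[OF fin l2 l1 M q _ y])
    have "(\<Sum>n\<in>A. cmod (x n / of_real X) powr q) = (\<Sum>n\<in>A. cmod (x n) powr q) / X powr q"
      using X by (simp add: norm_divide powr_divide sum_divide_distrib)
    then show "(\<Sum>n\<in>A. cmod (x n / of_real X) powr q) \<le> 1" using x X by simp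
  qed
  moreover have "(\<Sum>n\<in>A. \<Sum>m\<in>B. (x n / of_real X) * y m * k n m) = (\<Sum>n\<in>A. \<Sum>m\<in>B. x n * y m * k n m) / of_real X"
    by (simp add: sum_divide_distrib)
  ultimately have "cmod (\<Sum>n\<in>A. \<Sum>m\<in>B. x n * y m * k n m) / X \<le> M powr (2 / q - 1)"
    using X by (simp only: norm_divide norm_of_real abs_of_pos)
  then show ?thesis using X by (simp add: pos_divide_le_eq)
qed

section \<open>Summability classes and dispersive estimates\<close>

text \<open>Membership in l^p and a bound on the norm in one statement about finite sums. It passes
  to pointwise limits, and it cannot hold for a non-summable family, for which
  \<open>lp_norm\<close> would be a meaningless 0.\<close>

definition lp_bounded :: "real \<Rightarrow> (int \<Rightarrow> complex) \<Rightarrow> real \<Rightarrow> bool" where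
  "lp_bounded p x B \<longleftrightarrow> B \<ge> 0 \<and> (\<forall>A. finite A \<longrightarrow> (\<Sum>n\<in>A. cmod (x n) powr p) \<le> B powr p)"

lemma lp_boundedD: "lp_bounded p x B \<Longrightarrow> finite A \<Longrightarrow> (\<Sum>n\<in>A. cmod (x n) powr p) \<le> B powr p"
  and lp_bounded_nonneg: "lp_bounded p x B \<Longrightarrow> B \<ge> 0"
  by (auto simp: lp_bounded_def)

lemma lp_bounded_lp_norm:
  assumes "x \<in> lp_space p" "p > 0"
  shows "lp_bounded p x (lp_norm p x)"
proof -
  have s: "(\<lambda>n. cmod (x n) powr p) summable_on UNIV" using assms by (simp add: lp_space_def)
  have "(\<Sum>n\<in>A. cmod (x n) powr p) \<le> lp_norm p x powr p" if "finite A" for A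
  proof -
    have "(\<Sum>n\<in>A. cmod (x n) powr p) \<le> (\<Sum>\<^sub>\<infinity>n. cmod (x n) powr p)"
      using that by (intro finite_sum_le_infsum s) auto
    also have "\<dots> = lp_norm p x powr p"
      using assms by (simp add: lp_norm_def powr_powr infsum_nonneg)
    finally show ?thesis .
  qed
  then show ?thesis by (simp add: lp_bounded_def lp_norm_def)
qed

lemma lp_boundedI_norm:
  assumes "lp_bounded p x B" "p > 0"
  shows "x \<in> lp_space p" "lp_norm p x \<le> B"
proof -
  have s: "(\<lambda>n. cmod (x n) powr p) summable_on UNIV"
    using assms by (intro nonneg_bdd_above_summable_on) (auto simp: lp_bounded_def bdd_above_def)
  then show "x \<in> lp_space p" by (simp add: lp_space_def)
  have "(\<Sum>\<^sub>\<infinity>n. cmod (x n) powr p) \<le> B powr p"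
    using assms by (intro infsum_le_finite_sums s) (auto simp: lp_bounded_def)
  then have "lp_norm p x \<le> (B powr p) powr (1 / p)"
    unfolding lp_norm_def using assms by (intro powr_mono2) (auto simp: infsum_nonneg)
  then show "lp_norm p x \<le> B" using assms by (simp add: powr_powr lp_bounded_def)
qed

lemma lp_bounded_pointwise:
  assumes "lp_bounded p x B" "p > 0"
  shows "cmod (x n) \<le> B"
proof -
  have "cmod (x n) powr p \<le> B powr p" using lp_boundedD[OF assms(1), of "{n}"] by simp
  moreover have "B powr p < cmod (x n) powr p" if "B < cmod (x n)"
    using that assms lp_bounded_nonneg[OF assms(1)] by (intro powr_less_mono2) auto
  ultimately show ?thesis by (cases "B < cmod (x n)") auto
qed

text \<open>On sequences l^q lies in l^p for q \<le> p with constant 1, since the excess power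
  |x_n|^(p-q) is at most B^(p-q).\<close>

lemma lp_bounded_embed:
  assumes "lp_bounded q x B" "0 < q" "q \<le> p"
  shows "lp_bounded p x B"
proof -
  have B: "B \<ge> 0" using assms by (simp add: lp_bounded_def)
  have "(\<Sum>n\<in>A. cmod (x n) powr p) \<le> B powr p" if "finite A" for A
  proof -
    have "(\<Sum>n\<in>A. cmod (x n) powr p) \<le> (\<Sum>n\<in>A. B powr (p - q) * cmod (x n) powr q)"
    proof (rule sum_mono)
      fix n
      have "cmod (x n) powr (p - q) \<le> B powr (p - q)"
        using lp_bounded_pointwise[OF assms(1,2)] assms by (intro powr_mono2) auto
      then have "cmod (x n) powr (p - q) * cmod (x n) powr q \<le> B powr (p - q) * cmod (x n) powr q"
        by (rule mult_right_mono) auto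
      then show "cmod (x n) powr p \<le> B powr (p - q) * cmod (x n) powr q" by (simp flip: powr_add)
    qed
    also have "\<dots> \<le> B powr (p - q) * B powr q"
      unfolding sum_distrib_left[symmetric] using lp_boundedD[OF assms(1) that] by (intro mult_left_mono) auto
    finally show ?thesis by (simp flip: powr_add)
  qed
  then show ?thesis using B by (simp add: lp_bounded_def)
qed

lemma lp_bounded_mono: "lp_bounded p x B \<Longrightarrow> B \<le> B' \<Longrightarrow> p > 0 \<Longrightarrow> lp_bounded p x B'"
  unfolding lp_bounded_def by (meson less_imp_le order_trans powr_mono2)

text \<open>Converse of Hoelder's inequality, so that l^p estimates of a solution reduce to bilinear
  forms with finitely supported test vectors.\<close>

lemma lp_bounded_dual:
  assumes p: "p > 1" "1 / p + 1 / q = 1" and B: "B \<ge> 0"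
    and dual: "\<And>A y. finite A \<Longrightarrow> (\<Sum>n\<in>A. cmod (y n) powr q) \<le> 1 \<Longrightarrow> cmod (\<Sum>n\<in>A. y n * x n) \<le> B"
  shows "lp_bounded p x B"
proof -
  have q: "q = p / (p - 1)" "q > 1"
  proof -
    have "1 / q = (p - 1) / p" using p by (simp add: field_simps)
    then have "1 / (1 / q) = 1 / ((p - 1) / p)" by simp
    then show qp: "q = p / (p - 1)" by simp
    show "q > 1" unfolding qp using p by simp
  qed
  have "(\<Sum>n\<in>A. cmod (x n) powr p) \<le> B powr p" if A: "finite A" for A
  proof (cases "(\<Sum>n\<in>A. cmod (x n) powr p) = 0")
    case False
    define S where "S = (\<Sum>n\<in>A. cmod (x n) powr p)"
    have S: "S > 0" using False unfolding S_def by (simp add: sum_nonneg less_le)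
    \<comment> \<open>The extremal vector of Hoelder's inequality; the conjugate phase appears
      because the pairing is bilinear.\<close>
    define y where "y n = of_real (cmod (x n) powr (p - 1) / S powr (1 / q)) * cnj (sgn (x n))" for n
    have ny: "cmod (y n) powr q = cmod (x n) powr p / S" for n
    proof (cases "x n = 0")
      case False
      have "cmod (y n) = cmod (x n) powr (p - 1) / S powr (1 / q)"
        using False by (simp add: y_def norm_mult norm_sgn norm_divide)
      then have "cmod (y n) powr q = cmod (x n) powr ((p - 1) * q) / S powr (1 / q * q)"
        by (simp add: powr_divide powr_powr)
      also have "(p - 1) * q = p" using p q by simp
      finally show ?thesis using q S p by simp
    qed (use q in \<open>simp add: y_def\<close>)
    have yx: "y n * x n = of_real (cmod (x n) powr p / S powr (1 / q))" for n
    proof (cases "x n = 0")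
      case False
      have "cnj (sgn (x n)) * x n = of_real (cmod (x n))"
        using False by (simp add: sgn_eq complex_norm_square[symmetric] power2_eq_square mult.commute)
      then have "y n * x n = of_real (cmod (x n) powr (p - 1) / S powr (1 / q) * cmod (x n))"
        by (simp add: y_def)
      also have "cmod (x n) powr (p - 1) / S powr (1 / q) * cmod (x n) = cmod (x n) powr p / S powr (1 / q)"
        using False powr_add[of "cmod (x n)" "p - 1" 1] by simp
      finally show ?thesis .
    qed auto
    have "cmod (\<Sum>n\<in>A. y n * x n) \<le> B"
      using S by (intro dual A) (simp add: ny S_def[symmetric] flip: sum_divide_distrib)
    moreover have "(\<Sum>n\<in>A. y n * x n) = of_real (S / S powr (1 / q))"
      unfolding yx S_def by (simp add: sum_divide_distrib)
    ultimately have "S / S powr (1 / q) \<le> B" using S by (simp only: norm_of_real abs_of_pos divide_pos_pos powr_gt_zero)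
    also have "S / S powr (1 / q) = S powr (1 / p)"
    proof -
      have "1 / p = 1 - 1 / q" using p by simp
      then show ?thesis using S by (simp only: powr_diff) simp
    qed
    finally have "(S powr (1 / p)) powr p \<le> B powr p" using p by (intro powr_mono2) auto
    then show ?thesis using S p by (simp add: powr_powr S_def)
  qed simp
  then show ?thesis using B by (simp add: lp_bounded_def)
qed

text \<open>The first family is Riesz-Thorin with the sup bound on the kernel, raised to the power
  2/q - 1. The second is Hoelder's inequality between l^(5/4) and the l^5 norm of the kernel, whose
  fifth power decays at the rate 5/4.\<close>

lemma dispersive_forms:
  "\<exists>C\<ge>1. \<forall>t\<ge>0. \<forall>k\<in>{sine_ker, cosine_ker}. \<forall>(x :: int \<Rightarrow> complex) A X. finite A \<longrightarrow> X \<ge> 0 \<longrightarrow>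
    (\<forall>q y B. 1 \<le> q \<longrightarrow> q \<le> 2 \<longrightarrow> finite B \<longrightarrow> (\<Sum>n\<in>A. cmod (x n) powr q) \<le> X powr q \<longrightarrow>
       (\<Sum>m\<in>B. cmod (y m) powr q) \<le> 1 \<longrightarrow>
       cmod (\<Sum>n\<in>A. \<Sum>m\<in>B. x n * y m * of_real (k t (n - m))) \<le> C * (1 + t) powr (- ((2 / q - 1) / 3)) * X) \<and>
    (\<forall>m. (\<Sum>n\<in>A. cmod (x n) powr (5/4)) \<le> X powr (5/4) \<longrightarrow>
       cmod (\<Sum>n\<in>A. x n * of_real (k t (n - m))) \<le> C * (1 + t) powr (-1/4) * X)"
proof -
  obtain C where C: "C \<ge> 1" and decay: "\<forall>t\<ge>0. \<forall>k\<in>{sine_ker, cosine_ker}. (\<forall>n. \<bar>k t n\<bar> \<le> C * (1 + t) powr (-1/3)) \<and>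
     (\<forall>A. finite A \<longrightarrow> (\<Sum>n\<in>A. \<bar>k t n\<bar> ^ 5) \<le> C * (1 + t) powr (-5/4))"
    using ker_decay by (elim exE conjE)
  show ?thesis
  proof (intro exI[of _ C] conjI C allI impI ballI)
    fix t :: real and k :: "real \<Rightarrow> int \<Rightarrow> real" and x :: "int \<Rightarrow> complex" and A X q and y :: "int \<Rightarrow> complex" and B
    assume t: "t \<ge> 0" and k: "k \<in> {sine_ker, cosine_ker}" and fin: "finite A" "finite B" and q: "1 \<le> q" "q \<le> 2"
      and X: "X \<ge> 0" "(\<Sum>n\<in>A. cmod (x n) powr q) \<le> X powr q" and y: "(\<Sum>m\<in>B. cmod (y m) powr q) \<le> 1"
    have "cmod (\<Sum>n\<in>A. \<Sum>m\<in>B. x n * y m * of_real (k t (n - m))) \<le> (C * (1 + t) powr (-1/3)) powr (2 / q - 1) * X"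
      by (rule riesz_thorin_form[OF fin ker_form_l2[OF k fin] _ _ q X(2,1) y])
        (use decay t k C in \<open>auto intro!: mult_pos_pos\<close>)
    also have "\<dots> \<le> C * (1 + t) powr (- ((2 / q - 1) / 3)) * X"
    proof -
      have "C powr (2 / q - 1) \<le> C powr 1" using C q by (intro powr_mono) (auto simp: field_simps)
      then have "C powr (2 / q - 1) \<le> C" using C by simp
      moreover have "(C * (1 + t) powr (-1/3)) powr (2 / q - 1) = C powr (2 / q - 1) * (1 + t) powr (- ((2 / q - 1) / 3))"
        using C t by (simp add: powr_mult powr_powr)
      ultimately show ?thesis using X by (simp add: mult_right_mono)
    qed
    finally show "cmod (\<Sum>n\<in>A. \<Sum>m\<in>B. x n * y m * of_real (k t (n - m))) \<le> C * (1 + t) powr (- ((2 / q - 1) / 3)) * X" .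
  next
    fix t :: real and k :: "real \<Rightarrow> int \<Rightarrow> real" and x :: "int \<Rightarrow> complex" and A X m
    assume t: "t \<ge> 0" and k: "k \<in> {sine_ker, cosine_ker}" and fin: "finite A"
      and X: "X \<ge> 0" "(\<Sum>n\<in>A. cmod (x n) powr (5/4)) \<le> X powr (5/4)"
    have sum5: "(\<Sum>n\<in>A. \<bar>k t (n - m)\<bar> ^ 5) \<le> C * (1 + t) powr (-5/4)"
    proof -
      have "(\<Sum>n\<in>A. \<bar>k t (n - m)\<bar> ^ 5) = (\<Sum>n\<in>(\<lambda>n. n - m) ` A. \<bar>k t n\<bar> ^ 5)"
        by (subst sum.reindex) (auto simp: inj_on_def)
      also have "\<dots> \<le> C * (1 + t) powr (-5/4)" using decay t k fin by blast
      finally show ?thesis .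
    qed
    have "cmod (\<Sum>n\<in>A. x n * of_real (k t (n - m))) \<le> (\<Sum>n\<in>A. (\<bar>k t (n - m)\<bar> ^ 5) powr (1/5) * (cmod (x n) powr (5/4)) powr (1 - 1/5))"
    proof (intro sum_norm_le)
      fix n
      have "(\<bar>k t (n - m)\<bar> ^ 5) powr (1/5) = \<bar>k t (n - m)\<bar>"
      proof (cases "k t (n - m) = 0")
        case False
        then have e: "\<bar>k t (n - m)\<bar> ^ 5 = \<bar>k t (n - m)\<bar> powr 5" by (simp add: powr_numeral)
        show ?thesis unfolding e powr_powr by simp
      qed simp
      then show "cmod (x n * of_real (k t (n - m))) \<le> (\<bar>k t (n - m)\<bar> ^ 5) powr (1/5) * (cmod (x n) powr (5/4)) powr (1 - 1/5)"
        by (simp add: norm_mult powr_powr)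
    qed
    also have "\<dots> \<le> (C * (1 + t) powr (-5/4)) powr (1/5) * (X powr (5/4)) powr (1 - 1/5)"
      by (rule holder_sum[OF _ _ fin _ sum5 _ X(2)]) auto
    also have "\<dots> = C powr (1/5) * (1 + t) powr (-1/4) * X"
      using X C t by (simp add: powr_mult powr_powr)
    also have "\<dots> \<le> C * (1 + t) powr (-1/4) * X"
    proof -
      have "C powr (1/5) \<le> C powr 1" using C by (intro powr_mono) auto
      then show ?thesis using C X by (intro mult_right_mono) auto
    qed
    finally show "cmod (\<Sum>n\<in>A. x n * of_real (k t (n - m))) \<le> C * (1 + t) powr (-1/4) * X" .
  qed
qed

section \<open>Duhamel's formula\<close>

lemma has_vector_derivative_of_real_comp:
  assumes "(f has_real_derivative f') (at (T - s))"
  shows "((\<lambda>s. complex_of_real (f (T - s))) has_vector_derivative - of_real f') (at s within S)"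
proof -
  have "((\<lambda>s. f (T - s)) has_real_derivative f' * (- 1)) (at s)"
    by (rule DERIV_chain2[of f f' "\<lambda>s. T - s" s "-1" UNIV, OF assms]) (auto intro!: derivative_eq_intros)
  then have "((\<lambda>s. f (T - s)) has_vector_derivative - f') (at s within S)"
    using has_vector_derivative_at_within by (auto simp: has_real_derivative_iff_has_vector_derivative)
  then have "((\<lambda>s. complex_of_real (f (T - s))) has_vector_derivative of_real (- f')) (at s within S)"
    by (rule bounded_linear.has_vector_derivative[OF bounded_linear_of_real])
  then show ?thesis by simp
qed

text \<open>Only boundary terms remain, as the discrete Laplacian is symmetric.\<close>

lemma discrete_green:
  fixes k u :: "int \<Rightarrow> complex"
  shows "(\<Sum>n\<in>{- int N..int N}. k n * (u (n + 1) + u (n - 1)) - (k (n + 1) + k (n - 1)) * u n) =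
    (k (int N) * u (int N + 1) - k (int N + 1) * u (int N)) + (k (- int N) * u (- int N - 1) - k (- int N - 1) * u (- int N))"
proof -
  define w where "w n = k n * u (n + 1) - k (n + 1) * u n" for n
  have "(\<Sum>n\<in>{- int N..int N}. w n - w (n - 1)) = w (int N) - w (- int N - 1)"
  proof (induction N)
    case (Suc N)
    have e: "- int (Suc N) = - int N - 1" "int (Suc N) = int N + 1" by auto
    have "{- int (Suc N)..int (Suc N)} = insert (- int N - 1) (insert (int N + 1) {- int N..int N})" by auto
    then show ?case unfolding e by (simp add: Suc)
  qed simp
  moreover have "k n * (u (n + 1) + u (n - 1)) - (k (n + 1) + k (n - 1)) * u n = w n - w (n - 1)" for n
    by (simp add: w_def algebra_simps)
  ultimately show ?thesis by (simp add: w_def algebra_simps)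
qed

text \<open>A first-order system for u and its velocity v; Laplacian and mass term together leave
  the coefficient -3 at n. The forcing \<open>h\<close> is any function of time and site, so the
  nonlinearity along a given solution can be inserted.\<close>

definition forced_solution :: "(real \<Rightarrow> int \<Rightarrow> complex) \<Rightarrow> (real \<Rightarrow> int \<Rightarrow> complex) \<Rightarrow> (real \<Rightarrow> int \<Rightarrow> complex) \<Rightarrow> bool" where
  "forced_solution h u v \<longleftrightarrow> (\<forall>t\<ge>0. \<forall>n.
     ((\<lambda>s. u s n) has_vector_derivative v t n) (at t within {0..}) \<and>
     ((\<lambda>s. v s n) has_vector_derivative (u t (n + 1) + u t (n - 1) - 3 * u t n + h t n)) (at t within {0..}))"

text \<open>Stated as an inequality between bounds for bilinear forms: \<open>a1\<close> and
  \<open>a2\<close> control the data, \<open>b\<close> the forcing, and a primitive of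
  \<open>b\<close> takes the place of the time integral. No infinite sum has to be formed or
  differentiated.\<close>

lemma duhamel_bound:
  fixes y :: "int \<Rightarrow> complex"
  assumes sol: "forced_solution h u v" and T: "T \<ge> 0" and Y: "finite Y"
    and U: "\<And>s n. s \<in> {0..T} \<Longrightarrow> cmod (u s n) \<le> U"
    and a1: "\<And>A. finite A \<Longrightarrow> cmod (\<Sum>n\<in>A. \<Sum>m\<in>Y. v 0 n * y m * of_real (sine_ker T (n - m))) \<le> a1"
    and a2: "\<And>A. finite A \<Longrightarrow> cmod (\<Sum>n\<in>A. \<Sum>m\<in>Y. u 0 n * y m * of_real (cosine_ker T (n - m))) \<le> a2"
    and b: "\<And>A s. finite A \<Longrightarrow> s \<in> {0..T} \<Longrightarrow> cmod (\<Sum>n\<in>A. \<Sum>m\<in>Y. h s n * y m * of_real (sine_ker (T - s) (n - m))) \<le> b s"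
    and phi: "\<And>s. s \<in> {0..T} \<Longrightarrow> (\<phi> has_real_derivative b s) (at s within {0..T})"
  shows "cmod (\<Sum>m\<in>Y. y m * u T m) \<le> a1 + a2 + (\<phi> T - \<phi> 0)"
proof -
  define kS where "kS \<tau> n = (\<Sum>m\<in>Y. y m * complex_of_real (sine_ker \<tau> (n - m)))" for \<tau> n
  define kC where "kC \<tau> n = (\<Sum>m\<in>Y. y m * complex_of_real (cosine_ker \<tau> (n - m)))" for \<tau> n
  have form: "(\<Sum>n\<in>A. \<Sum>m\<in>Y. x n * y m * complex_of_real (sine_ker \<tau> (n - m))) = (\<Sum>n\<in>A. kS \<tau> n * x n)"
    "(\<Sum>n\<in>A. \<Sum>m\<in>Y. x n * y m * complex_of_real (cosine_ker \<tau> (n - m))) = (\<Sum>n\<in>A. kC \<tau> n * x n)" for A x \<tau>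
    unfolding kS_def kC_def sum_distrib_right by (auto intro!: sum.cong)
  have dS: "((\<lambda>s. kS (T - s) n) has_vector_derivative - kC (T - s) n) (at s within {0..T})" for s n
    unfolding kS_def kC_def sum_negf[symmetric] mult_minus_right[symmetric]
    by (intro has_vector_derivative_sum has_vector_derivative_mult_right has_vector_derivative_of_real_comp sine_ker_deriv)
  have dC: "((\<lambda>s. kC (T - s) n) has_vector_derivative - (kS (T - s) (n + 1) + kS (T - s) (n - 1) - 3 * kS (T - s) n)) (at s within {0..T})" for s n
  proof -
    have "((\<lambda>s. kC (T - s) n) has_vector_derivative (\<Sum>m\<in>Y. y m * - complex_of_real (sine_ker (T - s) (n - m + 1) + sine_ker (T - s) (n - m - 1) - 3 * sine_ker (T - s) (n - m)))) (at s within {0..T})"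
      unfolding kC_def
      by (intro has_vector_derivative_sum has_vector_derivative_mult_right has_vector_derivative_of_real_comp cosine_ker_deriv)
    also have "(\<Sum>m\<in>Y. y m * - complex_of_real (sine_ker (T - s) (n - m + 1) + sine_ker (T - s) (n - m - 1) - 3 * sine_ker (T - s) (n - m)))
      = - (kS (T - s) (n + 1) + kS (T - s) (n - 1) - 3 * kS (T - s) n)"
      unfolding kS_def sum_distrib_left sum.distrib[symmetric] sum_subtractf[symmetric] sum_negf[symmetric]
      by (intro sum.cong refl) (simp add: algebra_simps)
    finally show ?thesis .
  qed
  have du: "((\<lambda>s. u s n) has_vector_derivative v s n) (at s within {0..T})"
    and dv: "((\<lambda>s. v s n) has_vector_derivative (u s (n + 1) + u s (n - 1) - 3 * u s n + h s n)) (at s within {0..T})"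
    if "s \<in> {0..T}" for s n
  proof -
    have "((\<lambda>s. u s n) has_vector_derivative v s n) (at s within {0..})"
      "((\<lambda>s. v s n) has_vector_derivative (u s (n + 1) + u s (n - 1) - 3 * u s n + h s n)) (at s within {0..})"
      using sol that unfolding forced_solution_def by auto
    then show "((\<lambda>s. u s n) has_vector_derivative v s n) (at s within {0..T})"
      "((\<lambda>s. v s n) has_vector_derivative (u s (n + 1) + u s (n - 1) - 3 * u s n + h s n)) (at s within {0..T})"
      by (auto elim!: has_vector_derivative_within_subset)
  qed
  obtain L where L: "\<And>m. m \<in> Y \<Longrightarrow> \<bar>m\<bar> \<le> int L"
  proof -
    have "finite ((\<lambda>m. nat \<bar>m\<bar>) ` Y)" using Y by simp
    then obtain L where "\<forall>x\<in>(\<lambda>m. nat \<bar>m\<bar>) ` Y. x \<le> L" using finite_nat_set_iff_bounded_le by blast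
    then show ?thesis by (intro that[of L]) auto
  qed
  have U0: "U \<ge> 0" using order_trans[OF norm_ge_zero U[of 0 0]] T by auto
  define Yn where "Yn = (\<Sum>m\<in>Y. cmod (y m))"
  have Yn0: "Yn \<ge> 0" by (simp add: Yn_def sum_nonneg)
  define e where "e j = 4 * (Yn * ((5 * T) ^ j / fact j) * U)" for j
  have main: "cmod (\<Sum>m\<in>Y. y m * u T m) \<le> a1 + a2 + (\<phi> T - \<phi> 0) + e j * T" for j
  proof -
    \<comment> \<open>Sites at or beyond the ends of the window are then at distance at least
      \<open>j\<close> from all of \<open>Y\<close>, where the kernels are at most (5T)^j /
      j!.\<close>
    define N where "N = L + j"
    have kS_small: "cmod (kS \<tau> n) \<le> Yn * ((5 * T) ^ j / fact j)" if "0 \<le> \<tau>" "\<tau> \<le> T" "\<bar>n\<bar> \<ge> int N" for \<tau> n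
    proof -
      have "cmod (kS \<tau> n) \<le> (\<Sum>m\<in>Y. cmod (y m) * ((5 * T) ^ j / fact j))"
        unfolding kS_def
      proof (intro sum_norm_le)
        fix m assume "m \<in> Y"
        then have "\<bar>n - m\<bar> \<ge> int j" using L[of m] that by (auto simp: N_def)
        then have "\<bar>sine_ker \<tau> (n - m)\<bar> \<le> (5 * \<tau>) ^ j / fact j" using ker_finite_speed[OF that(1)] by blast
        also have "\<dots> \<le> (5 * T) ^ j / fact j" using that by (intro divide_right_mono power_mono) auto
        finally show "cmod (y m * complex_of_real (sine_ker \<tau> (n - m))) \<le> cmod (y m) * ((5 * T) ^ j / fact j)"
          unfolding norm_mult norm_of_real by (rule mult_left_mono) simp
      qed
      then show ?thesis unfolding Yn_def sum_distrib_right .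
    qed
    \<comment> \<open>At s = T the sine kernel is 0 and the cosine kernel the unit mass, so this is
      \<open>u T\<close> tested against \<open>y\<close>; at s = 0 it is the data tested against the
      kernels at time T. In its derivative all but forcing and boundary terms cancel.\<close>
    define \<Phi> where "\<Phi> s = (\<Sum>n\<in>{- int N..int N}. kS (T - s) n * v s n + kC (T - s) n * u s n)" for s
    define bd where "bd s = (kS (T - s) (int N) * u s (int N + 1) - kS (T - s) (int N + 1) * u s (int N)) + (kS (T - s) (- int N) * u s (- int N - 1) - kS (T - s) (- int N - 1) * u s (- int N))" for s
    have d\<Phi>: "(\<Phi> has_vector_derivative ((\<Sum>n\<in>{- int N..int N}. kS (T - s) n * h s n) + bd s)) (at s within {0..T})"
      if s: "s \<in> {0..T}" for s
    proof -
      have "(\<Phi> has_vector_derivative (\<Sum>n\<in>{- int N..int N}.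
        (kS (T - s) n * (u s (n + 1) + u s (n - 1) - 3 * u s n + h s n) + - kC (T - s) n * v s n) +
        (kC (T - s) n * v s n + - (kS (T - s) (n + 1) + kS (T - s) (n - 1) - 3 * kS (T - s) n) * u s n))) (at s within {0..T})"
        unfolding \<Phi>_def
        by (intro has_vector_derivative_sum has_vector_derivative_add has_vector_derivative_mult dS dC du[OF s] dv[OF s])
      also have "(\<Sum>n\<in>{- int N..int N}.
        (kS (T - s) n * (u s (n + 1) + u s (n - 1) - 3 * u s n + h s n) + - kC (T - s) n * v s n) +
        (kC (T - s) n * v s n + - (kS (T - s) (n + 1) + kS (T - s) (n - 1) - 3 * kS (T - s) n) * u s n))
        = (\<Sum>n\<in>{- int N..int N}. kS (T - s) n * h s n + (kS (T - s) n * (u s (n + 1) + u s (n - 1)) - (kS (T - s) (n + 1) + kS (T - s) (n - 1)) * u s n))"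
        by (intro sum.cong refl) (simp add: algebra_simps)
      also have "\<dots> = (\<Sum>n\<in>{- int N..int N}. kS (T - s) n * h s n) + bd s"
        unfolding sum.distrib bd_def by (subst discrete_green) (rule refl)
      finally show ?thesis .
    qed
    have bd: "cmod (bd s) \<le> e j" if s: "s \<in> {0..T}" for s
    proof -
      have pr: "cmod (kS (T - s) n * u s m) \<le> Yn * ((5 * T) ^ j / fact j) * U" if "\<bar>n\<bar> \<ge> int N" for n m
        unfolding norm_mult using s that T Yn0 by (intro mult_mono kS_small U) auto
      have tri4: "cmod ((p - q) + (r - w)) \<le> 4 * M" if "cmod p \<le> M" "cmod q \<le> M" "cmod r \<le> M" "cmod w \<le> M" for p q r w M
        using norm_triangle_ineq[of "p - q" "r - w"] norm_triangle_ineq4[of p q] norm_triangle_ineq4[of r w] that by linarith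
      show ?thesis unfolding bd_def e_def by (intro tri4 pr) auto
    qed
    have "cmod (\<Phi> T - \<Phi> 0) \<le> (\<phi> T + e j * T) - (\<phi> 0 + e j * 0)"
    proof (rule norm_diff_le_majorant[OF T d\<Phi>])
      fix s assume s: "s \<in> {0..T}"
      show "((\<lambda>s. \<phi> s + e j * s) has_real_derivative b s + e j) (at s within {0..T})"
        by (auto intro!: derivative_eq_intros phi[OF s])
      have "cmod (\<Sum>n\<in>{- int N..int N}. kS (T - s) n * h s n) \<le> b s"
        using b[OF _ s, of "{- int N..int N}"] unfolding form by simp
      then show "cmod ((\<Sum>n\<in>{- int N..int N}. kS (T - s) n * h s n) + bd s) \<le> b s + e j"
        using norm_triangle_le add_mono bd[OF s] by blast
    qed
    moreover have "\<Phi> T = (\<Sum>m\<in>Y. y m * u T m)"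
    proof -
      have "\<Phi> T = (\<Sum>n\<in>{- int N..int N}. \<Sum>m\<in>Y. y m * of_bool (n - m = 0) * u T n)"
        unfolding \<Phi>_def kS_def kC_def by (auto simp: sine_ker_0 cosine_ker_0 sum_distrib_right of_bool_def intro!: sum.cong)
      also have "\<dots> = (\<Sum>m\<in>Y. \<Sum>n\<in>{- int N..int N}. if m = n then y m * u T n else 0)"
        by (subst sum.swap) (intro sum.cong refl, auto)
      also have "\<dots> = (\<Sum>m\<in>Y. y m * u T m)"
      proof (intro sum.cong refl)
        fix m assume "m \<in> Y"
        then have "m \<in> {- int N..int N}" using L[of m] by (auto simp: N_def)
        then show "(\<Sum>n\<in>{- int N..int N}. if m = n then y m * u T n else 0) = y m * u T m" by simp
      qed
      finally show ?thesis .
    qed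
    moreover have "cmod (\<Phi> 0) \<le> a1 + a2"
    proof -
      have "\<Phi> 0 = (\<Sum>n\<in>{- int N..int N}. kS T n * v 0 n) + (\<Sum>n\<in>{- int N..int N}. kC T n * u 0 n)"
        by (simp add: \<Phi>_def sum.distrib)
      then show ?thesis
        using a1[of "{- int N..int N}"] a2[of "{- int N..int N}"] norm_triangle_ineq[of "\<Sum>n\<in>{- int N..int N}. kS T n * v 0 n" "\<Sum>n\<in>{- int N..int N}. kC T n * u 0 n"]
        unfolding form by simp
    qed
    ultimately show ?thesis using norm_triangle_ineq2[of "\<Phi> T" "\<Phi> 0"] by simp
  qed
  \<comment> \<open>The window is enlarged: \<open>Yn\<close>, \<open>U\<close> and \<open>T\<close>
    are fixed, and the boundary error \<open>e j\<close> tends to 0.\<close>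
  have "(\<lambda>j. (5 * T) ^ j / fact j) \<longlonglongrightarrow> 0"
    using summable_LIMSEQ_zero[OF summable_exp[of "5 * T"]] by (simp add: divide_inverse mult.commute)
  from tendsto_add[OF tendsto_const[of "a1 + a2 + (\<phi> T - \<phi> 0)"] tendsto_mult[OF tendsto_mult[OF tendsto_const[of 4] tendsto_mult[OF tendsto_mult[OF tendsto_const[of Yn] this] tendsto_const[of U]]] tendsto_const[of T]]]
  have "(\<lambda>j. a1 + a2 + (\<phi> T - \<phi> 0) + e j * T) \<longlonglongrightarrow> a1 + a2 + (\<phi> T - \<phi> 0)" by (simp add: e_def)
  then show ?thesis by (rule tendsto_lowerbound) (use main in auto)
qed

section \<open>Existence for Lipschitz nonlinearities\<close>

text \<open>Mean value inequality for the l^2 norm from componentwise derivatives: the scalar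
  version is applied to the pairing with the fixed vector \<open>c\<close>, the conjugate of the
  total increment, and Cauchy-Schwarz bounds the derivative of the pairing.\<close>

lemma L2_set_majorant:
  fixes d :: "real \<Rightarrow> int \<Rightarrow> complex"
  assumes "finite A" "a \<le> b"
    and d: "\<And>x n. x \<in> {a..b} \<Longrightarrow> n \<in> A \<Longrightarrow> ((\<lambda>x. d x n) has_vector_derivative d' x n) (at x within {a..b})"
    and g: "\<And>x. x \<in> {a..b} \<Longrightarrow> (g has_real_derivative g' x) (at x within {a..b})"
    and le: "\<And>x. x \<in> {a..b} \<Longrightarrow> L2_set (\<lambda>n. cmod (d' x n)) A \<le> g' x"
  shows "L2_set (\<lambda>n. cmod (d b n - d a n)) A \<le> g b - g a"
proof -
  define c where "c n = cnj (d b n - d a n)" for n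
  define N where "N = L2_set (\<lambda>n. cmod (d b n - d a n)) A"
  have N: "N \<ge> 0" "L2_set (\<lambda>n. cmod (c n)) A = N"
    unfolding N_def c_def complex_mod_cnj by (simp_all add: L2_set_nonneg)
  have "cmod ((\<Sum>n\<in>A. c n * d b n) - (\<Sum>n\<in>A. c n * d a n)) \<le> N * g b - N * g a"
  proof (rule norm_diff_le_majorant[OF assms(2)])
    fix x assume x: "x \<in> {a..b}"
    show "((\<lambda>x. \<Sum>n\<in>A. c n * d x n) has_vector_derivative (\<Sum>n\<in>A. c n * d' x n)) (at x within {a..b})"
      by (intro has_vector_derivative_sum has_vector_derivative_mult_right d x)
    show "((\<lambda>x. N * g x) has_real_derivative N * g' x) (at x within {a..b})"
      by (intro DERIV_cmult g x)
    have "cmod (\<Sum>n\<in>A. c n * d' x n) \<le> (\<Sum>n\<in>A. \<bar>cmod (c n)\<bar> * \<bar>cmod (d' x n)\<bar>)"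
      by (intro sum_norm_le) (simp add: norm_mult)
    also have "\<dots> \<le> N * L2_set (\<lambda>n. cmod (d' x n)) A"
      using L2_set_mult_ineq[of "\<lambda>n. cmod (c n)" "\<lambda>n. cmod (d' x n)" A] unfolding N(2) .
    also have "\<dots> \<le> N * g' x" using N le[OF x] by (intro mult_left_mono)
    finally show "cmod (\<Sum>n\<in>A. c n * d' x n) \<le> N * g' x" .
  qed
  also have "(\<Sum>n\<in>A. c n * d b n) - (\<Sum>n\<in>A. c n * d a n) = of_real (\<Sum>n\<in>A. (cmod (d b n - d a n))\<^sup>2)"
    unfolding sum_subtractf[symmetric] right_diff_distrib[symmetric] of_real_sum c_def
    by (intro sum.cong refl) (simp only: complex_norm_square mult.commute)
  also have "(\<Sum>n\<in>A. (cmod (d b n - d a n))\<^sup>2) = N\<^sup>2"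
    by (simp add: N_def L2_set_def sum_nonneg)
  finally have "N * N \<le> N * (g b - g a)" by (simp add: power2_eq_square right_diff_distrib norm_mult)
  moreover have "g a \<le> g b"
  proof -
    have "norm ((\<lambda>_. 0 :: real) b - (\<lambda>_. 0) a) \<le> g b - g a"
    proof (rule norm_diff_le_majorant[OF assms(2) _ g, where f'="\<lambda>_. 0"])
      fix x assume x: "x \<in> {a..b}"
      show "norm (0::real) \<le> g' x" using order_trans[OF L2_set_nonneg le[OF x]] by simp
    qed (auto intro!: derivative_eq_intros)
    then show ?thesis by simp
  qed
  ultimately have "N \<le> g b - g a" using N by (cases "N = 0") (auto simp: mult_le_cancel_left)
  then show ?thesis by (simp add: N_def)
qed

lemma L2_set_shift:
  assumes "\<And>A. finite A \<Longrightarrow> L2_set (\<lambda>n::int. cmod (x n)) A \<le> M" "finite A"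
  shows "L2_set (\<lambda>n. cmod (x (n + j))) A \<le> M"
proof -
  have "L2_set (\<lambda>n. cmod (x (n + j))) A = L2_set (\<lambda>n. cmod (x n)) ((\<lambda>n. n + j) ` A)"
    unfolding L2_set_def by (subst sum.reindex) (auto simp: inj_on_def)
  then show ?thesis using assms by simp
qed

lemma integral_deriv_half_line:
  fixes h :: "real \<Rightarrow> complex"
  assumes "continuous_on {0..} h" "t \<ge> 0"
  shows "((\<lambda>t. integral {0..t} h) has_vector_derivative h t) (at t within {0..})"
proof -
  have "((\<lambda>t. integral {0..t} h) has_vector_derivative h t) (at t within {0..t+1})"
    using assms by (intro integral_has_vector_derivative continuous_on_subset[OF assms(1)]) auto
  moreover have "at t within {0..t+1} = at t within {0..}"
    using assms by (intro at_within_nhd[where S="{..<t+1}"]) auto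
  ultimately show ?thesis by simp
qed

lemma continuous_on_integral_half_line:
  fixes h :: "real \<Rightarrow> complex"
  assumes "continuous_on {0..} h"
  shows "continuous_on {0..} (\<lambda>t. integral {0..t} h)"
  by (rule continuous_on_vector_derivative, rule integral_deriv_half_line[OF assms]) simp

text \<open>The right-hand side is Lipschitz on l^2: the two shifts contribute 1 each, the diagonal
  term 3 and the nonlinearity \<open>M\<close>.\<close>

lemma L2_set_rhs:
  fixes a b :: "int \<Rightarrow> complex"
  assumes F: "\<And>z w. cmod (F z - F w) \<le> M * cmod (z - w)" "M \<ge> 0"
    and D: "\<And>A. finite A \<Longrightarrow> L2_set (\<lambda>n. cmod (a n - b n)) A \<le> D" and A: "finite A"
  shows "L2_set (\<lambda>n. cmod ((a (n + 1) + a (n - 1) - 3 * a n - F (a n)) - (b (n + 1) + b (n - 1) - 3 * b n - F (b n)))) A \<le> (5 + M) * D"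
proof -
  have "L2_set (\<lambda>n. cmod ((a (n + 1) + a (n - 1) - 3 * a n - F (a n)) - (b (n + 1) + b (n - 1) - 3 * b n - F (b n)))) A
    \<le> L2_set (\<lambda>n. cmod (a (n + 1) - b (n + 1)) + (cmod (a (n - 1) - b (n - 1)) + (3 + M) * cmod (a n - b n))) A"
  proof (rule L2_set_mono)
    fix n
    have "(a (n + 1) + a (n - 1) - 3 * a n - F (a n)) - (b (n + 1) + b (n - 1) - 3 * b n - F (b n))
      = ((a (n + 1) - b (n + 1)) + (a (n - 1) - b (n - 1))) - (3 * (a n - b n) + (F (a n) - F (b n)))"
      by (simp add: algebra_simps)
    also have "cmod \<dots> \<le> (cmod (a (n + 1) - b (n + 1)) + cmod (a (n - 1) - b (n - 1))) + (cmod (3 * (a n - b n)) + cmod (F (a n) - F (b n)))"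
      by (rule order_trans[OF norm_triangle_ineq4 add_mono[OF norm_triangle_ineq norm_triangle_ineq]])
    also have "cmod (3 * (a n - b n)) = 3 * cmod (a n - b n)" by (simp only: norm_mult norm_numeral)
    finally show "cmod ((a (n + 1) + a (n - 1) - 3 * a n - F (a n)) - (b (n + 1) + b (n - 1) - 3 * b n - F (b n)))
      \<le> cmod (a (n + 1) - b (n + 1)) + (cmod (a (n - 1) - b (n - 1)) + (3 + M) * cmod (a n - b n))"
      using F(1)[of "a n" "b n"] by (simp add: distrib_right)
  qed auto
  also have "\<dots> \<le> L2_set (\<lambda>n. cmod (a (n + 1) - b (n + 1))) A + (L2_set (\<lambda>n. cmod (a (n - 1) - b (n - 1))) A + L2_set (\<lambda>n. (3 + M) * cmod (a n - b n)) A)"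
    by (intro order_trans[OF L2_set_triangle_ineq] add_left_mono L2_set_triangle_ineq)
  also have "\<dots> \<le> D + (D + (3 + M) * D)"
  proof (intro add_mono)
    show "L2_set (\<lambda>n. cmod (a (n + 1) - b (n + 1))) A \<le> D"
      using L2_set_shift[OF D A, where j=1] by simp
    show "L2_set (\<lambda>n. cmod (a (n - 1) - b (n - 1))) A \<le> D"
      using L2_set_shift[OF D A, where j="-1"] by simp
    show "L2_set (\<lambda>n. (3 + M) * cmod (a n - b n)) A \<le> (3 + M) * D"
      using F(2) D[OF A] by (subst L2_set_right_distrib[symmetric]) (auto intro: mult_left_mono)
  qed
  finally show ?thesis by (simp add: algebra_simps)
qed

lemma uniform_limit_lipschitz:
  assumes "uniform_limit S f l net" "\<And>z w. dist (F z) (F w) \<le> M * dist z w" "M \<ge> (0::real)"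
  shows "uniform_limit S (\<lambda>k x. F (f k x)) (\<lambda>x. F (l x)) net"
proof (rule uniform_limitI)
  fix e :: real assume e: "e > 0"
  have "\<forall>\<^sub>F k in net. \<forall>x\<in>S. dist (f k x) (l x) < e / (M + 1)"
    \<comment> \<open>The denominator M + 1 keeps the choice of tolerance valid for M = 0.\<close>
    using e assms(3) by (intro uniform_limitD[OF assms(1)]) auto
  then show "\<forall>\<^sub>F k in net. \<forall>x\<in>S. dist (F (f k x)) (F (l x)) < e"
  proof (rule eventually_mono, intro ballI)
    fix k x assume k: "\<forall>x\<in>S. dist (f k x) (l x) < e / (M + 1)" and x: "x \<in> S"
    have "dist (F (f k x)) (F (l x)) \<le> M * dist (f k x) (l x)" by (rule assms(2))
    also have "\<dots> \<le> (M + 1) * dist (f k x) (l x)" by (simp add: distrib_right)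
    also have "\<dots> < e" using k x assms(3) by (simp add: pos_less_divide_eq mult.commute)
    finally show "dist (F (f k x)) (F (l x)) < e" .
  qed
qed

text \<open>Picard iteration, with convergence taken componentwise and the l^2 bounds carried by
  finite sums. Increments are at most B (L t)^k / k!, which gives uniform convergence on every
  [0, T] and, summed, the exponential growth bound.\<close>

theorem lipschitz_lattice_existence:
  fixes f g :: "int \<Rightarrow> complex" and F :: "complex \<Rightarrow> complex"
  assumes F: "\<And>z w. cmod (F z - F w) \<le> M * cmod (z - w)" "M \<ge> 0" "F 0 = 0"
    and f: "\<And>A. finite A \<Longrightarrow> L2_set (\<lambda>n. cmod (f n)) A \<le> B" and g: "\<And>A. finite A \<Longrightarrow> L2_set (\<lambda>n. cmod (g n)) A \<le> B"
  shows "\<exists>u v. forced_solution (\<lambda>s n. - F (u s n)) u v \<and> u 0 = f \<and> v 0 = g \<and>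
    (\<forall>t\<ge>0. \<forall>A. finite A \<longrightarrow> L2_set (\<lambda>n. cmod (u t n)) A \<le> B * exp ((5 + M) * t) \<and> L2_set (\<lambda>n. cmod (v t n)) A \<le> B * exp ((5 + M) * t))"
proof -
  define R where "R a n = a (n + 1) + a (n - 1) - 3 * a n - F (a n)" for a :: "int \<Rightarrow> complex" and n
  define L where "L = 5 + M"
  have L: "L \<ge> 1" using F by (simp add: L_def)
  have B0: "B \<ge> 0" using f[of "{}"] by simp
  \<comment> \<open>The iterates of the pair (u, v) start at 0: an iterate is then the sum of its
    increments, and the first increment is the data because F 0 = 0.\<close>
  define P where "P k = rec_nat (\<lambda>(t::real) (n::int). 0::complex, \<lambda>(t::real) (n::int). 0::complex) (\<lambda>k p. (\<lambda>t n. f n + integral {0..t} (\<lambda>s. snd p s n), \<lambda>t n. g n + integral {0..t} (\<lambda>s. R (fst p s) n))) k" for k :: nat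
  define U where "U k = fst (P k)" for k
  define V where "V k = snd (P k)" for k
  have U0: "U 0 = (\<lambda>t n. 0)" "V 0 = (\<lambda>t n. 0)" by (simp_all add: U_def V_def P_def)
  have US: "U (Suc k) = (\<lambda>t n. f n + integral {0..t} (\<lambda>s. V k s n))" "V (Suc k) = (\<lambda>t n. g n + integral {0..t} (\<lambda>s. R (U k s) n))" for k
    by (simp_all add: U_def V_def P_def)
  have Fc: "continuous_on S F" for S
    by (rule continuous_on_subset[of UNIV], rule lipschitz_on_continuous_on[of M], rule lipschitz_onI) (auto simp: dist_norm F)
  have cR: "continuous_on S (\<lambda>s. R (a s) n)" if "\<And>n. continuous_on S (\<lambda>s. a s n)" for S :: "real set" and a n
    unfolding R_def using that by (intro continuous_intros continuous_on_compose2[OF Fc[of UNIV]]) auto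
  have cUV: "continuous_on {0..} (\<lambda>t. U k t n) \<and> continuous_on {0..} (\<lambda>t. V k t n)" for k n
  proof (induction k arbitrary: n)
    case 0 then show ?case by (simp add: U0)
  next
    case (Suc k n)
    have c: "continuous_on {0..} (\<lambda>t. U k t n)" "continuous_on {0..} (\<lambda>t. V k t n)" for n
      using Suc by blast+
    have "continuous_on {0..} (\<lambda>t. integral {0..t} (\<lambda>s. V k s n))"
      by (rule continuous_on_integral_half_line[OF c(2)])
    moreover have "continuous_on {0..} (\<lambda>t. integral {0..t} (\<lambda>s. R (U k s) n))"
      by (rule continuous_on_integral_half_line[OF cR[OF c(1)]])
    ultimately show ?case unfolding US by (auto intro!: continuous_intros)
  qed
  have dU: "((\<lambda>t. U (Suc k) t n) has_vector_derivative V k t n) (at t within {0..})"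
    and dV: "((\<lambda>t. V (Suc k) t n) has_vector_derivative R (U k t) n) (at t within {0..})" if "t \<ge> 0" for k t n
    unfolding US using that cUV cR
    by (auto intro!: derivative_eq_intros integral_deriv_half_line)
  have U_0: "U (Suc k) 0 = f" "V (Suc k) 0 = g" for k by (auto simp: US)
  have R0: "R (\<lambda>n. 0) n = 0" for n by (simp add: R_def F)
  have diff: "L2_set (\<lambda>n. cmod (U (Suc k) t n - U k t n)) A \<le> B * (L * t) ^ k / fact k \<and>
      L2_set (\<lambda>n. cmod (V (Suc k) t n - V k t n)) A \<le> B * (L * t) ^ k / fact k" if "t \<ge> 0" "finite A" for k t A
    using that
  proof (induction k arbitrary: t A)
    case 0
    then show ?case using f g by (simp add: U0 US R0)
  next
    case (Suc k)
    note dg = power_fact_deriv[of B L k _ "{0..t}"]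
    have IH: "L2_set (\<lambda>n. cmod (U (Suc k) s n - U k s n)) A' \<le> B * (L * s) ^ k / fact k"
      "L2_set (\<lambda>n. cmod (V (Suc k) s n - V k s n)) A' \<le> B * (L * s) ^ k / fact k" if "s \<in> {0..t}" "finite A'" for s A'
      using Suc.IH[of s A'] that by auto
    have sub: "{0..t} \<subseteq> {0::real..}" by auto
    have "L2_set (\<lambda>n. cmod ((U (Suc (Suc k)) t n - U (Suc k) t n) - (U (Suc (Suc k)) 0 n - U (Suc k) 0 n))) A
       \<le> B * (L * t) ^ Suc k / fact (Suc k) - B * (L * 0) ^ Suc k / fact (Suc k)"
    proof (rule L2_set_majorant[OF Suc.prems(2,1) _ dg])
      fix s n assume s: "s \<in> {0..t}"
      show "((\<lambda>x. U (Suc (Suc k)) x n - U (Suc k) x n) has_vector_derivative (V (Suc k) s n - V k s n)) (at s within {0..t})"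
        using s by (intro has_vector_derivative_diff has_vector_derivative_within_subset[OF dU sub]) auto
    next
      fix s assume s: "s \<in> {0..t}"
      have "0 \<le> B * (L * s) ^ k / fact k" using B0 L s by (auto intro!: divide_nonneg_pos mult_nonneg_nonneg)
      then have "B * (L * s) ^ k / fact k \<le> L * (B * (L * s) ^ k / fact k)"
        using L mult_right_mono[of 1 L "B * (L * s) ^ k / fact k"] by simp
      then show "L2_set (\<lambda>n. cmod (V (Suc k) s n - V k s n)) A \<le> L * (B * (L * s) ^ k / fact k)"
        using IH(2)[OF s Suc.prems(2)] by linarith
    qed
    moreover have "L2_set (\<lambda>n. cmod ((V (Suc (Suc k)) t n - V (Suc k) t n) - (V (Suc (Suc k)) 0 n - V (Suc k) 0 n))) A
       \<le> B * (L * t) ^ Suc k / fact (Suc k) - B * (L * 0) ^ Suc k / fact (Suc k)"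
    proof (rule L2_set_majorant[OF Suc.prems(2,1) _ dg])
      fix s n assume s: "s \<in> {0..t}"
      show "((\<lambda>x. V (Suc (Suc k)) x n - V (Suc k) x n) has_vector_derivative (R (U (Suc k) s) n - R (U k s) n)) (at s within {0..t})"
        using s by (intro has_vector_derivative_diff has_vector_derivative_within_subset[OF dV sub]) auto
    next
      fix s assume s: "s \<in> {0..t}"
      show "L2_set (\<lambda>n. cmod (R (U (Suc k) s) n - R (U k s) n)) A \<le> L * (B * (L * s) ^ k / fact k)"
        unfolding R_def L_def by (rule L2_set_rhs[OF F(1,2) IH(1)[OF s, unfolded L_def] Suc.prems(2)])
    qed
    ultimately show ?case by (simp add: U_0 del: power_Suc fact_Suc)
  qed
  have sumexp: "(\<Sum>j<k. B * (L * t) ^ j / fact j) \<le> B * exp (L * t)" if "t \<ge> 0" for k t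
  proof -
    have "(\<Sum>j<k. (L * t) ^ j / fact j) \<le> (\<Sum>j. (L * t) ^ j / fact j)"
    proof (rule sum_le_suminf)
      have "(\<lambda>j. inverse (fact j) * (L * t) ^ j) = (\<lambda>j. (L * t) ^ j / fact j)"
        by (rule ext) (simp only: divide_inverse mult_ac)
      then show "summable (\<lambda>j. (L * t) ^ j / fact j)" using summable_exp[of "L * t"] by simp
    qed (use that L in auto)
    also have "\<dots> = exp (L * t)"
      unfolding exp_def by (intro suminf_cong) (simp only: divide_inverse real_scaleR_def mult_ac)
    finally have "B * (\<Sum>j<k. (L * t) ^ j / fact j) \<le> B * exp (L * t)" using B0 by (rule mult_left_mono)
    then show ?thesis by (simp add: sum_distrib_left)
  qed
  define u where "u t n = (\<Sum>k. U (Suc k) t n - U k t n)" for t n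
  define v where "v t n = (\<Sum>k. V (Suc k) t n - V k t n)" for t n
  have tel: "(\<Sum>k<m. U (Suc k) t n - U k t n) = U m t n" "(\<Sum>k<m. V (Suc k) t n - V k t n) = V m t n" for m t n
    using sum_lessThan_telescope[of "\<lambda>k. U k t n" m] sum_lessThan_telescope[of "\<lambda>k. V k t n" m] by (simp_all add: U0)
  have unif: "uniform_limit {0..T} (\<lambda>k t. U k t n) (\<lambda>t. u t n) sequentially"
    "uniform_limit {0..T} (\<lambda>k t. V k t n) (\<lambda>t. v t n) sequentially" if "T \<ge> 0" for T n
  proof -
    have sm: "summable (\<lambda>k. B * (L * T) ^ k / fact k)"
    proof -
      have "(\<lambda>k. B * (inverse (fact k) * (L * T) ^ k)) = (\<lambda>k. B * (L * T) ^ k / fact k)"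
        by (rule ext) (simp only: divide_inverse mult_ac)
      then show ?thesis using summable_mult[OF summable_exp[of "L * T"], of B] by simp
    qed
    have pw: "cmod (U (Suc k) t n - U k t n) \<le> B * (L * T) ^ k / fact k" "cmod (V (Suc k) t n - V k t n) \<le> B * (L * T) ^ k / fact k"
      if t: "t \<in> {0..T}" for k t
    proof -
      have "B * (L * t) ^ k / fact k \<le> B * (L * T) ^ k / fact k"
        using t B0 L by (intro divide_right_mono mult_left_mono power_mono) auto
      then show "cmod (U (Suc k) t n - U k t n) \<le> B * (L * T) ^ k / fact k" "cmod (V (Suc k) t n - V k t n) \<le> B * (L * T) ^ k / fact k"
        using diff[of t "{n}" k] t by (auto simp: L2_set_def)
    qed
    show "uniform_limit {0..T} (\<lambda>k t. U k t n) (\<lambda>t. u t n) sequentially"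
      using Weierstrass_m_test[where A="{0..T}" and f="\<lambda>k t. U (Suc k) t n - U k t n", OF pw(1) sm] unfolding tel u_def .
    show "uniform_limit {0..T} (\<lambda>k t. V k t n) (\<lambda>t. v t n) sequentially"
      using Weierstrass_m_test[where A="{0..T}" and f="\<lambda>k t. V (Suc k) t n - V k t n", OF pw(2) sm] unfolding tel v_def .
  qed
  have cuv: "continuous_on {0..T} (\<lambda>t. u t n)" "continuous_on {0..T} (\<lambda>t. v t n)" for T n
  proof -
    have "continuous_on {0..T} (\<lambda>t. u t n) \<and> continuous_on {0..T} (\<lambda>t. v t n)"
    proof (cases "T \<ge> 0")
      case True
      have sub: "{0..T} \<subseteq> {0::real..}" by auto
      show ?thesis
        using uniform_limit_theorem[OF _ unif(1)[OF True], of n] uniform_limit_theorem[OF _ unif(2)[OF True], of n] cUV continuous_on_subset[OF _ sub]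
        by (auto intro!: always_eventually)
    qed auto
    then show "continuous_on {0..T} (\<lambda>t. u t n)" "continuous_on {0..T} (\<lambda>t. v t n)" by auto
  qed
  have chalf: "continuous_on {0..} a" if "\<And>T. continuous_on {0..T} a" for a :: "real \<Rightarrow> complex"
  proof (rule continuous_on_eq_continuous_within[THEN iffD2], rule ballI)
    fix t :: real assume t: "t \<in> {0..}"
    then have "continuous (at t within {0..t+1}) a" using that[of "t + 1"] by (auto simp: continuous_on_eq_continuous_within)
    moreover have "at t within {0..t+1} = at t within {0..}"
      using t by (intro at_within_nhd[where S="{..<t+1}"]) auto
    ultimately show "continuous (at t within {0..}) a" by simp
  qed
  have limit: "(\<lambda>k. U k t n) \<longlonglongrightarrow> u t n" "(\<lambda>k. V k t n) \<longlonglongrightarrow> v t n" if "t \<ge> 0" for t n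
    using tendsto_uniform_limitI[OF unif(1)[OF that]] tendsto_uniform_limitI[OF unif(2)[OF that]] that by auto
  \<comment> \<open>The limit inherits the integral equations from the iterates; differentiating
    them afterwards yields the system.\<close>
  have intlim: "z = c + integral {0..t} b" if t: "t \<ge> 0" and ul: "uniform_limit {0..t} bk b sequentially"
    and cb: "\<And>k. continuous_on {0..t} (bk k)" and ak: "\<And>k. ak (Suc k) = c + integral {0..t} (bk k)" and al: "ak \<longlonglongrightarrow> z"
    for b :: "real \<Rightarrow> complex" and ak bk c t z
  proof -
    obtain I J where IJ: "\<And>k. (bk k has_integral I k) {0..t}" "(b has_integral J) {0..t}" "I \<longlonglongrightarrow> J"
      using uniform_limit_integral[OF ul cb sequentially_bot] by blast
    have "(\<lambda>k. ak (Suc k)) \<longlonglongrightarrow> c + J"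
      unfolding ak using IJ(3) by (auto simp: integral_unique[OF IJ(1)] intro!: tendsto_intros)
    moreover have "(\<lambda>k. ak (Suc k)) \<longlonglongrightarrow> z" using al by (rule LIMSEQ_Suc)
    ultimately have "z = c + J" using LIMSEQ_unique by blast
    then show ?thesis using integral_unique[OF IJ(2)] by simp
  qed
  have sub: "{0..t} \<subseteq> {0::real..}" for t by auto
  have iu: "u t n = f n + integral {0..t} (\<lambda>s. v s n)" if "t \<ge> 0" for t n
  proof (rule intlim[where bk="\<lambda>k s. V k s n" and ak="\<lambda>k. U k t n", OF that unif(2)[OF that] _ _ limit(1)[OF that]])
    show "continuous_on {0..t} (\<lambda>s. V k s n)" for k using cUV continuous_on_subset[OF _ sub] by blast
  qed (simp add: US)
  have iv: "v t n = g n + integral {0..t} (\<lambda>s. R (u s) n)" if "t \<ge> 0" for t n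
  proof (rule intlim[where bk="\<lambda>k s. R (U k s) n" and ak="\<lambda>k. V k t n", OF that _ _ _ limit(2)[OF that]])
    have uF: "uniform_limit {0..t} (\<lambda>k s. F (U k s n)) (\<lambda>s. F (u s n)) sequentially"
      by (rule uniform_limit_lipschitz[OF unif(1)[OF that]]) (use F in \<open>auto simp: dist_norm\<close>)
    show "uniform_limit {0..t} (\<lambda>k s. R (U k s) n) (\<lambda>s. R (u s) n) sequentially"
      unfolding R_def by (intro uniform_limit_intros unif uF that)
    show "continuous_on {0..t} (\<lambda>s. R (U k s) n)" for k
      using cUV continuous_on_subset[OF _ sub] by (intro cR) blast
  qed (simp add: US)
  have cu: "continuous_on {0..} (\<lambda>t. u t n)" "continuous_on {0..} (\<lambda>t. v t n)" for n
    by (intro chalf cuv)+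
  have "forced_solution (\<lambda>s n. - F (u s n)) u v"
    unfolding forced_solution_def
  proof (intro allI impI conjI)
    fix t :: real and n assume t: "t \<ge> 0"
    have "((\<lambda>t. f n + integral {0..t} (\<lambda>s. v s n)) has_vector_derivative v t n) (at t within {0..})"
      using integral_deriv_half_line[OF cu(2) t] by (auto intro!: derivative_eq_intros)
    then show "((\<lambda>s. u s n) has_vector_derivative v t n) (at t within {0..})"
      by (rule has_vector_derivative_transform[rotated 2]) (use t iu in auto)
    have "((\<lambda>t. g n + integral {0..t} (\<lambda>s. R (u s) n)) has_vector_derivative R (u t) n) (at t within {0..})"
      using integral_deriv_half_line[OF cR[OF cu(1)] t] by (auto intro!: derivative_eq_intros)
    then have "((\<lambda>s. v s n) has_vector_derivative R (u t) n) (at t within {0..})"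
      by (rule has_vector_derivative_transform[rotated 2]) (use t iv in auto)
    then show "((\<lambda>s. v s n) has_vector_derivative u t (n + 1) + u t (n - 1) - 3 * u t n + - F (u t n)) (at t within {0..})"
      by (simp add: R_def)
  qed
  moreover have "u 0 = f" "v 0 = g" using iu[of 0] iv[of 0] by auto
  moreover have "L2_set (\<lambda>n. cmod (u t n)) A \<le> B * exp ((5 + M) * t) \<and> L2_set (\<lambda>n. cmod (v t n)) A \<le> B * exp ((5 + M) * t)"
    if t: "t \<ge> 0" and A: "finite A" for t A
  proof -
    have "L2_set (\<lambda>n. cmod (U k t n)) A \<le> (\<Sum>j<k. B * (L * t) ^ j / fact j) \<and> L2_set (\<lambda>n. cmod (V k t n)) A \<le> (\<Sum>j<k. B * (L * t) ^ j / fact j)" for k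
    proof (induction k)
      case 0 then show ?case by (simp add: U0 L2_set_def)
    next
      case (Suc k)
      have tri: "L2_set (\<lambda>n. cmod (a n)) A \<le> L2_set (\<lambda>n. cmod (b n)) A + L2_set (\<lambda>n. cmod (a n - b n)) A" for a b :: "int \<Rightarrow> complex"
        by (rule order_trans[OF L2_set_mono L2_set_triangle_ineq]) (rule norm_triangle_sub, simp)
      have "L2_set (\<lambda>n. cmod (U (Suc k) t n)) A \<le> (\<Sum>j<k. B * (L * t) ^ j / fact j) + B * (L * t) ^ k / fact k"
        using tri[of "U (Suc k) t" "U k t"] Suc diff[OF t A, of k] by linarith
      moreover have "L2_set (\<lambda>n. cmod (V (Suc k) t n)) A \<le> (\<Sum>j<k. B * (L * t) ^ j / fact j) + B * (L * t) ^ k / fact k"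
        using tri[of "V (Suc k) t" "V k t"] Suc diff[OF t A, of k] by linarith
      ultimately show ?case by simp
    qed
    then have UB: "L2_set (\<lambda>n. cmod (U k t n)) A \<le> B * exp (L * t)" "L2_set (\<lambda>n. cmod (V k t n)) A \<le> B * exp (L * t)" for k
      by (blast intro: order_trans[OF _ sumexp[OF t]])+
    have lim: "(\<lambda>k. L2_set (\<lambda>n. cmod (U k t n)) A) \<longlonglongrightarrow> L2_set (\<lambda>n. cmod (u t n)) A"
      "(\<lambda>k. L2_set (\<lambda>n. cmod (V k t n)) A) \<longlonglongrightarrow> L2_set (\<lambda>n. cmod (v t n)) A"
      unfolding L2_set_def by (intro tendsto_intros limit t)+
    have "L2_set (\<lambda>n. cmod (u t n)) A \<le> B * exp (L * t)"
      by (rule tendsto_upperbound[OF lim(1) _ sequentially_bot]) (simp add: UB)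
    moreover have "L2_set (\<lambda>n. cmod (v t n)) A \<le> B * exp (L * t)"
      by (rule tendsto_upperbound[OF lim(2) _ sequentially_bot]) (simp add: UB)
    ultimately show ?thesis by (simp add: L_def)
  qed
  ultimately show ?thesis by blast
qed

section \<open>The Klein-Gordon nonlinearity and uniqueness\<close>

definition nlin :: "real \<Rightarrow> complex \<Rightarrow> complex" where
  "nlin \<sigma> z = of_real (cmod z powr (2 * \<sigma>)) * z"

lemma powr_diff_le:
  fixes x y r :: real
  assumes "0 \<le> y" "y \<le> x" "r \<ge> 1"
  shows "(x powr r - y powr r) * y \<le> r * x powr r * (x - y)"
proof (cases "y = 0 \<or> x = y")
  case True
  then show ?thesis using assms by auto
next
  case False
  then have "0 < y" "y < x" using assms by auto
  then have "\<exists>z>y. z < x \<and> x powr r - y powr r = (x - y) * (r * z powr (r - 1))"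
    by (intro MVT2) (auto intro!: derivative_eq_intros)
  then obtain z where z: "y < z" "z < x" "x powr r - y powr r = (x - y) * (r * z powr (r - 1))" by auto
  have "z powr (r - 1) * y \<le> x powr (r - 1) * x"
    using z \<open>0 < y\<close> assms by (intro mult_mono powr_mono2) auto
  also have "\<dots> = x powr r" using \<open>0 < y\<close> \<open>y < x\<close> powr_add[of x "r - 1" 1] by simp
  finally have "(x - y) * r * (z powr (r - 1) * y) \<le> (x - y) * r * x powr r"
    using assms by (intro mult_left_mono) auto
  then show ?thesis unfolding z(3) by (simp add: mult_ac)
qed

text \<open>With z of larger modulus, the difference is |z|^(2\<sigma>) (z - w) plus
  (|z|^(2\<sigma>) - |w|^(2\<sigma>)) w. The second term costs the factor 2\<sigma> by the mean
  value theorem, hence the constant 2\<sigma> + 1.\<close>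

lemma nlin_lipschitz:
  assumes s: "\<sigma> \<ge> 1 / 2" and b: "cmod z \<le> b" "cmod w \<le> b"
  shows "cmod (nlin \<sigma> z - nlin \<sigma> w) \<le> (2 * \<sigma> + 1) * b powr (2 * \<sigma>) * cmod (z - w)"
proof -
  have main: "cmod (nlin \<sigma> z - nlin \<sigma> w) \<le> (2 * \<sigma> + 1) * b powr (2 * \<sigma>) * cmod (z - w)"
    if zw: "cmod w \<le> cmod z" "cmod z \<le> b" for z w
  proof -
    have "nlin \<sigma> z - nlin \<sigma> w = of_real (cmod z powr (2 * \<sigma>)) * (z - w) + of_real (cmod z powr (2 * \<sigma>) - cmod w powr (2 * \<sigma>)) * w"
      by (simp add: nlin_def algebra_simps)
    moreover have "cmod (of_real (cmod z powr (2 * \<sigma>) - cmod w powr (2 * \<sigma>)) * w) \<le> (2 * \<sigma>) * cmod z powr (2 * \<sigma>) * cmod (z - w)"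
    proof -
      have ge: "cmod w powr (2 * \<sigma>) \<le> cmod z powr (2 * \<sigma>)" using zw s by (intro powr_mono2) auto
      have "cmod (of_real (cmod z powr (2 * \<sigma>) - cmod w powr (2 * \<sigma>)) * w) = (cmod z powr (2 * \<sigma>) - cmod w powr (2 * \<sigma>)) * cmod w"
        unfolding norm_mult norm_of_real using ge by simp
      also have "\<dots> \<le> (2 * \<sigma>) * cmod z powr (2 * \<sigma>) * (cmod z - cmod w)"
        using zw s by (intro powr_diff_le) auto
      also have "\<dots> \<le> (2 * \<sigma>) * cmod z powr (2 * \<sigma>) * cmod (z - w)"
        using s norm_triangle_ineq2[of z w] by (intro mult_left_mono) auto
      finally show ?thesis .
    qed
    moreover have "cmod (of_real (cmod z powr (2 * \<sigma>)) * (z - w)) = cmod z powr (2 * \<sigma>) * cmod (z - w)"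
      by (simp add: norm_mult)
    ultimately have "cmod (nlin \<sigma> z - nlin \<sigma> w) \<le> cmod z powr (2 * \<sigma>) * cmod (z - w) + (2 * \<sigma>) * cmod z powr (2 * \<sigma>) * cmod (z - w)"
      using norm_triangle_ineq[of "of_real (cmod z powr (2 * \<sigma>)) * (z - w)" "of_real (cmod z powr (2 * \<sigma>) - cmod w powr (2 * \<sigma>)) * w"]
      by simp
    also have "\<dots> = (2 * \<sigma> + 1) * cmod z powr (2 * \<sigma>) * cmod (z - w)" by (simp add: algebra_simps)
    also have "\<dots> \<le> (2 * \<sigma> + 1) * b powr (2 * \<sigma>) * cmod (z - w)"
      using zw s by (intro mult_right_mono mult_left_mono powr_mono2) auto
    finally show ?thesis .
  qed
  show ?thesis
  proof (cases "cmod w \<le> cmod z")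
    case True then show ?thesis by (rule main[OF _ b(1)])
  next
    case False
    then show ?thesis using main[of z w] b by (simp add: norm_minus_commute)
  qed
qed

text \<open>Cutting off outside the unit ball makes the nonlinearity globally Lipschitz; small solutions never
  see the cutoff.\<close>

definition nlin_trunc :: "real \<Rightarrow> complex \<Rightarrow> complex" where
  "nlin_trunc \<sigma> z = nlin \<sigma> (closest_point (cball 0 1) z)"

lemma nlin_trunc:
  assumes "\<sigma> \<ge> 1 / 2"
  shows "cmod (nlin_trunc \<sigma> z - nlin_trunc \<sigma> w) \<le> (2 * \<sigma> + 1) * cmod (z - w)"
    and "nlin_trunc \<sigma> 0 = 0"
    and "cmod z \<le> 1 \<Longrightarrow> nlin_trunc \<sigma> z = nlin \<sigma> z"
    and "cmod (nlin_trunc \<sigma> z) \<le> cmod z powr (2 * \<sigma> + 1)"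
proof -
  define P where "P = closest_point (cball (0::complex) 1)"
  have P1: "cmod (P z) \<le> 1" for z
    using closest_point_in_set[of "cball (0::complex) 1" z] by (auto simp: P_def)
  have PL: "cmod (P z - P w) \<le> cmod (z - w)" for z w
    using closest_point_lipschitz[of "cball (0::complex) 1" z w] by (auto simp: P_def dist_norm)
  have Pid: "P z = z" if "cmod z \<le> 1" for z
    using that by (simp add: P_def closest_point_self)
  have nt: "nlin_trunc \<sigma> z = nlin \<sigma> (P z)" for z by (simp add: nlin_trunc_def P_def)
  have "cmod (nlin \<sigma> (P z) - nlin \<sigma> (P w)) \<le> (2 * \<sigma> + 1) * 1 powr (2 * \<sigma>) * cmod (P z - P w)"
    by (rule nlin_lipschitz[OF assms P1 P1])
  also have "\<dots> \<le> (2 * \<sigma> + 1) * cmod (z - w)" using PL[of z w] assms by (simp add: mult_left_mono)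
  finally show "cmod (nlin_trunc \<sigma> z - nlin_trunc \<sigma> w) \<le> (2 * \<sigma> + 1) * cmod (z - w)" unfolding nt .
  show "nlin_trunc \<sigma> 0 = 0" using Pid[of 0] by (simp add: nt nlin_def)
  show "cmod z \<le> 1 \<Longrightarrow> nlin_trunc \<sigma> z = nlin \<sigma> z" by (simp add: nt Pid)
  have "cmod (P z) \<le> cmod z" using PL[of z 0] Pid[of 0] by simp
  then have "cmod (P z) powr (2 * \<sigma>) * cmod (P z) \<le> cmod z powr (2 * \<sigma>) * cmod z"
    using assms by (intro mult_mono powr_mono2) auto
  also have "\<dots> = cmod z powr (2 * \<sigma> + 1)" by (cases "z = 0") (simp_all add: powr_add)
  finally show "cmod (nlin_trunc \<sigma> z) \<le> cmod z powr (2 * \<sigma> + 1)"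
    by (simp add: nt nlin_def norm_mult)
qed

section \<open>The space l^2, the energy class and uniqueness\<close>

lemma lp_bounded_2_iff:
  "lp_bounded 2 x B \<longleftrightarrow> B \<ge> 0 \<and> (\<forall>A. finite A \<longrightarrow> L2_set (\<lambda>n. cmod (x n)) A \<le> B)"
proof -
  have sq: "r powr 2 = r\<^sup>2" if "r \<ge> 0" for r :: real using that by (cases "r = 0") (simp_all add: powr_numeral)
  have "(\<Sum>n\<in>A. cmod (x n) powr 2) \<le> B powr 2 \<longleftrightarrow> L2_set (\<lambda>n. cmod (x n)) A \<le> B" if "B \<ge> 0" for A
    unfolding L2_set_def sq[OF that] sq[OF norm_ge_zero] using that
    by (metis real_sqrt_le_iff real_sqrt_unique)
  then show ?thesis by (auto simp: lp_bounded_def)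
qed

lemma lp_bounded_2_diff:
  assumes "lp_bounded 2 x A" "lp_bounded 2 y B"
  shows "lp_bounded 2 (\<lambda>n. x n - y n) (A + B)"
proof -
  have "L2_set (\<lambda>n. cmod (x n - y n)) S \<le> A + B" if S: "finite S" for S
  proof -
    have "L2_set (\<lambda>n. cmod (x n - y n)) S \<le> L2_set (\<lambda>n. cmod (x n) + cmod (y n)) S"
      by (intro L2_set_mono norm_triangle_ineq4) auto
    also have "\<dots> \<le> L2_set (\<lambda>n. cmod (x n)) S + L2_set (\<lambda>n. cmod (y n)) S" by (rule L2_set_triangle_ineq)
    also have "\<dots> \<le> A + B" using assms S by (intro add_mono) (auto simp: lp_bounded_2_iff)
    finally show ?thesis .
  qed
  then show ?thesis using assms by (auto simp: lp_bounded_2_iff)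
qed

lemma lp_bounded_minus_commute: "lp_bounded p (\<lambda>n. x n - y n) B = lp_bounded p (\<lambda>n. y n - x n) B"
  by (simp add: lp_bounded_def norm_minus_commute)

lemma within_half_line_eq: "t \<ge> 0 \<Longrightarrow> at t within {0..} = at t within {0..t + 1::real}"
  by (rule at_within_nhd[where S="{..<t+1}"]) auto

lemma vector_derivative_half_line:
  fixes f :: "real \<Rightarrow> complex"
  assumes "t \<ge> 0" "(f has_vector_derivative f') (at t within {0..})"
  shows "vector_derivative f (at t within {0..}) = f'"
  using assms vector_derivative_within_cbox[of 0 "t + 1" t f f'] unfolding within_half_line_eq[OF assms(1)] by simp

lemma l2_continuousI_lipschitz:
  assumes l2: "\<And>t. t \<ge> 0 \<Longrightarrow> x t \<in> lp_space 2"
    and lip: "\<And>T. \<exists>K. \<forall>s t. 0 \<le> s \<longrightarrow> s \<le> t \<longrightarrow> t \<le> T \<longrightarrow> lp_bounded 2 (\<lambda>n. x t n - x s n) (K * (t - s))"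
  shows "l2_continuous x"
  unfolding l2_continuous_def
proof (intro conjI allI impI l2)
  fix t :: real assume t: "t \<ge> 0"
  obtain K where K: "\<forall>r s. 0 \<le> r \<longrightarrow> r \<le> s \<longrightarrow> s \<le> t + 1 \<longrightarrow> lp_bounded 2 (\<lambda>n. x s n - x r n) (K * (s - r))"
    using lip by blast
  have sym: "lp_bounded 2 (\<lambda>n. x s n - x t n) (K * \<bar>s - t\<bar>)" if "s \<in> {0..t+1}" for s
  proof (cases "s \<le> t")
    case True
    then have "lp_bounded 2 (\<lambda>n. x t n - x s n) (K * (t - s))" using K that t by auto
    then have "lp_bounded 2 (\<lambda>n. x s n - x t n) (K * (t - s))" by (subst lp_bounded_minus_commute)
    moreover have "\<bar>s - t\<bar> = t - s" using True by simp
    ultimately show ?thesis by (simp only:)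
  next
    case False
    then show ?thesis using K that t by auto
  qed
  show "((\<lambda>s. lp_norm 2 (\<lambda>n. x s n - x t n)) \<longlongrightarrow> 0) (at t within {0..})"
    unfolding within_half_line_eq[OF t]
  proof (rule tendsto_sandwich[OF _ _ tendsto_const])
    show "\<forall>\<^sub>F s in at t within {0..t + 1}. 0 \<le> lp_norm 2 (\<lambda>n. x s n - x t n)"
      by (simp add: lp_norm_def)
    show "\<forall>\<^sub>F s in at t within {0..t + 1}. lp_norm 2 (\<lambda>n. x s n - x t n) \<le> K * \<bar>s - t\<bar>"
      using lp_boundedI_norm(2)[OF sym] by (auto simp: eventually_at intro!: exI[of _ 1])
    have "((\<lambda>s. K * \<bar>s - t\<bar>) \<longlongrightarrow> K * \<bar>t - t\<bar>) (at t within {0..t + 1})" by (intro tendsto_intros)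
    then show "((\<lambda>s. K * \<bar>s - t\<bar>) \<longlongrightarrow> 0) (at t within {0..t + 1})" by simp
  qed
qed

text \<open>Continuity into l^2 bounds the sup norm near each time; compactness of [0, T] leaves
  finitely many such bounds, and their sum serves as the maximum.\<close>

lemma l2_continuous_bounded:
  assumes "l2_continuous x"
  shows "\<exists>B. \<forall>t\<in>{0..T}. \<forall>n. cmod (x t n) \<le> B"
proof -
  have l2: "lp_bounded 2 (x t) (lp_norm 2 (x t))" if "t \<ge> 0" for t
    using assms that by (intro lp_bounded_lp_norm) (auto simp: l2_continuous_def)
  have loc: "\<exists>d>0. \<forall>s\<in>{0..}. dist s t < d \<longrightarrow> (\<forall>n. cmod (x s n) \<le> lp_norm 2 (x t) + 1)" if t: "t \<ge> 0" for t
  proof -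
    have "((\<lambda>s. lp_norm 2 (\<lambda>n. x s n - x t n)) \<longlongrightarrow> 0) (at t within {0..})"
      using assms t by (auto simp: l2_continuous_def)
    then have "\<forall>\<^sub>F s in at t within {0..}. lp_norm 2 (\<lambda>n. x s n - x t n) < 1"
      by (rule order_tendstoD) simp
    then obtain d where d: "d > 0" "\<And>s. s \<in> {0..} \<Longrightarrow> s \<noteq> t \<Longrightarrow> dist s t < d \<Longrightarrow> lp_norm 2 (\<lambda>n. x s n - x t n) < 1"
      unfolding eventually_at by auto
    have "cmod (x s n) \<le> lp_norm 2 (x t) + 1" if s: "s \<in> {0..}" "dist s t < d" for s n
    proof -
      have xt: "cmod (x t n) \<le> lp_norm 2 (x t)" using lp_bounded_pointwise[OF l2[OF t]] by simp
      show ?thesis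
      proof (cases "s = t")
        case True then show ?thesis using xt by simp
      next
        case False
        have "lp_bounded 2 (\<lambda>n. x s n - x t n) (lp_norm 2 (\<lambda>n. x s n - x t n))"
          using lp_boundedI_norm(1)[OF lp_bounded_2_diff[OF l2 l2[OF t]]] s by (intro lp_bounded_lp_norm) auto
        from lp_bounded_pointwise[OF this, of n] have "cmod (x s n - x t n) \<le> 1"
          using d(2)[OF s(1) False s(2)] by simp
        then show ?thesis using xt norm_triangle_sub[of "x s n" "x t n"] by linarith
      qed
    qed
    then show ?thesis using d(1) by blast
  qed
  then obtain d where d: "\<And>t. t \<ge> 0 \<Longrightarrow> d t > 0"
    "\<And>t s n. t \<ge> 0 \<Longrightarrow> s \<in> {0..} \<Longrightarrow> dist s t < d t \<Longrightarrow> cmod (x s n) \<le> lp_norm 2 (x t) + 1"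
    by metis
  have cover: "{0..T} \<subseteq> (\<Union>t\<in>{0..T}. ball t (d t))" using d(1) by fastforce
  obtain C where C: "C \<subseteq> {0..T}" "finite C" "{0..T} \<subseteq> (\<Union>t\<in>C. ball t (d t))"
    by (rule compactE_image[OF compact_Icc _ cover]) auto
  have "cmod (x s n) \<le> (\<Sum>t\<in>C. lp_norm 2 (x t) + 1)" if s: "s \<in> {0..T}" for s n
  proof -
    obtain t where t: "t \<in> C" "s \<in> ball t (d t)" using C(3) s by blast
    have "cmod (x s n) \<le> lp_norm 2 (x t) + 1"
      using t C(1) s by (intro d(2)) (auto simp: dist_commute)
    also have "\<dots> \<le> (\<Sum>t\<in>C. lp_norm 2 (x t) + 1)"
      using t C(2) by (intro member_le_sum) (auto simp: lp_norm_def)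
    finally show ?thesis .
  qed
  then show ?thesis by blast
qed

lemma dnkg_forced:
  assumes "dnkg_solution a \<sigma> w"
  shows "forced_solution (\<lambda>s n. - (of_real a * nlin \<sigma> (w s n))) w (time_deriv w)"
  unfolding forced_solution_def
proof (intro allI impI conjI)
  fix t :: real and n assume t: "t \<ge> 0"
  have d: "(\<lambda>s. w s n) differentiable (at t within {0..})" "(\<lambda>s. time_deriv w s n) differentiable (at t within {0..})"
    and eq: "time_deriv (time_deriv w) t n - disc_laplacian (w t) n + w t n
          + of_real (a * norm (w t n) powr (2 * \<sigma>)) * w t n = 0"
    using assms t unfolding dnkg_solution_def by auto
  show "((\<lambda>s. w s n) has_vector_derivative time_deriv w t n) (at t within {0..})"
    unfolding time_deriv_def using d(1) by (simp add: vector_derivative_works)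
  have "((\<lambda>s. time_deriv w s n) has_vector_derivative time_deriv (time_deriv w) t n) (at t within {0..})"
    using d(2) unfolding vector_derivative_works by (simp add: time_deriv_def[of "time_deriv w"])
  moreover have "time_deriv (time_deriv w) t n = w t (n + 1) + w t (n - 1) - 3 * w t n + - (of_real a * nlin \<sigma> (w t n))"
    using eq by (simp add: disc_laplacian_def nlin_def algebra_simps add_eq_0_iff)
  ultimately show "((\<lambda>s. time_deriv w s n) has_vector_derivative w t (n + 1) + w t (n - 1) - 3 * w t n + - (of_real a * nlin \<sigma> (w t n))) (at t within {0..})"
    by simp
qed

text \<open>The difference of two solutions is estimated in the sup norm by B (L s)^k / k! for every
  k. The energy class enters through sup bounds on {0..t}: they start the induction at k = 0 and fix
  the Lipschitz constant of the nonlinearity.\<close>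

lemma dnkg_unique:
  assumes u: "dnkg_solution a \<sigma> u" and w: "dnkg_solution a \<sigma> w"
    and init: "w 0 = u 0" "time_deriv w 0 = time_deriv u 0" and s: "\<sigma> \<ge> 1 / 2" and t: "t \<ge> 0"
  shows "w t = u t"
proof -
  have l2: "l2_continuous u" "l2_continuous w" "l2_continuous (time_deriv u)" "l2_continuous (time_deriv w)"
    using u w by (auto simp: dnkg_solution_def)
  obtain B1 where B1: "\<forall>s\<in>{0..t}. \<forall>n. cmod (u s n) \<le> B1" using l2_continuous_bounded[OF l2(1)] by blast
  obtain B2 where B2: "\<forall>s\<in>{0..t}. \<forall>n. cmod (w s n) \<le> B2" using l2_continuous_bounded[OF l2(2)] by blast
  obtain B3 where B3: "\<forall>s\<in>{0..t}. \<forall>n. cmod (time_deriv u s n) \<le> B3" using l2_continuous_bounded[OF l2(3)] by blast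
  obtain B4 where B4: "\<forall>s\<in>{0..t}. \<forall>n. cmod (time_deriv w s n) \<le> B4" using l2_continuous_bounded[OF l2(4)] by blast
  define b where "b = max B1 B2"
  define B where "B = \<bar>B1\<bar> + \<bar>B2\<bar> + \<bar>B3\<bar> + \<bar>B4\<bar>"
  define L where "L = 5 + \<bar>a\<bar> * ((2 * \<sigma> + 1) * b powr (2 * \<sigma>))"
  have M0: "0 \<le> \<bar>a\<bar> * ((2 * \<sigma> + 1) * b powr (2 * \<sigma>))" using s by (intro mult_nonneg_nonneg) auto
  define d where "d s n = w s n - u s n" for s n
  define e where "e s n = time_deriv w s n - time_deriv u s n" for s n
  have dd: "((\<lambda>s. d s n) has_vector_derivative e s n) (at s within {0..t})"
    and de: "((\<lambda>s. e s n) has_vector_derivative (d s (n + 1) + d s (n - 1) - 3 * d s n - of_real a * (nlin \<sigma> (w s n) - nlin \<sigma> (u s n)))) (at s within {0..t})"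
    if "s \<in> {0..t}" for s n
  proof -
    have sub: "{0..t} \<subseteq> {0..}" by auto
    have W: "((\<lambda>s. w s n) has_vector_derivative time_deriv w s n) (at s within {0..t})"
      "((\<lambda>s. time_deriv w s n) has_vector_derivative w s (n + 1) + w s (n - 1) - 3 * w s n + - (of_real a * nlin \<sigma> (w s n))) (at s within {0..t})"
      "((\<lambda>s. u s n) has_vector_derivative time_deriv u s n) (at s within {0..t})"
      "((\<lambda>s. time_deriv u s n) has_vector_derivative u s (n + 1) + u s (n - 1) - 3 * u s n + - (of_real a * nlin \<sigma> (u s n))) (at s within {0..t})"
      using dnkg_forced[OF w] dnkg_forced[OF u] that unfolding forced_solution_def
      by (auto intro!: has_vector_derivative_within_subset[OF _ sub])
    show "((\<lambda>s. d s n) has_vector_derivative e s n) (at s within {0..t})"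
      unfolding d_def e_def by (intro has_vector_derivative_diff W)
    show "((\<lambda>s. e s n) has_vector_derivative (d s (n + 1) + d s (n - 1) - 3 * d s n - of_real a * (nlin \<sigma> (w s n) - nlin \<sigma> (u s n)))) (at s within {0..t})"
      using has_vector_derivative_diff[OF W(2,4)] unfolding d_def e_def by (simp add: algebra_simps)
  qed
  have d0: "d 0 n = 0" "e 0 n = 0" for n by (simp_all add: d_def e_def init)
  have ind: "cmod (d s n) \<le> B * (L * s) ^ k / fact k \<and> cmod (e s n) \<le> B * (L * s) ^ k / fact k" if "s \<in> {0..t}" for k s n
    using that
  proof (induction k arbitrary: s n)
    case 0
    have "cmod (d s n) \<le> cmod (w s n) + cmod (u s n)" "cmod (e s n) \<le> cmod (time_deriv w s n) + cmod (time_deriv u s n)"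
      unfolding d_def e_def by (rule norm_triangle_ineq4)+
    moreover have "cmod (u s n) \<le> B1" "cmod (w s n) \<le> B2" "cmod (time_deriv u s n) \<le> B3" "cmod (time_deriv w s n) \<le> B4"
      using B1 B2 B3 B4 0 by blast+
    ultimately show ?case unfolding B_def by (simp, intro conjI; linarith)
  next
    case (Suc k)
    have s0: "0 \<le> s" using Suc.prems by simp
    have IH: "cmod (d r m) \<le> B * (L * r) ^ k / fact k" "cmod (e r m) \<le> B * (L * r) ^ k / fact k" if "r \<in> {0..s}" for r m
      using Suc.IH[of r m] Suc.prems that by auto
    have sub: "{0..s} \<subseteq> {0..t}" using Suc.prems by auto
    have "cmod (d s n - d 0 n) \<le> B * (L * s) ^ Suc k / fact (Suc k) - B * (L * 0) ^ Suc k / fact (Suc k)"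
    proof (rule norm_diff_le_majorant[where f="\<lambda>s. d s n", OF s0 _ power_fact_deriv])
      fix r assume r: "r \<in> {0..s}"
      show "((\<lambda>s. d s n) has_vector_derivative e r n) (at r within {0..s})"
        using r Suc.prems by (intro has_vector_derivative_within_subset[OF dd sub]) auto
      have "0 \<le> B * (L * r) ^ k / fact k" using IH(2)[OF r, of n] norm_ge_zero order_trans by blast
      then have "B * (L * r) ^ k / fact k \<le> L * (B * (L * r) ^ k / fact k)"
        using M0 mult_right_mono[of 1 L "B * (L * r) ^ k / fact k"] by (simp add: L_def)
      then show "cmod (e r n) \<le> L * (B * (L * r) ^ k / fact k)" using IH(2)[OF r, of n] by linarith
    qed
    moreover have "cmod (e s n - e 0 n) \<le> B * (L * s) ^ Suc k / fact (Suc k) - B * (L * 0) ^ Suc k / fact (Suc k)"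
    proof (rule norm_diff_le_majorant[where f="\<lambda>s. e s n", OF s0 _ power_fact_deriv])
      fix r assume r: "r \<in> {0..s}"
      show "((\<lambda>s. e s n) has_vector_derivative (d r (n + 1) + d r (n - 1) - 3 * d r n - of_real a * (nlin \<sigma> (w r n) - nlin \<sigma> (u r n)))) (at r within {0..s})"
        using r Suc.prems by (intro has_vector_derivative_within_subset[OF de sub]) auto
      let ?X = "B * (L * r) ^ k / fact k"
      have "r \<in> {0..t}" using r Suc.prems by auto
      then have "cmod (u r n) \<le> B1" "cmod (w r n) \<le> B2" using B1 B2 by blast+
      then have "cmod (u r n) \<le> b" "cmod (w r n) \<le> b" by (simp_all add: b_def)
      then have "cmod (nlin \<sigma> (w r n) - nlin \<sigma> (u r n)) \<le> (2 * \<sigma> + 1) * b powr (2 * \<sigma>) * cmod (d r n)"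
        unfolding d_def by (intro nlin_lipschitz s)
      also have "\<dots> \<le> (2 * \<sigma> + 1) * b powr (2 * \<sigma>) * ?X"
        using s IH(1)[OF r, of n] by (intro mult_left_mono) auto
      finally have "\<bar>a\<bar> * cmod (nlin \<sigma> (w r n) - nlin \<sigma> (u r n)) \<le> \<bar>a\<bar> * ((2 * \<sigma> + 1) * b powr (2 * \<sigma>) * ?X)"
        by (rule mult_left_mono) simp
      then have n1: "cmod (of_real a * (nlin \<sigma> (w r n) - nlin \<sigma> (u r n))) \<le> (\<bar>a\<bar> * ((2 * \<sigma> + 1) * b powr (2 * \<sigma>))) * ?X"
        by (simp only: norm_mult norm_of_real mult.assoc)
      have tri: "cmod (p + q - 3 * x - y) \<le> cmod p + cmod q + 3 * cmod x + cmod y" for p q x y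
      proof -
        have "cmod (p + q - 3 * x - y) \<le> cmod (p + q) + cmod (3 * x) + cmod y"
          by (rule order_trans[OF norm_triangle_ineq4 add_right_mono[OF norm_triangle_ineq4]])
        moreover have "cmod (3 * x) = 3 * cmod x" by (simp only: norm_mult norm_numeral)
        ultimately show ?thesis using norm_triangle_ineq[of p q] by linarith
      qed
      have "cmod (d r (n + 1) + d r (n - 1) - 3 * d r n - of_real a * (nlin \<sigma> (w r n) - nlin \<sigma> (u r n)))
        \<le> ?X + ?X + 3 * ?X + (\<bar>a\<bar> * ((2 * \<sigma> + 1) * b powr (2 * \<sigma>))) * ?X"
        using tri[of "d r (n + 1)" "d r (n - 1)" "d r n" "of_real a * (nlin \<sigma> (w r n) - nlin \<sigma> (u r n))"]
          IH(1)[OF r, of "n+1"] IH(1)[OF r, of "n-1"] IH(1)[OF r, of n] n1 by linarith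
      also have "\<dots> = L * ?X" unfolding L_def distrib_right by simp
      finally show "cmod (d r (n + 1) + d r (n - 1) - 3 * d r n - of_real a * (nlin \<sigma> (w r n) - nlin \<sigma> (u r n))) \<le> L * ?X" .
    qed
    ultimately show ?case by (simp add: d0 del: power_Suc fact_Suc)
  qed
  have lim: "(\<lambda>k. B * (L * t) ^ k / fact k) \<longlonglongrightarrow> 0"
  proof -
    have "(\<lambda>k. inverse (fact k) * (L * t) ^ k) \<longlonglongrightarrow> 0"
      by (rule summable_LIMSEQ_zero[OF summable_exp])
    from tendsto_mult[OF tendsto_const[of B] this] have "(\<lambda>k. B * (inverse (fact k) * (L * t) ^ k)) \<longlonglongrightarrow> 0" by simp
    moreover have "(\<lambda>k. B * (inverse (fact k) * (L * t) ^ k)) = (\<lambda>k. B * (L * t) ^ k / fact k)"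
      by (rule ext) (simp only: divide_inverse mult_ac)
    ultimately show ?thesis by simp
  qed
  have "d t n = 0" for n
  proof -
    have "cmod (d t n) \<le> 0"
      by (rule tendsto_lowerbound[OF lim]) (use ind[of t n] t in auto)
    then show ?thesis by simp
  qed
  then show ?thesis by (auto simp: d_def)
qed

text \<open>Bounds in l^2 on u, v and the right-hand side, locally uniform in time, make u and its
  velocity locally Lipschitz into l^2 and so place the solution in the energy class.\<close>

lemma forced_dnkg:
  assumes sol: "forced_solution (\<lambda>s n. - (of_real a * nlin \<sigma> (u s n))) u v"
    and bd: "\<And>T. \<exists>B. \<forall>t\<in>{0..T}. lp_bounded 2 (u t) B \<and> lp_bounded 2 (v t) B \<and> lp_bounded 2 (\<lambda>n. u t (n + 1) + u t (n - 1) - 3 * u t n - of_real a * nlin \<sigma> (u t n)) B"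
  shows "dnkg_solution a \<sigma> u" "t \<ge> 0 \<Longrightarrow> time_deriv u t = v t"
proof -
  define R where "R t n = u t (n + 1) + u t (n - 1) - 3 * u t n - of_real a * nlin \<sigma> (u t n)" for t n
  have du: "((\<lambda>s. u s n) has_vector_derivative v t n) (at t within {0..})"
    and dv: "((\<lambda>s. v s n) has_vector_derivative R t n) (at t within {0..})" if "t \<ge> 0" for t n
    using sol that unfolding forced_solution_def R_def by auto
  have td: "time_deriv u t n = v t n" if "t \<ge> 0" for t n
    unfolding time_deriv_def by (rule vector_derivative_half_line[OF that du[OF that]])
  then show "t \<ge> 0 \<Longrightarrow> time_deriv u t = v t" by auto
  have dtd: "((\<lambda>s. time_deriv u s n) has_vector_derivative R t n) (at t within {0..})" if "t \<ge> 0" for t n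
    by (rule has_vector_derivative_transform[OF _ _ dv[OF that]]) (use that td in auto)
  have td2: "time_deriv (time_deriv u) t n = R t n" if "t \<ge> 0" for t n
    unfolding time_deriv_def[of "time_deriv u"] by (rule vector_derivative_half_line[OF that dtd[OF that]])
  have lip: "l2_continuous x" if dx: "\<And>t n. t \<ge> 0 \<Longrightarrow> ((\<lambda>s. x s n) has_vector_derivative x' t n) (at t within {0..})"
    and bx: "\<And>T. \<exists>B. \<forall>t\<in>{0..T}. lp_bounded 2 (x t) B \<and> lp_bounded 2 (x' t) B" for x x'
  proof (rule l2_continuousI_lipschitz)
    fix t :: real assume t: "t \<ge> 0"
    obtain B where "\<forall>s\<in>{0..t}. lp_bounded 2 (x s) B \<and> lp_bounded 2 (x' s) B" using bx by blast
    then have "lp_bounded 2 (x t) B" using t by auto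
    then show "x t \<in> lp_space 2" by (rule lp_boundedI_norm) simp
  next
    fix T :: real
    obtain B where B: "\<forall>t\<in>{0..T}. lp_bounded 2 (x t) B \<and> lp_bounded 2 (x' t) B" using bx by blast
    show "\<exists>K. \<forall>s t. 0 \<le> s \<longrightarrow> s \<le> t \<longrightarrow> t \<le> T \<longrightarrow> lp_bounded 2 (\<lambda>n. x t n - x s n) (K * (t - s))"
    proof (intro exI[of _ B] allI impI)
      fix s t assume st: "0 \<le> s" "s \<le> t" "t \<le> T"
      then have "s \<in> {0..T}" by simp
      then have "lp_bounded 2 (x s) B" using B by blast
      then have B0: "B \<ge> 0" by (rule lp_bounded_nonneg)
      have "L2_set (\<lambda>n. cmod (x t n - x s n)) A \<le> B * t - B * s" if A: "finite A" for A
      proof (rule L2_set_majorant[OF A st(2)])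
        fix r n assume r: "r \<in> {s..t}"
        show "((\<lambda>y. x y n) has_vector_derivative x' r n) (at r within {s..t})"
          using r st by (intro has_vector_derivative_within_subset[OF dx]) auto
      next
        fix r assume r: "r \<in> {s..t}"
        show "((\<lambda>y. B * y) has_real_derivative B) (at r within {s..t})" by (auto intro!: derivative_eq_intros)
        have "r \<in> {0..T}" using r st by simp
        then have "lp_bounded 2 (x' r) B" using B by blast
        then show "L2_set (\<lambda>n. cmod (x' r n)) A \<le> B" using A by (simp add: lp_bounded_2_iff)
      qed
      then show "lp_bounded 2 (\<lambda>n. x t n - x s n) (B * (t - s))"
        using B0 st by (auto simp: lp_bounded_2_iff right_diff_distrib mult_left_mono)
    qed
  qed
  show "dnkg_solution a \<sigma> u"
    unfolding dnkg_solution_def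
  proof (intro conjI allI impI)
    show "l2_continuous u" by (rule lip[OF du]) (use bd in blast)+
    show "l2_continuous (time_deriv u)"
    proof (rule lip[OF dtd])
      fix T
      obtain B where "\<forall>t\<in>{0..T}. lp_bounded 2 (v t) B \<and> lp_bounded 2 (R t) B" using bd[of T] unfolding R_def by blast
      moreover have "time_deriv u t = v t" if "t \<in> {0..T}" for t using td that by auto
      ultimately show "\<exists>B. \<forall>t\<in>{0..T}. lp_bounded 2 (time_deriv u t) B \<and> lp_bounded 2 (R t) B" by auto
    qed auto
    fix t :: real and n assume t: "t \<ge> 0"
    show "(\<lambda>s. u s n) differentiable (at t within {0..})" using du[OF t] by (rule differentiableI_vector)
    show "(\<lambda>s. time_deriv u s n) differentiable (at t within {0..})" using dtd[OF t] by (rule differentiableI_vector)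
    show "time_deriv (time_deriv u) t n - disc_laplacian (u t) n + u t n + of_real (a * norm (u t n) powr (2 * \<sigma>)) * u t n = 0"
      unfolding td2[OF t] R_def disc_laplacian_def nlin_def by (simp add: algebra_simps)
  qed
qed

section \<open>Decay of small solutions\<close>

text \<open>One of s and T - s is at least T/2, and the factor carrying that time yields (1 +
  T)^(-\<alpha>), with 2^\<alpha> \<le> 2. What is left is a sum of two weights with explicit
  primitives.\<close>

lemma time_weight_le:
  fixes \<alpha> \<delta> s T :: real
  assumes "0 \<le> \<alpha>" "\<alpha> \<le> 1" "\<delta> > 0" "0 \<le> s" "s \<le> T"
  shows "(1 + (T - s)) powr (-\<alpha>) * (1 + s) powr (-1 - \<delta>)
    \<le> 2 * (1 + T) powr (-\<alpha>) * ((1 + s) powr (-1 - \<delta>) + (1 + (T - s)) powr (-1 - \<delta>))"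
proof -
  have half: "(1 + r) powr (-\<alpha>) \<le> 2 * (1 + T) powr (-\<alpha>)" if "T \<le> 2 * r" "0 \<le> r" for r
  proof -
    have "(1 + r) powr (-\<alpha>) \<le> ((1 + T) / 2) powr (-\<alpha>)" using that assms by (intro powr_mono2') auto
    also have "\<dots> = 2 powr \<alpha> * (1 + T) powr (-\<alpha>)"
      using assms by (simp add: powr_divide powr_minus_divide)
    also have "\<dots> \<le> 2 powr 1 * (1 + T) powr (-\<alpha>)" using assms by (intro mult_right_mono powr_mono) auto
    finally show ?thesis by simp
  qed
  let ?a = "(1 + s) powr (-1 - \<delta>)" and ?b = "(1 + (T - s)) powr (-1 - \<delta>)"
  have "(1 + (T - s)) powr (-\<alpha>) * ?a \<le> 2 * (1 + T) powr (-\<alpha>) * ?a \<or> (1 + (T - s)) powr (-\<alpha>) * ?a \<le> 2 * (1 + T) powr (-\<alpha>) * ?b"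
  proof (cases "s \<le> T - s")
    case True
    then show ?thesis using half[of "T - s"] assms by (intro disjI1 mult_right_mono) auto
  next
    case False
    \<comment> \<open>Here s is the larger time, so (1+s)^(-\<alpha>) is split off and gives the
      decay in T; the rest, with exponent \<alpha> - 1 - \<delta> < 0, is moved to the smaller time
      T - s, where it recombines with the first factor.\<close>
    have "(1 + (T - s)) powr (-\<alpha>) * ?a = (1 + (T - s)) powr (-\<alpha>) * ((1 + s) powr (-\<alpha>) * (1 + s) powr (\<alpha> - 1 - \<delta>))"
      by (simp flip: powr_add)
    also have "\<dots> \<le> (1 + (T - s)) powr (-\<alpha>) * ((2 * (1 + T) powr (-\<alpha>)) * (1 + (T - s)) powr (\<alpha> - 1 - \<delta>))"
      using False assms half[of s] by (intro mult_left_mono mult_mono powr_mono2') auto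
    also have "\<dots> = 2 * (1 + T) powr (-\<alpha>) * ((1 + (T - s)) powr (-\<alpha>) * (1 + (T - s)) powr (\<alpha> - 1 - \<delta>))"
      by simp
    also have "(1 + (T - s)) powr (-\<alpha>) * (1 + (T - s)) powr (\<alpha> - 1 - \<delta>) = ?b" by (simp flip: powr_add)
    finally show ?thesis by blast
  qed
  moreover have "0 \<le> 2 * (1 + T) powr (-\<alpha>) * ?a" "0 \<le> 2 * (1 + T) powr (-\<alpha>) * ?b" by simp_all
  ultimately show ?thesis unfolding distrib_left by linarith
qed

text \<open>Because \<delta> > 0, the two weights together have total mass at most 2/\<delta>,
  uniformly in T; this is where \<sigma>/2 > 1 is consumed.\<close>

lemma time_weight_primitive:
  fixes \<alpha> \<delta> T :: real
  assumes "\<delta> > 0" "T \<ge> 0"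
  defines "W \<equiv> \<lambda>s. 2 * (1 + T) powr (-\<alpha>) * (((1 + (T - s)) powr (-\<delta>) - (1 + s) powr (-\<delta>)) / \<delta>)"
  shows "s \<in> {0..T} \<Longrightarrow> (W has_real_derivative
      2 * (1 + T) powr (-\<alpha>) * ((1 + s) powr (-1 - \<delta>) + (1 + (T - s)) powr (-1 - \<delta>))) (at s within {0..T})"
    and "W T - W 0 \<le> 4 / \<delta> * (1 + T) powr (-\<alpha>)"
proof -
  assume s: "s \<in> {0..T}"
  have 1: "((\<lambda>s. (1 + s) powr (-\<delta>)) has_real_derivative -\<delta> * (1 + s) powr (-\<delta> - 1)) (at s)"
    using s by (auto intro!: derivative_eq_intros)
  have 2: "((\<lambda>s. (1 + (T - s)) powr (-\<delta>)) has_real_derivative \<delta> * (1 + (T - s)) powr (-\<delta> - 1)) (at s)"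
    using s by (auto intro!: derivative_eq_intros)
  have e: "-1 - \<delta> = -\<delta> - 1" by simp
  have "(W has_real_derivative 2 * (1 + T) powr (-\<alpha>) * ((\<delta> * (1 + (T - s)) powr (-\<delta> - 1) - (-\<delta> * (1 + s) powr (-\<delta> - 1))) / \<delta>)) (at s)"
    unfolding W_def by (intro DERIV_cmult DERIV_cdivide DERIV_diff 1 2)
  also have "(\<delta> * (1 + (T - s)) powr (-\<delta> - 1) - (-\<delta> * (1 + s) powr (-\<delta> - 1))) / \<delta> = (1 + s) powr (-1 - \<delta>) + (1 + (T - s)) powr (-1 - \<delta>)"
    using assms(1) unfolding e by (simp add: field_simps)
  finally show "(W has_real_derivative
      2 * (1 + T) powr (-\<alpha>) * ((1 + s) powr (-1 - \<delta>) + (1 + (T - s)) powr (-1 - \<delta>))) (at s within {0..T})"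
    by (rule has_field_derivative_at_within)
next
  have "W T - W 0 = 4 / \<delta> * (1 + T) powr (-\<alpha>) * (1 - (1 + T) powr (-\<delta>))"
    using assms(1) by (simp add: W_def field_simps)
  also have "\<dots> \<le> 4 / \<delta> * (1 + T) powr (-\<alpha>) * 1"
    using assms by (intro mult_left_mono) auto
  finally show "W T - W 0 \<le> 4 / \<delta> * (1 + T) powr (-\<alpha>)" by simp
qed

text \<open>The l^p bound \<open>M\<close> enters to the first power only: the sup norm and the
  small l^5 norm absorb all other powers of x. This makes the later Duhamel estimate a linear
  inequality in \<open>M\<close>. Here \<open>e\<close> stands for 1 + t.\<close>

lemma nonlinearity_lp_bound:
  fixes x h :: "int \<Rightarrow> complex"
  assumes sig: "\<sigma> > 2" and p: "2 \<le> p" "p \<le> 5" "1 / p + 1 / q = 1" and e: "e \<ge> 1" and k: "\<kappa> > 0" and M: "M \<ge> 0"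
    and sup: "\<And>n. cmod (x n) \<le> \<kappa> * e powr (-1/4)" and l5: "lp_bounded 5 x (\<kappa> * e powr (-1/5))"
    and lp: "lp_bounded p x (M * e powr (- ((p - 2) / (3 * p))))"
    and h: "\<And>n. cmod (h n) \<le> cmod (x n) powr (2 * \<sigma> + 1)"
  shows "lp_bounded q h (\<kappa> powr (2 * \<sigma>) * M * e powr (- (\<sigma> / 2)))"
proof -
  \<comment> \<open>Chosen so that the l^p norm to the power p (1 - \<theta>) is its q-th power,
    matching the left-hand side.\<close>
  define \<theta> where "\<theta> = 1 - q / p"
  define \<alpha> where "\<alpha> = (p - 2) / (3 * p)"
  \<comment> \<open>The powers of x left to the sup norm; nonnegative because \<theta> = 3 \<alpha>
    q with \<alpha> \<le> 1/5, so that 5 \<theta> \<le> 3 q.\<close>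
  define E where "E = 2 * \<sigma> * q - 5 * \<theta>"
  have q: "q > 0" "q = p / (p - 1)"
  proof -
    have "1 / q = (p - 1) / p" using p by (simp add: field_simps)
    then have "1 / (1 / q) = 1 / ((p - 1) / p)" by simp
    then show "q = p / (p - 1)" by simp
    then show "q > 0" using p by simp
  qed
  have lam: "\<theta> = 3 * \<alpha> * q" "0 \<le> \<theta>" "\<theta> \<le> 1" "p * (1 - \<theta>) = q"
  proof -
    have l: "\<theta> = (p - 2) / (p - 1)" unfolding \<theta>_def q(2) using p by (simp add: field_simps)
    have "3 * ((p - 2) / (3 * p)) = (p - 2) / p" using p by (simp add: field_simps)
    then show "\<theta> = 3 * \<alpha> * q" unfolding l \<alpha>_def q(2) using p by simp
    show "0 \<le> \<theta>" "\<theta> \<le> 1" unfolding l using p by auto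
    show "p * (1 - \<theta>) = q" unfolding \<theta>_def using p by simp
  qed
  have al: "0 \<le> \<alpha>" "\<alpha> \<le> 1/5" unfolding \<alpha>_def using p by (auto simp: field_simps)
  have E0: "E \<ge> 0"
  proof -
    have "15 * \<alpha> * q \<le> 15 * (1/5) * q" using al q by (intro mult_right_mono) auto
    also have "\<dots> \<le> 2 * \<sigma> * q" using sig q by (intro mult_right_mono) auto
    finally show ?thesis unfolding E_def lam(1) by simp
  qed
  have tot: "E + 5 * \<theta> + q = (2 * \<sigma> + 1) * q" unfolding E_def by (simp add: algebra_simps)
  have "(\<Sum>n\<in>A. cmod (h n) powr q) \<le> (\<kappa> powr (2 * \<sigma>) * M * e powr (- (\<sigma> / 2))) powr q" if A: "finite A" for A
  proof -
    let ?P = "(\<kappa> * e powr (-1/5)) powr 5" and ?Q = "(M * e powr (-\<alpha>)) powr p" and ?U = "(\<kappa> * e powr (-1/4)) powr E"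
    have "(\<Sum>n\<in>A. cmod (h n) powr q) \<le> (\<Sum>n\<in>A. ?U * ((cmod (x n) powr 5) powr \<theta> * (cmod (x n) powr p) powr (1 - \<theta>)))"
    proof (rule sum_mono)
      fix n
      have "cmod (h n) powr q \<le> (cmod (x n) powr (2 * \<sigma> + 1)) powr q" using h q by (intro powr_mono2) auto
      also have "\<dots> = cmod (x n) powr E * ((cmod (x n) powr 5) powr \<theta> * (cmod (x n) powr p) powr (1 - \<theta>))"
      proof -
        have "(cmod (x n) powr (2 * \<sigma> + 1)) powr q = cmod (x n) powr (E + 5 * \<theta> + q)"
          by (simp only: powr_powr tot)
        then show ?thesis by (simp only: powr_powr lam(4) powr_add mult.assoc)
      qed
      also have "\<dots> \<le> ?U * ((cmod (x n) powr 5) powr \<theta> * (cmod (x n) powr p) powr (1 - \<theta>))"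
        using sup E0 by (intro mult_right_mono powr_mono2) auto
      finally show "cmod (h n) powr q \<le> ?U * ((cmod (x n) powr 5) powr \<theta> * (cmod (x n) powr p) powr (1 - \<theta>))" .
    qed
    also have "\<dots> \<le> ?U * (?P powr \<theta> * ?Q powr (1 - \<theta>))"
      unfolding sum_distrib_left[symmetric]
      using holder_sum[OF lam(2,3) A _ lp_boundedD[OF l5 A] _ lp_boundedD[OF lp A]]
      by (intro mult_left_mono) (auto simp: \<alpha>_def)
    also have "?Q powr (1 - \<theta>) = M powr q * e powr (- (\<alpha> * q))"
      unfolding powr_powr lam(4) using M e by (simp add: powr_mult powr_powr)
    also have "?P powr \<theta> = \<kappa> powr (5 * \<theta>) * e powr (- \<theta>)"
      unfolding powr_powr using k e by (simp add: powr_mult powr_powr)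
    also have "?U = \<kappa> powr E * e powr (- (E / 4))"
      using k e by (simp add: powr_mult powr_powr)
    also have "\<kappa> powr E * e powr (- (E / 4)) * (\<kappa> powr (5 * \<theta>) * e powr (- \<theta>) * (M powr q * e powr (- (\<alpha> * q))))
      = (\<kappa> powr E * \<kappa> powr (5 * \<theta>)) * M powr q * (e powr (- (E / 4)) * e powr (- \<theta>) * e powr (- (\<alpha> * q)))"
      by (simp only: mult_ac)
    also have "\<kappa> powr E * \<kappa> powr (5 * \<theta>) = \<kappa> powr (2 * \<sigma> * q)" by (simp add: E_def flip: powr_add)
    also have "e powr (- (E / 4)) * e powr (- \<theta>) * e powr (- (\<alpha> * q)) = e powr (- (E / 4) - \<theta> - \<alpha> * q)"
      by (simp flip: powr_add)
    also have "\<kappa> powr (2 * \<sigma> * q) * M powr q * e powr (- (E / 4) - \<theta> - \<alpha> * q) \<le> \<kappa> powr (2 * \<sigma> * q) * M powr q * e powr (- (\<sigma> / 2) * q)"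
    proof (intro mult_left_mono powr_mono)
      \<comment> \<open>Decay collected: 1/4 per power in the sup norm, \<theta> from l^5, \<alpha>
        q from l^p. With \<theta> = 3 \<alpha> q the total exceeds \<sigma> q / 2 by \<alpha> q /
        4.\<close>
      have "- (E / 4) - \<theta> - \<alpha> * q = - (\<sigma> / 2) * q - \<alpha> * q / 4"
        unfolding E_def lam(1) by (simp add: field_simps)
      moreover have "0 \<le> \<alpha> * q" using al(1) q(1) by (intro mult_nonneg_nonneg) auto
      ultimately show "- (E / 4) - \<theta> - \<alpha> * q \<le> - (\<sigma> / 2) * q" by simp
    qed (use e in auto)
    also have "\<dots> = (\<kappa> powr (2 * \<sigma>) * M * e powr (- (\<sigma> / 2))) powr q"
      using M by (simp add: powr_mult powr_powr)
    finally show ?thesis .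
  qed
  then show ?thesis unfolding lp_bounded_def using M by simp
qed

section \<open>Pairings, sums and limits of l^p bounds\<close>

lemma lp_bounded_pairing:
  assumes p: "p > 1" "1 / p + 1 / q = 1" and x: "lp_bounded p x B"
    and A: "finite A" and y: "(\<Sum>n\<in>A. cmod (y n) powr q) \<le> 1"
  shows "cmod (\<Sum>n\<in>A. y n * x n) \<le> B"
proof -
  have q: "1 / q = 1 - 1 / p" using p by simp
  have q0: "q \<noteq> 0" using p by auto
  have "cmod (\<Sum>n\<in>A. y n * x n) \<le> (\<Sum>n\<in>A. (cmod (x n) powr p) powr (1 / p) * (cmod (y n) powr q) powr (1 - 1 / p))"
    unfolding q[symmetric] using p q0 by (intro sum_norm_le) (simp add: norm_mult powr_powr)
  also have "\<dots> \<le> (B powr p) powr (1 / p) * 1 powr (1 - 1 / p)"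
    using p by (intro holder_sum A lp_boundedD[OF x A] y) auto
  also have "\<dots> = B" using p lp_bounded_nonneg[OF x] by (simp add: powr_powr)
  finally show ?thesis .
qed

lemma lp_bounded_add:
  assumes p: "p > 1" and x: "lp_bounded p x A" and y: "lp_bounded p y B"
  shows "lp_bounded p (\<lambda>n. x n + y n) (A + B)"
proof -
  define q where "q = p / (p - 1)"
  have q: "1 / p + 1 / q = 1" using p by (simp add: q_def field_simps)
  show ?thesis
  proof (rule lp_bounded_dual[OF p q])
    fix S and z :: "int \<Rightarrow> complex" assume S: "finite S" "(\<Sum>n\<in>S. cmod (z n) powr q) \<le> 1"
    have "(\<Sum>n\<in>S. z n * (x n + y n)) = (\<Sum>n\<in>S. z n * x n) + (\<Sum>n\<in>S. z n * y n)"
      by (simp add: distrib_left sum.distrib)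
    then show "cmod (\<Sum>n\<in>S. z n * (x n + y n)) \<le> A + B"
      using lp_bounded_pairing[OF p q x S] lp_bounded_pairing[OF p q y S] norm_triangle_ineq[of "\<Sum>n\<in>S. z n * x n" "\<Sum>n\<in>S. z n * y n"]
      by simp
  qed (use lp_bounded_nonneg[OF x] lp_bounded_nonneg[OF y] in simp)
qed

lemma lp_bounded_limit:
  assumes "Bk \<longlonglongrightarrow> B" "\<And>k::nat. lp_bounded p x (Bk k)" "p > 0"
  shows "lp_bounded p x B"
proof -
  have "B \<ge> 0" using assms(1) by (rule tendsto_lowerbound) (use lp_bounded_nonneg[OF assms(2)] in auto)
  moreover have "(\<Sum>n\<in>A. cmod (x n) powr p) \<le> B powr p" if "finite A" for A
  proof -
    have "(\<lambda>k. Bk k powr p) \<longlonglongrightarrow> B powr p"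
      using assms lp_bounded_nonneg[OF assms(2)] by (intro tendsto_powr') auto
    then show ?thesis by (rule tendsto_lowerbound) (use lp_boundedD[OF assms(2) that] in auto)
  qed
  ultimately show ?thesis by (simp add: lp_bounded_def)
qed

text \<open>Induction along the half line: the infimum of the times of failure is itself good by
  \<open>closed\<close>, and so are all times shortly after it by \<open>ahead\<close>. The base
  case is \<open>closed\<close> at t = 0, whose premise is empty.\<close>

lemma forward_induction:
  fixes P :: "real \<Rightarrow> bool"
  assumes closed: "\<And>t. t \<ge> 0 \<Longrightarrow> (\<And>s. 0 \<le> s \<Longrightarrow> s < t \<Longrightarrow> P s) \<Longrightarrow> P t"
    and ahead: "\<And>t. t \<ge> 0 \<Longrightarrow> (\<And>s. 0 \<le> s \<Longrightarrow> s \<le> t \<Longrightarrow> P s) \<Longrightarrow> \<exists>d>0. \<forall>s. t < s \<longrightarrow> s < t + d \<longrightarrow> P s"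
    and t: "t \<ge> 0"
  shows "P t"
proof (rule ccontr)
  assume "\<not> P t"
  define S where "S = {s. s \<ge> 0 \<and> \<not> P s}"
  have S: "S \<noteq> {}" "bdd_below S" using \<open>\<not> P t\<close> t by (auto simp: S_def intro!: bdd_belowI[of _ 0])
  define \<tau> where "\<tau> = Inf S"
  have tau: "\<tau> \<ge> 0" unfolding \<tau>_def by (rule cInf_greatest[OF S(1)]) (simp add: S_def)
  have before: "P s" if "0 \<le> s" "s < \<tau>" for s
    using that cInf_lower[OF _ S(2), of s] unfolding \<tau>_def S_def by fastforce
  have "P s" if "0 \<le> s" "s \<le> \<tau>" for s
    using before[OF that(1)] closed[OF tau before] that by (cases "s = \<tau>") auto
  then obtain d where d: "d > 0" "\<And>s. \<tau> < s \<Longrightarrow> s < \<tau> + d \<Longrightarrow> P s" using ahead[OF tau] by blast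
  have "\<tau> + d \<le> Inf S"
  proof (rule cInf_greatest[OF S(1)])
    fix s assume "s \<in> S"
    then show "\<tau> + d \<le> s"
      using d(2)[of s] \<open>\<And>s. 0 \<le> s \<Longrightarrow> s \<le> \<tau> \<Longrightarrow> P s\<close>[of s] by (fastforce simp: S_def)
  qed
  then show False using d(1) by (simp add: \<tau>_def)
qed

text \<open>The body of \<open>dispersive_forms\<close>, named so that one fixed constant can enter
  the smallness conditions on the data.\<close>

definition dispersive_constant :: "real \<Rightarrow> bool" where
  "dispersive_constant C \<longleftrightarrow> C \<ge> 1 \<and> (\<forall>t\<ge>0. \<forall>k\<in>{sine_ker, cosine_ker}. \<forall>(x :: int \<Rightarrow> complex) A X. finite A \<longrightarrow> X \<ge> 0 \<longrightarrow>
    (\<forall>q y B. 1 \<le> q \<longrightarrow> q \<le> 2 \<longrightarrow> finite B \<longrightarrow> (\<Sum>n\<in>A. cmod (x n) powr q) \<le> X powr q \<longrightarrow>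
       (\<Sum>m\<in>B. cmod (y m) powr q) \<le> 1 \<longrightarrow>
       cmod (\<Sum>n\<in>A. \<Sum>m\<in>B. x n * y m * of_real (k t (n - m))) \<le> C * (1 + t) powr (- ((2 / q - 1) / 3)) * X) \<and>
    (\<forall>m. (\<Sum>n\<in>A. cmod (x n) powr (5/4)) \<le> X powr (5/4) \<longrightarrow>
       cmod (\<Sum>n\<in>A. x n * of_real (k t (n - m))) \<le> C * (1 + t) powr (-1/4) * X))"

lemma dispersive_constant_exists: "\<exists>C. dispersive_constant C"
  unfolding dispersive_constant_def by (rule dispersive_forms)

lemma dispersive_constantD:
  assumes "dispersive_constant C" "t \<ge> 0" "k \<in> {sine_ker, cosine_ker}" "finite A"
  shows "1 \<le> q \<Longrightarrow> q \<le> 2 \<Longrightarrow> finite B \<Longrightarrow> lp_bounded q x X \<Longrightarrow> (\<Sum>m\<in>B. cmod (y m) powr q) \<le> 1 \<Longrightarrow>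
       cmod (\<Sum>n\<in>A. \<Sum>m\<in>B. x n * y m * of_real (k t (n - m))) \<le> C * (1 + t) powr (- ((2 / q - 1) / 3)) * X"
    and "lp_bounded (5/4) x X \<Longrightarrow> cmod (\<Sum>n\<in>A. x n * of_real (k t (n - m))) \<le> C * (1 + t) powr (-1/4) * X"
proof -
  note D = assms(1)[unfolded dispersive_constant_def, THEN conjunct2, rule_format, OF assms(2,3,4)]
  show "cmod (\<Sum>n\<in>A. \<Sum>m\<in>B. x n * y m * of_real (k t (n - m))) \<le> C * (1 + t) powr (- ((2 / q - 1) / 3)) * X"
    if "1 \<le> q" "q \<le> 2" "finite B" "lp_bounded q x X" "(\<Sum>m\<in>B. cmod (y m) powr q) \<le> 1"
    by (rule D[OF lp_bounded_nonneg[OF that(4)], THEN conjunct1, rule_format, OF that(1,2,3) lp_boundedD[OF that(4) assms(4)] that(5)])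
  show "cmod (\<Sum>n\<in>A. x n * of_real (k t (n - m))) \<le> C * (1 + t) powr (-1/4) * X" if "lp_bounded (5/4) x X"
    by (rule D[OF lp_bounded_nonneg[OF that], THEN conjunct2, rule_format, OF lp_boundedD[OF that assms(4)]])
qed

text \<open>Turns the rate obtained by interpolation into the rate of the theorem, and places q in
  [5/4, 2], where data in l^(5/4) are controlled.\<close>

lemma conjugate_exponent:
  fixes p q :: real
  assumes "2 \<le> p" "p \<le> 5" "1 / p + 1 / q = 1"
  shows "5/4 \<le> q" "q \<le> 2" "(2 / q - 1) / 3 = (p - 2) / (3 * p)"
proof -
  have "1 / q = (p - 1) / p" using assms by (simp add: field_simps)
  then have "1 / (1 / q) = 1 / ((p - 1) / p)" by simp
  then have q: "q = p / (p - 1)" by simp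
  show "5/4 \<le> q" "q \<le> 2" unfolding q using assms by (auto simp: field_simps)
  have "2 / q = 2 * (1 / q)" by simp
  also have "\<dots> = 2 - 2 / p" using assms by simp
  finally have e: "2 / q = 2 - 2 / p" .
  show "(2 / q - 1) / 3 = (p - 2) / (3 * p)" unfolding e using assms(1) by (simp add: field_simps)
qed

section \<open>Duhamel's formula in the decaying norms\<close>

context
  fixes C \<delta> \<kappa> T :: real and h u v :: "real \<Rightarrow> int \<Rightarrow> complex" and f g :: "int \<Rightarrow> complex"
  assumes C: "dispersive_constant C" and d: "\<delta> > 0" and T: "T \<ge> 0"
    and sol: "forced_solution h u v" and init: "u 0 = f" "v 0 = g"
    and bdd: "\<And>s n. s \<in> {0..T} \<Longrightarrow> cmod (u s n) \<le> \<kappa>"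
begin

text \<open>A forcing of size (1+s)^(-1-\<delta>) in the dual exponent reproduces the free decay
  rate, at the price of the factor 4/\<delta>. The estimate is dual: \<open>y\<close> runs over the
  unit ball of l^q, on which the bilinear forms are bounded.\<close>

lemma duhamel_lp:
  assumes p: "2 \<le> p" "p \<le> 5" "1 / p + 1 / q = 1"
    and fg: "lp_bounded q f Nf" "lp_bounded q g Ng"
    and h: "\<And>s. s \<in> {0..T} \<Longrightarrow> lp_bounded q (h s) (K * (1 + s) powr (-1 - \<delta>))" and K: "K \<ge> 0"
  shows "lp_bounded p (u T) (C * (Nf + Ng + 4 / \<delta> * K) * (1 + T) powr (- ((p - 2) / (3 * p))))"
proof -
  define \<alpha> where "\<alpha> = (p - 2) / (3 * p)"
  have al: "0 \<le> \<alpha>" "\<alpha> \<le> 1" unfolding \<alpha>_def using p by (auto simp: field_simps)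
  note q = conjugate_exponent[OF p]
  have q1: "1 \<le> q" using q by simp
  have C1: "C \<ge> 1" using C by (simp add: dispersive_constant_def)
  define W where "W s = 2 * (1 + T) powr (-\<alpha>) * (((1 + (T - s)) powr (-\<delta>) - (1 + s) powr (-\<delta>)) / \<delta>)" for s
  show ?thesis
  proof (rule lp_bounded_dual)
    fix Y and y :: "int \<Rightarrow> complex" assume Y: "finite Y" "(\<Sum>n\<in>Y. cmod (y n) powr q) \<le> 1"
    have "cmod (\<Sum>m\<in>Y. y m * u T m) \<le> C * (1 + T) powr (-\<alpha>) * Ng + C * (1 + T) powr (-\<alpha>) * Nf + (C * K * W T - C * K * W 0)"
    proof (rule duhamel_bound[OF sol T Y(1) bdd])
      fix A :: "int set" assume A: "finite A"
      show "cmod (\<Sum>n\<in>A. \<Sum>m\<in>Y. v 0 n * y m * of_real (sine_ker T (n - m))) \<le> C * (1 + T) powr (-\<alpha>) * Ng"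
        using dispersive_constantD(1)[OF C T _ A q1 q(2) Y(1) fg(2) Y(2), of sine_ker] unfolding init(2) q(3) \<alpha>_def by simp
      show "cmod (\<Sum>n\<in>A. \<Sum>m\<in>Y. u 0 n * y m * of_real (cosine_ker T (n - m))) \<le> C * (1 + T) powr (-\<alpha>) * Nf"
        using dispersive_constantD(1)[OF C T _ A q1 q(2) Y(1) fg(1) Y(2), of cosine_ker] unfolding init(1) q(3) \<alpha>_def by simp
    next
      fix A :: "int set" and s assume A: "finite A" and s: "s \<in> {0..T}"
      have "cmod (\<Sum>n\<in>A. \<Sum>m\<in>Y. h s n * y m * of_real (sine_ker (T - s) (n - m))) \<le> C * (1 + (T - s)) powr (-\<alpha>) * (K * (1 + s) powr (-1 - \<delta>))"
        using dispersive_constantD(1)[OF C _ _ A q1 q(2) Y(1) h[OF s] Y(2), of "T - s" sine_ker] s unfolding q(3) \<alpha>_def by simp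
      also have "\<dots> = C * K * ((1 + (T - s)) powr (-\<alpha>) * (1 + s) powr (-1 - \<delta>))" by (simp only: mult_ac)
      also have "\<dots> \<le> C * K * (2 * (1 + T) powr (-\<alpha>) * ((1 + s) powr (-1 - \<delta>) + (1 + (T - s)) powr (-1 - \<delta>)))"
        using s C1 K by (intro mult_left_mono time_weight_le al d) auto
      finally show "cmod (\<Sum>n\<in>A. \<Sum>m\<in>Y. h s n * y m * of_real (sine_ker (T - s) (n - m))) \<le>
        C * K * (2 * (1 + T) powr (-\<alpha>) * ((1 + s) powr (-1 - \<delta>) + (1 + (T - s)) powr (-1 - \<delta>)))" .
    next
      fix s assume s: "s \<in> {0..T}"
      show "((\<lambda>s. C * K * W s) has_real_derivative C * K * (2 * (1 + T) powr (-\<alpha>) * ((1 + s) powr (-1 - \<delta>) + (1 + (T - s)) powr (-1 - \<delta>)))) (at s within {0..T})"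
        unfolding W_def by (intro DERIV_cmult time_weight_primitive(1)[OF d T s])
    qed
    also have "C * K * W T - C * K * W 0 = C * K * (W T - W 0)" by (simp only: right_diff_distrib)
    also have "\<dots> \<le> C * K * (4 / \<delta> * (1 + T) powr (-\<alpha>))"
      using time_weight_primitive(2)[OF d T, of \<alpha>] C1 K unfolding W_def by (intro mult_left_mono) auto
    also have "C * (1 + T) powr (-\<alpha>) * Ng + C * (1 + T) powr (-\<alpha>) * Nf + C * K * (4 / \<delta> * (1 + T) powr (-\<alpha>))
      = C * (Nf + Ng + 4 / \<delta> * K) * (1 + T) powr (-\<alpha>)" by (simp add: algebra_simps)
    finally show "cmod (\<Sum>n\<in>Y. y n * u T n) \<le> C * (Nf + Ng + 4 / \<delta> * K) * (1 + T) powr (- ((p - 2) / (3 * p)))"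
      unfolding \<alpha>_def by simp
  next
    have "0 \<le> Nf + Ng + 4 / \<delta> * K" using lp_bounded_nonneg[OF fg(1)] lp_bounded_nonneg[OF fg(2)] K d by simp
    then show "0 \<le> C * (Nf + Ng + 4 / \<delta> * K) * (1 + T) powr (- ((p - 2) / (3 * p)))" using C1 by simp
  qed (use p in auto)
qed

text \<open>The endpoint p = \<infinity>, where a unit mass at the single site \<open>n\<close>
  replaces the dual unit ball and the l^5 norm of the kernel gives the rate 1/4.\<close>

lemma duhamel_sup:
  assumes fg: "lp_bounded (5/4) f Nf" "lp_bounded (5/4) g Ng"
    and h: "\<And>s. s \<in> {0..T} \<Longrightarrow> lp_bounded (5/4) (h s) (K * (1 + s) powr (-1 - \<delta>))" and K: "K \<ge> 0"
  shows "cmod (u T n) \<le> C * (Nf + Ng + 4 / \<delta> * K) * (1 + T) powr (-1/4)"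
proof -
  define \<alpha> :: real where "\<alpha> = 1/4"
  have al: "0 \<le> \<alpha>" "\<alpha> \<le> 1" unfolding \<alpha>_def by auto
  have C1: "C \<ge> 1" using C by (simp add: dispersive_constant_def)
  define W where "W s = 2 * (1 + T) powr (-\<alpha>) * (((1 + (T - s)) powr (-\<delta>) - (1 + s) powr (-\<delta>)) / \<delta>)" for s
  have "cmod (\<Sum>m\<in>{n}. 1 * u T m) \<le> C * (1 + T) powr (-\<alpha>) * Ng + C * (1 + T) powr (-\<alpha>) * Nf + (C * K * W T - C * K * W 0)"
  proof (rule duhamel_bound[OF sol T _ bdd])
    fix A :: "int set" assume A: "finite A"
    show "cmod (\<Sum>n'\<in>A. \<Sum>m\<in>{n}. v 0 n' * 1 * of_real (sine_ker T (n' - m))) \<le> C * (1 + T) powr (-\<alpha>) * Ng"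
      using dispersive_constantD(2)[OF C T _ A fg(2), of sine_ker n] unfolding init(2) \<alpha>_def by simp
    show "cmod (\<Sum>n'\<in>A. \<Sum>m\<in>{n}. u 0 n' * 1 * of_real (cosine_ker T (n' - m))) \<le> C * (1 + T) powr (-\<alpha>) * Nf"
      using dispersive_constantD(2)[OF C T _ A fg(1), of cosine_ker n] unfolding init(1) \<alpha>_def by simp
  next
    fix A :: "int set" and s assume A: "finite A" and s: "s \<in> {0..T}"
    have "cmod (\<Sum>n'\<in>A. \<Sum>m\<in>{n}. h s n' * 1 * of_real (sine_ker (T - s) (n' - m))) \<le> C * (1 + (T - s)) powr (-\<alpha>) * (K * (1 + s) powr (-1 - \<delta>))"
      using dispersive_constantD(2)[OF C _ _ A h[OF s], of "T - s" sine_ker n] s unfolding \<alpha>_def by simp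
    also have "\<dots> = C * K * ((1 + (T - s)) powr (-\<alpha>) * (1 + s) powr (-1 - \<delta>))" by (simp only: mult_ac)
    also have "\<dots> \<le> C * K * (2 * (1 + T) powr (-\<alpha>) * ((1 + s) powr (-1 - \<delta>) + (1 + (T - s)) powr (-1 - \<delta>)))"
      using s C1 K by (intro mult_left_mono time_weight_le al d) auto
    finally show "cmod (\<Sum>n'\<in>A. \<Sum>m\<in>{n}. h s n' * 1 * of_real (sine_ker (T - s) (n' - m))) \<le>
      C * K * (2 * (1 + T) powr (-\<alpha>) * ((1 + s) powr (-1 - \<delta>) + (1 + (T - s)) powr (-1 - \<delta>)))" .
  next
    fix s assume s: "s \<in> {0..T}"
    show "((\<lambda>s. C * K * W s) has_real_derivative C * K * (2 * (1 + T) powr (-\<alpha>) * ((1 + s) powr (-1 - \<delta>) + (1 + (T - s)) powr (-1 - \<delta>)))) (at s within {0..T})"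
      unfolding W_def by (intro DERIV_cmult time_weight_primitive(1)[OF d T s])
  qed auto
  also have "C * K * W T - C * K * W 0 = C * K * (W T - W 0)" by (simp only: right_diff_distrib)
  also have "\<dots> \<le> C * K * (4 / \<delta> * (1 + T) powr (-\<alpha>))"
    using time_weight_primitive(2)[OF d T, of \<alpha>] C1 K unfolding W_def by (intro mult_left_mono) auto
  also have "C * (1 + T) powr (-\<alpha>) * Ng + C * (1 + T) powr (-\<alpha>) * Nf + C * K * (4 / \<delta> * (1 + T) powr (-\<alpha>))
    = C * (Nf + Ng + 4 / \<delta> * K) * (1 + T) powr (-\<alpha>)" by (simp add: algebra_simps)
  finally show ?thesis unfolding \<alpha>_def by simp
qed

end

section \<open>The continuity argument\<close>

definition small_profile :: "real \<Rightarrow> real \<Rightarrow> (int \<Rightarrow> complex) \<Rightarrow> bool" where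
  "small_profile \<kappa> t x \<longleftrightarrow> (\<forall>n. cmod (x n) \<le> \<kappa> * (1 + t) powr (-1/4)) \<and> lp_bounded 5 x (\<kappa> * (1 + t) powr (-1/5))"

text \<open>Both parts of the profile constrain finitely many sites at a time, so componentwise
  continuity is enough to pass to the limit from the left.\<close>

lemma small_profile_limit:
  assumes t: "t > 0" and c: "\<And>n. continuous_on {0..} (\<lambda>s. u s n)"
    and before: "\<And>s. 0 \<le> s \<Longrightarrow> s < t \<Longrightarrow> small_profile \<kappa> s (u s)"
  shows "small_profile \<kappa> t (u t)"
proof -
  have ev: "\<forall>\<^sub>F s in at_left t. 0 \<le> s \<and> s < t"
    using eventually_at_left_real[OF t] by (rule eventually_mono) auto
  have lim: "((\<lambda>s. u s n) \<longlongrightarrow> u t n) (at_left t)" for n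
  proof -
    have "continuous (at t within {0..}) (\<lambda>s. u s n)" using c[of n] t by (simp add: continuous_on_eq_continuous_within)
    then have "((\<lambda>s. u s n) \<longlongrightarrow> u t n) (at t within {0..})" by (simp add: continuous_within)
    moreover have "at t within {0..} = at t" using t by (intro at_within_interior) auto
    ultimately show ?thesis by (simp add: filterlim_at_split)
  qed
  have limw: "((\<lambda>s. \<kappa> * (1 + s) powr r) \<longlongrightarrow> \<kappa> * (1 + t) powr r) (at_left t)" for r
    using t by (intro tendsto_intros) auto
  have k0: "\<kappa> \<ge> 0"
    using before[of 0] t lp_bounded_nonneg[of 5 "u 0" "\<kappa> * (1 + 0) powr (-1/5)"] by (simp add: small_profile_def)
  have "cmod (u t n) \<le> \<kappa> * (1 + t) powr (-1/4)" for n
  proof (rule tendsto_le[OF trivial_limit_at_left_real limw tendsto_norm[OF lim]])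
    show "\<forall>\<^sub>F s in at_left t. cmod (u s n) \<le> \<kappa> * (1 + s) powr (-1/4)"
      using ev by (rule eventually_mono) (use before in \<open>auto simp: small_profile_def\<close>)
  qed
  moreover have "(\<Sum>n\<in>A. cmod (u t n) powr 5) \<le> (\<kappa> * (1 + t) powr (-1/5)) powr 5" if A: "finite A" for A
  proof (rule tendsto_le[OF trivial_limit_at_left_real])
    show "((\<lambda>s. (\<kappa> * (1 + s) powr (-1/5)) powr 5) \<longlongrightarrow> (\<kappa> * (1 + t) powr (-1/5)) powr 5) (at_left t)"
      using k0 by (intro tendsto_powr'[OF limw tendsto_const]) (auto intro!: always_eventually)
    show "((\<lambda>s. \<Sum>n\<in>A. cmod (u s n) powr 5) \<longlongrightarrow> (\<Sum>n\<in>A. cmod (u t n) powr 5)) (at_left t)"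
      by (intro tendsto_sum tendsto_powr'[OF tendsto_norm[OF lim] tendsto_const]) (auto intro!: always_eventually)
    show "\<forall>\<^sub>F s in at_left t. (\<Sum>n\<in>A. cmod (u s n) powr 5) \<le> (\<kappa> * (1 + s) powr (-1/5)) powr 5"
    proof (rule eventually_mono[OF ev])
      fix s assume "0 \<le> s \<and> s < t"
      then have "lp_bounded 5 (u s) (\<kappa> * (1 + s) powr (-1/5))" using before unfolding small_profile_def by blast
      then show "(\<Sum>n\<in>A. cmod (u s n) powr 5) \<le> (\<kappa> * (1 + s) powr (-1/5)) powr 5" by (rule lp_boundedD[OF _ A])
    qed
  qed
  ultimately show ?thesis using k0 by (simp add: small_profile_def lp_bounded_def)
qed

text \<open>The margin between $\kappa/2$ and $\kappa$ absorbs the growth of $u$ in $l^2$, hence in $l^5$ and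
  $l^\infty$, over a short time.\<close>

lemma small_profile_ahead:
  assumes t: "t \<ge> 0" and k: "\<kappa> > 0" and half: "small_profile (\<kappa> / 2) t (u t)"
    and lip: "\<And>s. t \<le> s \<Longrightarrow> s \<le> t + 1 \<Longrightarrow> lp_bounded 2 (\<lambda>n. u s n - u t n) (K * (s - t))"
  shows "\<exists>d>0. \<forall>s. t < s \<longrightarrow> s < t + d \<longrightarrow> small_profile \<kappa> s (u s)"
proof -
  have pos: "0 < \<kappa> * (1 + t) powr r - \<kappa> / 2 * (1 + t) powr r" for r using k t by simp
  have "((\<lambda>s. \<kappa> * (1 + s) powr r - (\<kappa> / 2 * (1 + t) powr r + K * (s - t))) \<longlongrightarrow>
    \<kappa> * (1 + t) powr r - (\<kappa> / 2 * (1 + t) powr r + K * (t - t))) (at_right t)" for r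
    using t by (intro tendsto_intros) auto
  then have ev: "\<forall>\<^sub>F s in at_right t. \<kappa> * (1 + s) powr r - (\<kappa> / 2 * (1 + t) powr r + K * (s - t)) > 0" for r
    by (rule order_tendstoD) (use pos[of r] in simp)
  have ev1: "\<forall>\<^sub>F s in at_right t. s < t + 1"
    by (rule eventually_mono[OF eventually_at_right_real[of t "t + 1"]]) auto
  have "\<forall>\<^sub>F s in at_right t. small_profile \<kappa> s (u s)"
    using ev[of "-1/4"] ev[of "-1/5"] ev1 eventually_at_right_less[of t]
  proof eventually_elim
    case (elim s)
    have D: "lp_bounded 2 (\<lambda>n. u s n - u t n) (K * (s - t))" by (rule lip) (use elim(3,4) in linarith)+
    have "cmod (u s n) \<le> \<kappa> * (1 + s) powr (-1/4)" for n
    proof -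
      have "cmod (u s n) \<le> cmod (u t n) + cmod (u s n - u t n)" by (rule norm_triangle_sub)
      moreover have "cmod (u s n - u t n) \<le> K * (s - t)" using lp_bounded_pointwise[OF D] by simp
      moreover have "cmod (u t n) \<le> \<kappa> / 2 * (1 + t) powr (-1/4)" using half by (simp add: small_profile_def)
      ultimately show ?thesis using elim(1) by linarith
    qed
    moreover have "lp_bounded 5 (u s) (\<kappa> * (1 + s) powr (-1/5))"
    proof -
      have "lp_bounded 5 (\<lambda>n. u s n - u t n) (K * (s - t))" by (rule lp_bounded_embed[OF D]) auto
      moreover have "lp_bounded 5 (u t) (\<kappa> / 2 * (1 + t) powr (-1/5))" using half by (simp add: small_profile_def)
      ultimately have "lp_bounded 5 (\<lambda>n. u t n + (u s n - u t n)) (\<kappa> / 2 * (1 + t) powr (-1/5) + K * (s - t))"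
        by (intro lp_bounded_add) auto
      then have "lp_bounded 5 (u s) (\<kappa> / 2 * (1 + t) powr (-1/5) + K * (s - t))" by simp
      then show ?thesis by (rule lp_bounded_mono) (use elim(2) in linarith, simp)
    qed
    ultimately show ?case by (simp add: small_profile_def)
  qed
  then obtain b where b: "b > t" "\<forall>s>t. s < b \<longrightarrow> small_profile \<kappa> s (u s)"
    unfolding eventually_at_right_field by auto
  show ?thesis
  proof (intro exI[of _ "b - t"] conjI allI impI)
    fix s assume "t < s" "s < t + (b - t)"
    then show "small_profile \<kappa> s (u s)" using b(2) by simp
  qed (use b(1) in simp)
qed

text \<open>The truncated equation is solved first, so that the solution exists for all times before
  anything is known about its size; the continuity argument then shows that the truncation was never
  active. The third condition on \<open>\<kappa>\<close> says that one passage of the nonlinearity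
  through Duhamel's formula costs at most a factor 1/4.\<close>

lemma global_small_solution:
  fixes C \<sigma> \<kappa> a :: real
  assumes sig: "\<sigma> > 2" and C: "dispersive_constant C" and k: "0 < \<kappa>" "\<kappa> \<le> 1" "C * (4 / (\<sigma> / 2 - 1) * \<kappa> powr (2 * \<sigma>)) \<le> 1 / 4"
    and a: "\<bar>a\<bar> = 1" and f: "lp_bounded (5/4) f (\<kappa> / (8 * C))" and g: "lp_bounded (5/4) g (\<kappa> / (8 * C))"
  shows "\<exists>u. dnkg_solution a \<sigma> u \<and> u 0 = f \<and> time_deriv u 0 = g \<and>
    (\<forall>p q t Nf Ng. 2 \<le> p \<and> p \<le> 5 \<and> 1 / p + 1 / q = 1 \<and> t \<ge> 0 \<and> lp_bounded q f Nf \<and> lp_bounded q g Ng \<longrightarrow>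
       lp_bounded p (u t) (2 * C * (Nf + Ng) * (1 + t) powr (- ((p - 2) / (3 * p)))))"
proof -
  define \<delta> where "\<delta> = \<sigma> / 2 - 1"
  have d: "\<delta> > 0" "-1 - \<delta> = - (\<sigma> / 2)" using sig by (simp_all add: \<delta>_def)
  have C1: "C \<ge> 1" using C by (simp add: dispersive_constant_def)
  have s2: "\<sigma> \<ge> 1 / 2" using sig by simp
  define F where "F z = of_real a * nlin_trunc \<sigma> z" for z
  define L where "L = 2 * \<sigma> + 1"
  have L0: "L \<ge> 0" using sig by (simp add: L_def)
  have F: "cmod (F z - F w) \<le> L * cmod (z - w)" "F 0 = 0" "cmod (F z) \<le> cmod z powr (2 * \<sigma> + 1)" for z w
    using nlin_trunc[OF s2] a unfolding F_def L_def right_diff_distrib[symmetric] norm_mult by simp_all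
  \<comment> \<open>The two data terms together then contribute 2 C \<epsilon> = \<kappa>/4.\<close>
  define \<epsilon> where "\<epsilon> = \<kappa> / (8 * C)"
  have e0: "\<epsilon> \<ge> 0" using k C1 by (simp add: \<epsilon>_def)
  have f2: "L2_set (\<lambda>n. cmod (f n)) A \<le> \<epsilon>" and g2: "L2_set (\<lambda>n. cmod (g n)) A \<le> \<epsilon>" if "finite A" for A
    using lp_bounded_embed[OF f, of 2] lp_bounded_embed[OF g, of 2] that by (auto simp: lp_bounded_2_iff \<epsilon>_def)
  obtain u v where sol: "forced_solution (\<lambda>s n. - F (u s n)) u v" and init: "u 0 = f" "v 0 = g"
    and growth: "\<forall>t\<ge>0. \<forall>A. finite A \<longrightarrow> L2_set (\<lambda>n. cmod (u t n)) A \<le> \<epsilon> * exp ((5 + L) * t) \<and> L2_set (\<lambda>n. cmod (v t n)) A \<le> \<epsilon> * exp ((5 + L) * t)"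
    using lipschitz_lattice_existence[of F L f \<epsilon> g, OF F(1) L0 F(2) f2 g2] by blast
  have l2: "lp_bounded 2 (u t) (\<epsilon> * exp ((5 + L) * T))" "lp_bounded 2 (v t) (\<epsilon> * exp ((5 + L) * T))" if "0 \<le> t" "t \<le> T" for t T
  proof -
    have "\<epsilon> * exp ((5 + L) * t) \<le> \<epsilon> * exp ((5 + L) * T)" using that e0 L0 by (intro mult_left_mono) (auto intro: mult_left_mono)
    then show "lp_bounded 2 (u t) (\<epsilon> * exp ((5 + L) * T))" "lp_bounded 2 (v t) (\<epsilon> * exp ((5 + L) * T))"
      using growth that(1) e0 unfolding lp_bounded_2_iff by (meson mult_nonneg_nonneg exp_ge_zero order_trans)+
  qed
  have du: "((\<lambda>s. u s n) has_vector_derivative v t n) (at t within {0..})" if "t \<ge> 0" for t n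
    using sol that by (auto simp: forced_solution_def)
  have cu: "continuous_on {0..} (\<lambda>s. u s n)" for n
    by (rule continuous_on_vector_derivative, rule du) simp
  have lip: "lp_bounded 2 (\<lambda>n. u s n - u t n) (\<epsilon> * exp ((5 + L) * T) * (s - t))" if "0 \<le> t" "t \<le> s" "s \<le> T" for s t T
  proof -
    let ?B = "\<epsilon> * exp ((5 + L) * T)"
    have "L2_set (\<lambda>n. cmod (u s n - u t n)) A \<le> ?B * s - ?B * t" if A: "finite A" for A
    proof (rule L2_set_majorant[OF A \<open>t \<le> s\<close>])
      fix r n assume r: "r \<in> {t..s}"
      show "((\<lambda>y. u y n) has_vector_derivative v r n) (at r within {t..s})"
        using r \<open>0 \<le> t\<close> by (intro has_vector_derivative_within_subset[OF du]) auto
    next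
      fix r assume r: "r \<in> {t..s}"
      show "((\<lambda>y. ?B * y) has_real_derivative ?B) (at r within {t..s})" by (auto intro!: derivative_eq_intros)
      have "lp_bounded 2 (v r) ?B" using r \<open>0 \<le> t\<close> \<open>s \<le> T\<close> by (intro l2) auto
      then show "L2_set (\<lambda>n. cmod (v r n)) A \<le> ?B" using A by (simp add: lp_bounded_2_iff)
    qed
    then show ?thesis using e0 that unfolding lp_bounded_2_iff right_diff_distrib[symmetric] by simp
  qed
  \<comment> \<open>A small profile is exactly what \<open>nonlinearity_lp_bound\<close> requires
    with e = 1 + s, and its rate \<sigma>/2 is written as 1 + \<delta>.\<close>
  have force: "lp_bounded q (\<lambda>n. - F (u s n)) (\<kappa> powr (2 * \<sigma>) * M * (1 + s) powr (-1 - \<delta>))"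
    if p: "2 \<le> p" "p \<le> 5" "1 / p + 1 / q = 1" and s: "s \<ge> 0" and sp: "small_profile \<kappa> s (u s)"
      and M: "M \<ge> 0" "lp_bounded p (u s) (M * (1 + s) powr (- ((p - 2) / (3 * p))))" for p q s M
    unfolding d(2)
  proof (rule nonlinearity_lp_bound[OF sig p _ k(1) M(1) _ _ M(2)])
    show "cmod (u s n) \<le> \<kappa> * (1 + s) powr (-1/4)" "lp_bounded 5 (u s) (\<kappa> * (1 + s) powr (-1/5))" for n
      using sp by (auto simp: small_profile_def)
    show "cmod (- F (u s n)) \<le> cmod (u s n) powr (2 * \<sigma> + 1)" for n using F(3) by simp
  qed (use s in simp)
  have sup: "cmod (u s n) \<le> \<kappa>" if "s \<ge> 0" "small_profile \<kappa> s (u s)" for s n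
  proof -
    have "(1 + s) powr (-1/4) \<le> 1 powr (-1/4)" using that by (intro powr_mono2') auto
    then have "\<kappa> * (1 + s) powr (-1/4) \<le> \<kappa>" using k by simp
    then show ?thesis using that(2) unfolding small_profile_def by (meson order_trans)
  qed
  have kk: "C * (4 / \<delta> * (\<kappa> powr (2 * \<sigma>) * M)) \<le> M / 4" if "M \<ge> 0" for M
    using mult_right_mono[OF k(3) that] by (simp add: \<delta>_def mult_ac)
  \<comment> \<open>One round of Duhamel: a weighted l^p bound \<open>M\<close> up to time T is
    replaced at T by the data term plus M/4.\<close>
  have step: "lp_bounded p (u T) ((C * (Nf + Ng) + M / 4) * (1 + T) powr (- ((p - 2) / (3 * p))))"
    if p: "2 \<le> p" "p \<le> 5" "1 / p + 1 / q = 1" and T: "T \<ge> 0" and sp: "\<And>s. 0 \<le> s \<Longrightarrow> s \<le> T \<Longrightarrow> small_profile \<kappa> s (u s)"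
      and fg: "lp_bounded q f Nf" "lp_bounded q g Ng" and M: "M \<ge> 0"
      and lp: "\<And>s. 0 \<le> s \<Longrightarrow> s \<le> T \<Longrightarrow> lp_bounded p (u s) (M * (1 + s) powr (- ((p - 2) / (3 * p))))" for p q T Nf Ng M
  proof -
    have "lp_bounded p (u T) (C * (Nf + Ng + 4 / \<delta> * (\<kappa> powr (2 * \<sigma>) * M)) * (1 + T) powr (- ((p - 2) / (3 * p))))"
      by (rule duhamel_lp[OF C d(1) T sol init _ p fg])
        (use sup sp force[OF p _ _ M] lp M in \<open>auto intro!: mult_nonneg_nonneg\<close>)
    then show ?thesis
    proof (rule lp_bounded_mono)
      have "C * (Nf + Ng + 4 / \<delta> * (\<kappa> powr (2 * \<sigma>) * M)) \<le> C * (Nf + Ng) + M / 4"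
        using kk[OF M] by (simp only: distrib_left[of C "Nf + Ng"] add_left_mono)
      then show "C * (Nf + Ng + 4 / \<delta> * (\<kappa> powr (2 * \<sigma>) * M)) * (1 + T) powr (- ((p - 2) / (3 * p))) \<le> (C * (Nf + Ng) + M / 4) * (1 + T) powr (- ((p - 2) / (3 * p)))"
        by (rule mult_right_mono) simp
    qed (use p in auto)
  qed
  have p5: "(2::real) \<le> 5" "(5::real) \<le> 5" "1 / 5 + 1 / (5/4) = (1::real)" by auto
  have Ce: "C * (\<epsilon> + \<epsilon>) = \<kappa> / 4" using C1 by (simp add: \<epsilon>_def)
  have fe: "lp_bounded (5/4) f \<epsilon>" "lp_bounded (5/4) g \<epsilon>" using f g by (simp_all add: \<epsilon>_def)
  \<comment> \<open>Both norms come out at \<kappa>/4 from the data plus \<kappa>/4 from the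
    nonlinearity, half of what was assumed.\<close>
  have improve: "small_profile (\<kappa> / 2) T (u T)" if T: "T \<ge> 0" and sp: "\<And>s. 0 \<le> s \<Longrightarrow> s \<le> T \<Longrightarrow> small_profile \<kappa> s (u s)" for T
  proof -
    have e5: "(5 - 2) / (3 * 5) = (1 / 5 :: real)" by simp
    have l5: "lp_bounded 5 (u s) (\<kappa> * (1 + s) powr (- ((5 - 2) / (3 * 5))))" if "0 \<le> s" "s \<le> T" for s
      using sp[OF that] unfolding e5 by (simp add: small_profile_def)
    have "lp_bounded 5 (u T) ((C * (\<epsilon> + \<epsilon>) + \<kappa> / 4) * (1 + T) powr (- ((5 - 2) / (3 * 5))))"
      by (rule step[OF p5 T sp fe _ l5]) (use k in auto)
    then have 1: "lp_bounded 5 (u T) (\<kappa> / 2 * (1 + T) powr (-1/5))" unfolding Ce e5 by simp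
    have "cmod (u T n) \<le> C * (\<epsilon> + \<epsilon> + 4 / \<delta> * (\<kappa> powr (2 * \<sigma>) * \<kappa>)) * (1 + T) powr (-1/4)" for n
      by (rule duhamel_sup[OF C d(1) T sol init _ fe])
        (use sup sp force[OF p5 _ _ less_imp_le[OF k(1)] l5] k in \<open>auto intro!: mult_nonneg_nonneg\<close>)
    moreover have "C * (\<epsilon> + \<epsilon> + 4 / \<delta> * (\<kappa> powr (2 * \<sigma>) * \<kappa>)) \<le> \<kappa> / 2"
      using kk[of \<kappa>] k Ce unfolding distrib_left[of C "\<epsilon> + \<epsilon>"] by linarith
    then have "C * (\<epsilon> + \<epsilon> + 4 / \<delta> * (\<kappa> powr (2 * \<sigma>) * \<kappa>)) * (1 + T) powr (-1/4) \<le> \<kappa> / 2 * (1 + T) powr (-1/4)"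
      by (rule mult_right_mono) simp
    ultimately have 2: "cmod (u T n) \<le> \<kappa> / 2 * (1 + T) powr (-1/4)" for n by (meson order_trans)
    show ?thesis unfolding small_profile_def using 1 2 by blast
  qed
  have small: "small_profile \<kappa> t (u t)" if "t \<ge> 0" for t
  proof (rule forward_induction[OF _ _ that])
    fix t :: real assume t: "t \<ge> 0" and before: "\<And>s. 0 \<le> s \<Longrightarrow> s < t \<Longrightarrow> small_profile \<kappa> s (u s)"
    show "small_profile \<kappa> t (u t)"
    proof (cases "t = 0")
      case True
      have "\<epsilon> \<le> \<kappa>" using k C1 frac_le[of \<kappa> \<kappa> 1 "8 * C"] by (simp add: \<epsilon>_def)
      moreover have "lp_bounded 5 f \<epsilon>" by (rule lp_bounded_embed[OF fe(1)]) auto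
      ultimately have f5: "lp_bounded 5 f \<kappa>" by (intro lp_bounded_mono[of 5 f \<epsilon> \<kappa>]) simp_all
      then have "cmod (f n) \<le> \<kappa>" for n by (rule lp_bounded_pointwise) simp
      then show ?thesis using f5 unfolding True init small_profile_def by simp
    next
      case False
      then have "t > 0" using t by simp
      then show ?thesis by (rule small_profile_limit[OF _ cu]) (rule before)
    qed
  next
    fix t :: real assume t: "t \<ge> 0" and sp: "\<And>s. 0 \<le> s \<Longrightarrow> s \<le> t \<Longrightarrow> small_profile \<kappa> s (u s)"
    show "\<exists>d>0. \<forall>s. t < s \<longrightarrow> s < t + d \<longrightarrow> small_profile \<kappa> s (u s)"
    proof (rule small_profile_ahead[OF t k(1)])
      show "small_profile (\<kappa> / 2) t (u t)" by (rule improve[OF t]) (rule sp)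
      show "lp_bounded 2 (\<lambda>n. u s n - u t n) (\<epsilon> * exp ((5 + L) * (t + 1)) * (s - t))" if "t \<le> s" "s \<le> t + 1" for s
        by (rule lip[OF t that])
    qed
  qed
  have decay: "lp_bounded p (u t) (2 * C * (Nf + Ng) * (1 + t) powr (- ((p - 2) / (3 * p))))"
    if p: "2 \<le> p" "p \<le> 5" "1 / p + 1 / q = 1" and t: "t \<ge> 0" and fg: "lp_bounded q f Nf" "lp_bounded q g Ng" for p q t Nf Ng
  proof -
    define \<alpha> where "\<alpha> = (p - 2) / (3 * p)"
    define N where "N = C * (Nf + Ng)"
    have N0: "N \<ge> 0" using C1 lp_bounded_nonneg[OF fg(1)] lp_bounded_nonneg[OF fg(2)] by (simp add: N_def)
    have al: "\<alpha> \<ge> 0" unfolding \<alpha>_def using p by simp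
    \<comment> \<open>A crude starting bound on [0, t] from the exponential l^2 growth. It depends
      on t, but each round of \<open>step\<close> divides its excess by 4 while 2 N is kept, since N
      + (2 N)/4 \<le> 2 N; in the limit it disappears.\<close>
    define M0 where "M0 = \<epsilon> * exp ((5 + L) * t) * (1 + t) powr \<alpha>"
    have M0: "M0 \<ge> 0" using e0 by (simp add: M0_def)
    have iter: "lp_bounded p (u s) ((2 * N + M0 / 4 ^ j) * (1 + s) powr (- \<alpha>))" if "0 \<le> s" "s \<le> t" for s j
      using that
    proof (induction j arbitrary: s)
      case 0
      have "lp_bounded p (u s) (\<epsilon> * exp ((5 + L) * t))"
        by (rule lp_bounded_embed[OF l2(1)[OF 0]]) (use p in auto)
      then show ?case
      proof (rule lp_bounded_mono)
        have "(1 + s) powr \<alpha> * (1 + s) powr (- \<alpha>) = 1" using 0 by (simp add: powr_minus)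
        moreover have "(1 + s) powr \<alpha> * (1 + s) powr (- \<alpha>) \<le> (1 + t) powr \<alpha> * (1 + s) powr (- \<alpha>)"
          using 0 al by (intro mult_right_mono powr_mono2) auto
        ultimately have "1 \<le> (1 + t) powr \<alpha> * (1 + s) powr (- \<alpha>)" by simp
        then have "\<epsilon> * exp ((5 + L) * t) * 1 \<le> \<epsilon> * exp ((5 + L) * t) * ((1 + t) powr \<alpha> * (1 + s) powr (- \<alpha>))"
          using e0 by (intro mult_left_mono) auto
        also have "\<dots> = M0 * (1 + s) powr (- \<alpha>)" by (simp add: M0_def)
        also have "\<dots> \<le> (2 * N + M0 / 4 ^ 0) * (1 + s) powr (- \<alpha>)" using N0 by (intro mult_right_mono) auto
        finally show "\<epsilon> * exp ((5 + L) * t) \<le> (2 * N + M0 / 4 ^ 0) * (1 + s) powr (- \<alpha>)" by simp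
      qed (use p in auto)
    next
      case (Suc j)
      have Mj: "2 * N + M0 / 4 ^ j \<ge> 0" using N0 M0 by simp
      have "lp_bounded p (u s) ((C * (Nf + Ng) + (2 * N + M0 / 4 ^ j) / 4) * (1 + s) powr (- ((p - 2) / (3 * p))))"
      proof (rule step[OF p Suc.prems(1) small fg Mj])
        fix r assume r: "0 \<le> r" "r \<le> s"
        show "lp_bounded p (u r) ((2 * N + M0 / 4 ^ j) * (1 + r) powr (- ((p - 2) / (3 * p))))"
          using Suc.IH[of r] r Suc.prems by (simp add: \<alpha>_def)
      qed
      then show ?case
        unfolding N_def[symmetric] \<alpha>_def[symmetric]
      proof (rule lp_bounded_mono)
        have "N + (2 * N + M0 / 4 ^ j) / 4 \<le> 2 * N + M0 / 4 ^ Suc j" using N0 by (simp add: add_divide_distrib)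
        then show "(N + (2 * N + M0 / 4 ^ j) / 4) * (1 + s) powr (- \<alpha>) \<le> (2 * N + M0 / 4 ^ Suc j) * (1 + s) powr (- \<alpha>)"
          by (rule mult_right_mono) simp
      qed (use p in auto)
    qed
    have "(\<lambda>j. (2 * N + M0 * (1/4) ^ j) * (1 + t) powr (- \<alpha>)) \<longlonglongrightarrow> (2 * N + M0 * 0) * (1 + t) powr (- \<alpha>)"
      by (intro tendsto_intros LIMSEQ_realpow_zero) auto
    then have "lp_bounded p (u t) ((2 * N + M0 * 0) * (1 + t) powr (- \<alpha>))"
    proof (rule lp_bounded_limit)
      show "lp_bounded p (u t) ((2 * N + M0 * (1/4) ^ j) * (1 + t) powr (- \<alpha>))" for j
        using iter[OF t order_refl, of j] by (simp add: power_one_over)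
    qed (use p in auto)
    then show ?thesis by (simp add: N_def \<alpha>_def mult.assoc)
  qed
  \<comment> \<open>The profile keeps |u| \<le> \<kappa> \<le> 1, where the truncated and the
    original nonlinearity agree.\<close>
  have Fn: "F (u t n) = of_real a * nlin \<sigma> (u t n)" if "t \<ge> 0" for t n
    using sup[OF that small[OF that], of n] k nlin_trunc(3)[OF s2, of "u t n"] by (simp add: F_def)
  have sol': "forced_solution (\<lambda>s n. - (of_real a * nlin \<sigma> (u s n))) u v"
    using sol Fn unfolding forced_solution_def by simp
  have bd: "\<exists>B. \<forall>t\<in>{0..T}. lp_bounded 2 (u t) B \<and> lp_bounded 2 (v t) B \<and> lp_bounded 2 (\<lambda>n. u t (n + 1) + u t (n - 1) - 3 * u t n - of_real a * nlin \<sigma> (u t n)) B" for T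
  proof (intro exI ballI conjI)
    fix t assume t: "t \<in> {0..T}"
    let ?B = "\<epsilon> * exp ((5 + L) * T)"
    have u2: "lp_bounded 2 (u t) ?B" and v2: "lp_bounded 2 (v t) ?B" using l2 t by auto
    have le: "?B \<le> (5 + L) * ?B" using L0 mult_right_mono[of 1 "5 + L" ?B] lp_bounded_nonneg[OF u2] by simp
    show "lp_bounded 2 (u t) ((5 + L) * ?B)" "lp_bounded 2 (v t) ((5 + L) * ?B)"
      by (rule lp_bounded_mono[OF u2 le], simp) (rule lp_bounded_mono[OF v2 le], simp)
    have "L2_set (\<lambda>n. cmod (u t (n + 1) + u t (n - 1) - 3 * u t n - of_real a * nlin \<sigma> (u t n))) A \<le> (5 + L) * ?B" if A: "finite A" for A
    proof -
      have "L2_set (\<lambda>n. cmod ((u t (n + 1) + u t (n - 1) - 3 * u t n - F (u t n)) - ((\<lambda>n. 0) (n + 1) + (\<lambda>n. 0) (n - 1) - 3 * (\<lambda>n. 0) n - F ((\<lambda>n. 0) n)))) A \<le> (5 + L) * ?B"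
        by (rule L2_set_rhs[OF F(1) L0 _ A]) (use u2 in \<open>simp add: lp_bounded_2_iff\<close>)
      then show ?thesis using Fn t F(2) by simp
    qed
    then show "lp_bounded 2 (\<lambda>n. u t (n + 1) + u t (n - 1) - 3 * u t n - of_real a * nlin \<sigma> (u t n)) ((5 + L) * ?B)"
      using lp_bounded_nonneg[OF u2] le by (simp add: lp_bounded_2_iff)
  qed
  show ?thesis
  proof (intro exI[of _ u] conjI)
    show "dnkg_solution a \<sigma> u" by (rule forced_dnkg(1)[OF sol' bd])
    show "time_deriv u 0 = g" using forced_dnkg(2)[OF sol' bd, of 0] init by simp
  qed (use init decay in blast)+
qed

section \<open>Standing waves and the theorem\<close>

lemma standing_wave_trivial:
  fixes \<Lambda> K :: real
  assumes "\<And>t. t > 0 \<Longrightarrow> cmod (exp (\<i> * of_real (\<Lambda> * t)) * z) \<le> K * t powr (-1/5)"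
  shows "z = 0"
proof -
  have "((\<lambda>t. K * t powr (-1/5)) \<longlongrightarrow> K * 0) at_top"
    by (intro tendsto_intros tendsto_neg_powr filterlim_ident) auto
  moreover have "\<forall>\<^sub>F t in at_top. cmod z \<le> K * t powr (-1/5)"
    using eventually_gt_at_top[of "0::real"]
  proof eventually_elim
    case (elim t)
    have "cmod (exp (\<i> * of_real (\<Lambda> * t)) * z) = cmod z"
      by (simp add: norm_mult)
    then show ?case using assms[OF elim] by simp
  qed
  ultimately have "cmod z \<le> K * 0"
    by (intro tendsto_lowerbound) auto
  then show ?thesis by simp
qed

text \<open>The bound carries the norm of the initial velocity besides that of the initial position:
  for f = 0 and g \<noteq> 0 a bound by f alone would force u = 0 at all positive times,
  contradicting the velocity g. The clause on \<open>w\<close> is uniqueness in the energy class,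
  which gives sense to "the solution".\<close>

theorem theorem6:
  fixes \<sigma> :: real
  assumes "\<sigma> > 2"
  shows "\<exists>\<epsilon>>0. \<exists>C::real. \<forall>a\<in>{1, -1::real}.
    (\<forall>f\<in>lp_ball (5/4) \<epsilon>. \<forall>g\<in>lp_ball (5/4) \<epsilon>.
       \<exists>u. dnkg_solution a \<sigma> u \<and> u 0 = f \<and> time_deriv u 0 = g \<and>
         (\<forall>w. dnkg_solution a \<sigma> w \<and> w 0 = f \<and> time_deriv w 0 = g \<longrightarrow> (\<forall>t\<ge>0. w t = u t)) \<and>
         (\<forall>p q t. 2 \<le> p \<and> p \<le> 5 \<and> 1 / p + 1 / q = 1 \<and> t > 0 \<longrightarrow>
            u t \<in> lp_space p \<and>
            lp_norm p (u t) \<le> C * t powr (- (p - 2) / (3 * p)) * (lp_norm q f + lp_norm q g))) \<and>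
    \<not> (\<exists>(\<Lambda>::real) \<phi> u. u = (\<lambda>t n. exp (\<i> * of_real (\<Lambda> * t)) * \<phi> n) \<and> \<phi> \<noteq> (\<lambda>n. 0) \<and>
         dnkg_solution a \<sigma> u \<and> u 0 \<in> lp_ball (5/4) \<epsilon> \<and> time_deriv u 0 \<in> lp_ball (5/4) \<epsilon>)"
proof -
  obtain C where C: "dispersive_constant C" using dispersive_constant_exists by blast
  have C1: "C \<ge> 1" using C by (simp add: dispersive_constant_def)
  define \<delta> where "\<delta> = \<sigma> / 2 - 1"
  have d: "\<delta> > 0" using assms by (simp add: \<delta>_def)
  \<comment> \<open>Since \<kappa> \<le> 1 and 2\<sigma> \<ge> 1, \<kappa>^(2\<sigma>) \<le>
    \<kappa> \<le> \<delta>/(16 C), which makes the Duhamel factor C (4/\<delta>)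
    \<kappa>^(2\<sigma>) at most 1/4.\<close>
  define \<kappa> where "\<kappa> = min 1 (\<delta> / (16 * C))"
  have k: "0 < \<kappa>" "\<kappa> \<le> 1" using d C1 by (simp_all add: \<kappa>_def)
  have k3: "C * (4 / (\<sigma> / 2 - 1) * \<kappa> powr (2 * \<sigma>)) \<le> 1 / 4"
  proof -
    have "\<kappa> powr (2 * \<sigma>) \<le> \<kappa> powr 1" using k assms by (intro powr_mono') auto
    also have "\<dots> \<le> \<delta> / (16 * C)" using k by (simp add: \<kappa>_def)
    finally have "C * (4 / \<delta> * \<kappa> powr (2 * \<sigma>)) \<le> C * (4 / \<delta> * (\<delta> / (16 * C)))"
      using C1 d by (intro mult_left_mono) auto
    also have "\<dots> = 1 / 4" using C1 d by simp
    finally show ?thesis by (simp add: \<delta>_def)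
  qed
  define \<epsilon> where "\<epsilon> = \<kappa> / (8 * C)"
  have e: "\<epsilon> > 0" using k C1 by (simp add: \<epsilon>_def)
  have main: "\<exists>u. dnkg_solution a \<sigma> u \<and> u 0 = f \<and> time_deriv u 0 = g \<and>
         (\<forall>w. dnkg_solution a \<sigma> w \<and> w 0 = f \<and> time_deriv w 0 = g \<longrightarrow> (\<forall>t\<ge>0. w t = u t)) \<and>
         (\<forall>p q t. 2 \<le> p \<and> p \<le> 5 \<and> 1 / p + 1 / q = 1 \<and> t > 0 \<longrightarrow>
            u t \<in> lp_space p \<and>
            lp_norm p (u t) \<le> 2 * C * t powr (- (p - 2) / (3 * p)) * (lp_norm q f + lp_norm q g))"
    if a: "a \<in> {1, -1::real}" and f: "f \<in> lp_ball (5/4) \<epsilon>" and g: "g \<in> lp_ball (5/4) \<epsilon>" for a f g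
  proof -
    have ball: "lp_bounded (5/4) x \<epsilon>" if "x \<in> lp_ball (5/4) \<epsilon>" for x
    proof -
      have "x \<in> lp_space (5/4)" "lp_norm (5/4) x \<le> \<epsilon>" using that by (auto simp: lp_ball_def)
      then have "lp_bounded (5/4) x (lp_norm (5/4) x)" by (intro lp_bounded_lp_norm) auto
      then show ?thesis by (rule lp_bounded_mono) (use \<open>lp_norm (5/4) x \<le> \<epsilon>\<close> in auto)
    qed
    have nq: "lp_bounded q x (lp_norm q x)" if "x \<in> lp_ball (5/4) \<epsilon>" "5/4 \<le> q" for x q
    proof -
      have "lp_bounded q x \<epsilon>" by (rule lp_bounded_embed[OF ball[OF that(1)]]) (use that in auto)
      then have "x \<in> lp_space q" by (rule lp_boundedI_norm(1)) (use that in auto)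
      then show ?thesis by (rule lp_bounded_lp_norm) (use that in auto)
    qed
    have a1: "\<bar>a\<bar> = 1" using a by auto
    obtain u where u: "dnkg_solution a \<sigma> u" "u 0 = f" "time_deriv u 0 = g"
      and dec: "\<forall>p q t Nf Ng. 2 \<le> p \<and> p \<le> 5 \<and> 1 / p + 1 / q = 1 \<and> t \<ge> 0 \<and> lp_bounded q f Nf \<and> lp_bounded q g Ng \<longrightarrow>
       lp_bounded p (u t) (2 * C * (Nf + Ng) * (1 + t) powr (- ((p - 2) / (3 * p))))"
      using global_small_solution[OF assms C k k3 a1 ball[OF f, unfolded \<epsilon>_def] ball[OF g, unfolded \<epsilon>_def]]
      by (elim exE conjE)
    show ?thesis
    proof (intro exI[of _ u] conjI u allI impI; elim conjE)
      fix w t assume w: "dnkg_solution a \<sigma> w" "w 0 = f" "time_deriv w 0 = g" "(0::real) \<le> t"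
      show "w t = u t"
        by (rule dnkg_unique[OF u(1) w(1) _ _ _ w(4)]) (simp_all only: w(2,3) u(2,3), use assms in simp)
    next
      fix p q t :: real assume p: "2 \<le> p" "p \<le> 5" "1 / p + 1 / q = 1" and t: "t > 0"
      note q = conjugate_exponent(1)[OF p]
      have nf: "lp_bounded q f (lp_norm q f)" and ng: "lp_bounded q g (lp_norm q g)" by (rule nq[OF f q], rule nq[OF g q])
      have B: "lp_bounded p (u t) (2 * C * (lp_norm q f + lp_norm q g) * (1 + t) powr (- ((p - 2) / (3 * p))))"
        by (rule dec[rule_format, where q=q]) (intro conjI p nf ng less_imp_le[OF t])
      show "u t \<in> lp_space p" by (rule lp_boundedI_norm(1)[OF B]) (use p in auto)
      have "lp_norm p (u t) \<le> 2 * C * (lp_norm q f + lp_norm q g) * (1 + t) powr (- ((p - 2) / (3 * p)))"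
        by (rule lp_boundedI_norm(2)[OF B]) (use p in auto)
      also have "\<dots> \<le> 2 * C * (lp_norm q f + lp_norm q g) * t powr (- ((p - 2) / (3 * p)))"
        using t p C1 lp_bounded_nonneg[OF nf] lp_bounded_nonneg[OF ng] by (intro mult_left_mono powr_mono2') auto
      also have "- ((p - 2) / (3 * p)) = - (p - 2) / (3 * p)" by (rule minus_divide_left)
      finally show "lp_norm p (u t) \<le> 2 * C * t powr (- (p - 2) / (3 * p)) * (lp_norm q f + lp_norm q g)"
        by (simp only: mult_ac)
    qed
  qed
  have nowave: False if a: "a \<in> {1, -1::real}" and ph: "\<phi> \<noteq> (\<lambda>n. 0)"
    and w: "dnkg_solution a \<sigma> (\<lambda>t n. exp (\<i> * of_real (\<Lambda> * t)) * \<phi> n)"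
    and f: "(\<lambda>t n. exp (\<i> * of_real (\<Lambda> * t)) * \<phi> n) 0 \<in> lp_ball (5/4) \<epsilon>" and g: "time_deriv (\<lambda>t n. exp (\<i> * of_real (\<Lambda> * t)) * \<phi> n) 0 \<in> lp_ball (5/4) \<epsilon>" for a \<Lambda> \<phi>
  proof -
    let ?w = "\<lambda>t n. exp (\<i> * of_real (\<Lambda> * t)) * \<phi> n"
    from main[OF a f g] obtain u where
      uniq: "\<forall>w. dnkg_solution a \<sigma> w \<and> w 0 = ?w 0 \<and> time_deriv w 0 = time_deriv ?w 0 \<longrightarrow> (\<forall>t\<ge>0. w t = u t)"
      and dec: "\<forall>p q t. 2 \<le> p \<and> p \<le> 5 \<and> 1 / p + 1 / q = 1 \<and> t > 0 \<longrightarrow> u t \<in> lp_space p \<and>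
            lp_norm p (u t) \<le> 2 * C * t powr (- (p - 2) / (3 * p)) * (lp_norm q (?w 0) + lp_norm q (time_deriv ?w 0))"
      by (elim exE conjE)
    \<comment> \<open>Decay is known for the constructed solution; uniqueness transfers it to the
      wave, whose modulus at each site does not change in time.\<close>
    have eq: "u t = ?w t" if "t \<ge> 0" for t
      using uniq[rule_format, of ?w t] w that by simp
    define K where "K = 2 * C * (lp_norm (5/4) (?w 0) + lp_norm (5/4) (time_deriv ?w 0))"
    have "\<phi> n = 0" for n
    proof (rule standing_wave_trivial)
      fix t :: real assume t: "t > 0"
      have D: "u t \<in> lp_space 5 \<and> lp_norm 5 (u t) \<le> 2 * C * t powr (- (5 - 2) / (3 * 5)) * (lp_norm (5/4) (?w 0) + lp_norm (5/4) (time_deriv ?w 0))"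
        by (rule dec[rule_format, where q="5/4"]) (use t in simp)
      have "cmod (u t n) \<le> lp_norm 5 (u t)"
        by (rule lp_bounded_pointwise[OF lp_bounded_lp_norm]) (use D in auto)
      also have "\<dots> \<le> K * t powr (-1/5)"
      proof -
        have e5: "- (5 - 2) / (3 * 5) = (-1/5 :: real)" by simp
        show ?thesis using conjunct2[OF D] unfolding K_def e5 by (simp only: mult_ac)
      qed
      finally show "cmod (exp (\<i> * of_real (\<Lambda> * t)) * \<phi> n) \<le> K * t powr (-1/5)"
        using eq[of t] t by simp
    qed
    then show False using ph by auto
  qed
  show ?thesis
  proof (rule exI[of _ \<epsilon>], intro conjI e, rule exI[of _ "2 * C"], intro conjI ballI)
    fix a :: real and f g assume "a \<in> {1, -1}" "f \<in> lp_ball (5/4) \<epsilon>" "g \<in> lp_ball (5/4) \<epsilon>"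
    then show "\<exists>u. dnkg_solution a \<sigma> u \<and> u 0 = f \<and> time_deriv u 0 = g \<and>
         (\<forall>w. dnkg_solution a \<sigma> w \<and> w 0 = f \<and> time_deriv w 0 = g \<longrightarrow> (\<forall>t\<ge>0. w t = u t)) \<and>
         (\<forall>p q t. 2 \<le> p \<and> p \<le> 5 \<and> 1 / p + 1 / q = 1 \<and> t > 0 \<longrightarrow>
            u t \<in> lp_space p \<and>
            lp_norm p (u t) \<le> 2 * C * t powr (- (p - 2) / (3 * p)) * (lp_norm q f + lp_norm q g))"
      by (rule main)
  next
    fix a :: real assume a: "a \<in> {1, -1}"
    show "\<not> (\<exists>(\<Lambda>::real) \<phi> u. u = (\<lambda>t n. exp (\<i> * of_real (\<Lambda> * t)) * \<phi> n) \<and> \<phi> \<noteq> (\<lambda>n. 0) \<and>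
         dnkg_solution a \<sigma> u \<and> u 0 \<in> lp_ball (5/4) \<epsilon> \<and> time_deriv u 0 \<in> lp_ball (5/4) \<epsilon>)"
    proof (rule notI, elim exE conjE)
      fix \<Lambda> :: real and \<phi> u
      assume eq: "u = (\<lambda>t n. exp (\<i> * of_real (\<Lambda> * t)) * \<phi> n)" and ph: "\<phi> \<noteq> (\<lambda>n. 0)"
        and "dnkg_solution a \<sigma> u" "u 0 \<in> lp_ball (5/4) \<epsilon>" "time_deriv u 0 \<in> lp_ball (5/4) \<epsilon>"
      then show False using nowave[OF a ph] unfolding eq by blast
    qed
  qed
qed

end
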